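(* Let $n$ be a positive integer and let $A \in W^{n-1,q}(D)$ with $q > 2$. Then every solution $w$ on $D$ of \[ \left( \frac{\partial}{\partial\bar z} - A\right)^n w = 0 \] has the form \[ w(z) = e^{\psi(z)}\sum_{k=0}^{n-1} \bar z^k w_k(z), \] where \[ \psi(z) = -\frac{1}{\pi} \iint_D \frac{A(\zeta)}{\zeta - z}\,d\xi\,d\eta \qquad (\zeta = \xi + i\eta) \] and $w_k \in H(D)$ for every $k$, $0 \le k \le n-1$.
   Context: $D$ is the open unit disk in $\mathbb{C}$. $H(D)$ is the set of holomorphic functions $f: D \to \mathbb{C}$. $W^{k,q}(D)$ is the Sobolev space of (complex-valued) $L^q(D)$ functions with $k$ weak derivatives which are all in $L^q(D)$ (so $W^{0,q}(D)=L^q(D)$). $\left(\frac{\partial}{\partial\bar z} - A\right)^n$ is the $n$-fold composition of the first-order operator $w \mapsto \frac{\partial w}{\partial \bar z} - A w$. *)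

theory Defs
  imports "HOL-Complex_Analysis.Complex_Analysis"
begin

abbreviation unit_disk :: "complex set" where
  "unit_disk \<equiv> ball 0 1"

text \<open>
  Throughout, the plane is \<^typ>\<open>complex\<close> regarded as a two-dimensional real vector space,
  with coordinate directions \<open>1\<close> (for \<open>x\<close>) and \<open>\<i>\<close> (for \<open>y\<close>). Functions on an open set \<open>\<Omega>\<close>
  are total functions of which only the values on \<open>\<Omega>\<close> matter, up to null sets.
\<close>

definition dir_deriv :: "complex \<Rightarrow> (complex \<Rightarrow> complex) \<Rightarrow> complex \<Rightarrow> complex" where
  "dir_deriv v f = (\<lambda>z. frechet_derivative f (at z) v)"

definition dbar :: "(complex \<Rightarrow> complex) \<Rightarrow> complex \<Rightarrow> complex" where
  "dbar f = (\<lambda>z. (dir_deriv 1 f z + \<i> * dir_deriv \<i> f z) / 2)"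

primrec class_C :: "nat \<Rightarrow> (complex \<Rightarrow> complex) \<Rightarrow> bool" where
  "class_C 0 f \<longleftrightarrow> continuous_on UNIV f"
| "class_C (Suc k) f \<longleftrightarrow> f differentiable_on UNIV \<and>
     class_C k (dir_deriv 1 f) \<and> class_C k (dir_deriv \<i> f)"

definition test_functions :: "complex set \<Rightarrow> (complex \<Rightarrow> complex) set" where
  "test_functions \<Omega> = {\<phi>. (\<forall>k. class_C k \<phi>) \<and>
     (\<exists>K. compact K \<and> K \<subseteq> \<Omega> \<and> (\<forall>z. z \<notin> K \<longrightarrow> \<phi> z = 0))}"

definition locally_integrable_on :: "(complex \<Rightarrow> complex) \<Rightarrow> complex set \<Rightarrow> bool"
    (infix "locally'_integrable'_on" 50) where
  "f locally_integrable_on \<Omega> \<longleftrightarrow>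
     (\<forall>K. compact K \<and> K \<subseteq> \<Omega> \<longrightarrow> f absolutely_integrable_on K)"

definition Lspace :: "real \<Rightarrow> complex set \<Rightarrow> (complex \<Rightarrow> complex) set" where
  "Lspace q \<Omega> = {f. f \<in> borel_measurable (lebesgue_on \<Omega>) \<and>
     integrable (lebesgue_on \<Omega>) (\<lambda>z. norm (f z) powr q)}"

text \<open>\<open>g\<close> is the weak derivative \<open>\<partial>\<^sub>x\<^sup>a \<partial>\<^sub>y\<^sup>b f\<close> on \<open>\<Omega>\<close>.\<close>

definition has_weak_partial ::
    "complex set \<Rightarrow> nat \<Rightarrow> nat \<Rightarrow> (complex \<Rightarrow> complex) \<Rightarrow> (complex \<Rightarrow> complex) \<Rightarrow> bool" where
  "has_weak_partial \<Omega> a b f g \<longleftrightarrow>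
     f locally_integrable_on \<Omega> \<and> g locally_integrable_on \<Omega> \<and>
     (\<forall>\<phi>\<in>test_functions \<Omega>.
        (LINT z:\<Omega>|lebesgue. f z * (dir_deriv 1 ^^ a) ((dir_deriv \<i> ^^ b) \<phi>) z)
        = (- 1) ^ (a + b) * (LINT z:\<Omega>|lebesgue. g z * \<phi> z))"

definition sobolev :: "nat \<Rightarrow> real \<Rightarrow> complex set \<Rightarrow> (complex \<Rightarrow> complex) set" where
  "sobolev k q \<Omega> = {f \<in> Lspace q \<Omega>.
     \<forall>a b. a + b \<le> k \<longrightarrow> (\<exists>g\<in>Lspace q \<Omega>. has_weak_partial \<Omega> a b f g)}"

text \<open>\<open>g\<close> is the weak (Sobolev) derivative of \<open>f\<close> with respect to \<open>cnj z\<close> on \<open>\<Omega>\<close>. The separate weak derivatives of \<open>f\<close>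
  in \<open>x\<close> and \<open>y\<close> need not be functions.\<close>

definition has_weak_dbar ::
    "complex set \<Rightarrow> (complex \<Rightarrow> complex) \<Rightarrow> (complex \<Rightarrow> complex) \<Rightarrow> bool" where
  "has_weak_dbar \<Omega> f g \<longleftrightarrow>
     f locally_integrable_on \<Omega> \<and> g locally_integrable_on \<Omega> \<and>
     (\<forall>\<phi>\<in>test_functions \<Omega>.
        (LINT z:\<Omega>|lebesgue. f z * dbar \<phi> z) = - (LINT z:\<Omega>|lebesgue. g z * \<phi> z))"

text \<open>
  The graph of the operator \<open>w \<mapsto> dbar w - A w\<close>, with the derivative in the weak sense. It is a
  relation because the value is determined only almost everywhere; its relational power \<open>^^ n\<close>
  is the graph of the \<open>n\<close>-fold composition, and contains exactly those \<open>w\<close> to which the operator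
  can be applied \<open>n\<close> times in succession with the intermediate results locally integrable.
\<close>

definition dbar_minus ::
    "complex set \<Rightarrow> (complex \<Rightarrow> complex) \<Rightarrow> (complex \<Rightarrow> complex) \<Rightarrow> (complex \<Rightarrow> complex) \<Rightarrow> bool" where
  "dbar_minus \<Omega> A w v \<longleftrightarrow>
     (\<exists>g. has_weak_dbar \<Omega> w g \<and> (AE z in lebesgue_on \<Omega>. v z = g z - A z * w z))"

definition is_solution ::
    "complex set \<Rightarrow> nat \<Rightarrow> (complex \<Rightarrow> complex) \<Rightarrow> (complex \<Rightarrow> complex) \<Rightarrow> bool" where
  "is_solution \<Omega> n A w \<longleftrightarrow> (dbar_minus \<Omega> A ^^ n) w (\<lambda>_. 0)"

definition psi :: "(complex \<Rightarrow> complex) \<Rightarrow> complex \<Rightarrow> complex" where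
  "psi A z = - (1 / of_real pi) * (LINT \<zeta>:unit_disk|lebesgue. A \<zeta> / (\<zeta> - z))"

end

theory Submission
  imports Defs
begin

text \<open>
  The operator \<open>C f z = - (1 / \<pi>) \<integral> f \<zeta> / (\<zeta> - z)\<close> is a right inverse of \<open>dbar\<close>, and \<open>psi A = C A\<close>. Since \<open>q > 2\<close>,
  the integral of \<open>\<bar>A \<zeta>\<bar> / \<bar>\<zeta> - z\<bar>\<close> is bounded uniformly in \<open>z\<close>, which makes
  Fubini's theorem applicable to \<open>\<integral> C A \<cdot> G = - \<integral> A \<cdot> C G\<close> for every integrable \<open>G\<close>.
  If \<open>v\<close> has the weak derivative \<open>b\<close> and \<open>\<phi>\<close> is a test function, then \<open>v \<phi> = C G\<close> almost everywhere, where
  \<open>G = v dbar \<phi> + b \<phi>\<close>, so that \<open>\<integral> C A \<cdot> G = - \<integral> A v \<phi>\<close>. This is the product rule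
  \<open>dbar (C A \<cdot> v) = A v + C A \<cdot> b\<close>, obtained without any regularization. Iterating it and summing the exponential
  series gives \<open>dbar (exp (- psi A) w) = exp (- psi A) (dbar w - A w)\<close>. Hence \<open>exp (- psi A) w\<close> is annihilated by
  \<open>dbar ^ n\<close>, and Weyl's lemma for \<open>dbar\<close> yields the polynomial in \<open>cnj z\<close> by induction on \<open>n\<close>.
\<close>

section \<open>Smooth functions\<close>

text \<open>Fubini's theorem moves the transform from \<open>A\<close> to the integrable function
  \<open>G\<close>, and the identity \<open>cauchy G = v \<phi>\<close> needs smoothness only of the
  transforms of test functions. The product rule handles one factor \<open>cauchy a\<close> at a
  time. The exponential is not presented as such a transform, hence the detour through powers and
  partial sums, whose limit is dominated with the constant \<open>exp M\<close>. The exponent enters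
  through the conjugate exponent \<open>p = q / (q - 1)\<close>: \<open>q > 2\<close> means
  \<open>p < 2\<close>, so that the power \<open>- p\<close> of the distance is integrable over
  bounded sets of the plane. Weyl's lemma is the case \<open>b = 0\<close> of the same identity with
  a cutoff as \<open>\<phi>\<close>: where the cutoff is constant, \<open>G\<close> vanishes and
  \<open>cauchy G\<close> is holomorphic.\<close>

lemma dir_deriv_eq: "(f has_derivative f') (at z) \<Longrightarrow> dir_deriv v f z = f' v"
  unfolding dir_deriv_def by (metis frechet_derivative_at)

lemma differentiable_imp_has_derivative_dir_deriv:
  "f differentiable (at z) \<Longrightarrow> (f has_derivative (\<lambda>v. dir_deriv v f z)) (at z)"
  unfolding dir_deriv_def by (metis eta_contract_eq frechet_derivative_works)

lemma differentiable_on_UNIV_dir_deriv: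
  "f differentiable_on UNIV \<Longrightarrow> (f has_derivative (\<lambda>v. dir_deriv v f z)) (at z)"
  by (simp add: differentiable_imp_has_derivative_dir_deriv differentiable_on_def)

lemma dir_deriv_coords:
  assumes "f differentiable (at z)"
  shows "dir_deriv v f z = of_real (Re v) * dir_deriv 1 f z + of_real (Im v) * dir_deriv \<i> f z"
proof -
  interpret linear "\<lambda>v. dir_deriv v f z"
    using differentiable_imp_has_derivative_dir_deriv[OF assms] has_derivative_linear by blast
  have "v = Re v *\<^sub>R 1 + Im v *\<^sub>R \<i>"
    by (simp add: complex_eq_iff)
  then have "dir_deriv v f z = dir_deriv (Re v *\<^sub>R 1 + Im v *\<^sub>R \<i>) f z" by simp
  also have "\<dots> = Re v *\<^sub>R dir_deriv 1 f z + Im v *\<^sub>R dir_deriv \<i> f z"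
    by (simp only: add scaleR)
  finally show ?thesis by (simp add: scaleR_conv_of_real)
qed

lemma class_C_SucD: "class_C (Suc k) f \<Longrightarrow> class_C k f"
proof (induction k arbitrary: f)
  case 0
  then show ?case by (auto intro: differentiable_imp_continuous_on)
next
  case (Suc k)
  then show ?case by (metis class_C.simps(2))
qed

abbreviation smooth :: "(complex \<Rightarrow> complex) \<Rightarrow> bool" where
  "smooth f \<equiv> \<forall>k. class_C k f"

lemma smooth_iff:
  "smooth f \<longleftrightarrow> f differentiable_on UNIV \<and> smooth (dir_deriv 1 f) \<and> smooth (dir_deriv \<i> f)"
  by (metis class_C.simps(2) class_C_SucD)

lemma smooth_differentiable_on: "smooth f \<Longrightarrow> f differentiable_on UNIV"
  using smooth_iff by blast

lemma smooth_differentiable: "smooth f \<Longrightarrow> f differentiable (at z)"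
  using smooth_differentiable_on[of f] by (simp add: differentiable_on_def)

lemma smooth_continuous_on: "smooth f \<Longrightarrow> continuous_on S f"
  using differentiable_imp_continuous_on[OF smooth_differentiable_on] continuous_on_subset by blast

lemma class_C_const [simp]: "class_C k (\<lambda>z. c)"
proof (induction k arbitrary: c)
  case (Suc k)
  have "dir_deriv v (\<lambda>z. c) = (\<lambda>z. 0)" for v
    by (auto simp: fun_eq_iff intro!: dir_deriv_eq)
  with Suc show ?case by simp
qed auto

lemma class_C_add:
  "class_C k f \<Longrightarrow> class_C k g \<Longrightarrow> class_C k (\<lambda>z. f z + g z)"
proof (induction k arbitrary: f g)
  case (Suc k)
  have "dir_deriv v (\<lambda>z. f z + g z) = (\<lambda>z. dir_deriv v f z + dir_deriv v g z)" for v
    using Suc.prems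
    by (auto simp: fun_eq_iff intro!: dir_deriv_eq derivative_eq_intros differentiable_on_UNIV_dir_deriv)
  with Suc show ?case by (auto intro: differentiable_on_add)
qed (auto intro: continuous_intros)

lemma differentiable_on_mult_UNIV:
  fixes f g :: "complex \<Rightarrow> complex"
  shows "f differentiable_on UNIV \<Longrightarrow> g differentiable_on UNIV \<Longrightarrow> (\<lambda>z. f z * g z) differentiable_on UNIV"
  by (auto simp: differentiable_on_def)

lemma dir_deriv_mult:
  assumes "f differentiable (at z)" "g differentiable (at z)"
  shows "dir_deriv v (\<lambda>z. f z * g z) z = f z * dir_deriv v g z + dir_deriv v f z * g z"
  by (rule dir_deriv_eq)
     (rule has_derivative_mult[OF assms[THEN differentiable_imp_has_derivative_dir_deriv]])

lemma class_C_mult: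
  "class_C k f \<Longrightarrow> class_C k g \<Longrightarrow> class_C k (\<lambda>z. f z * g z)"
proof (induction k arbitrary: f g)
  case (Suc k)
  have "dir_deriv v (\<lambda>z. f z * g z) = (\<lambda>z. f z * dir_deriv v g z + dir_deriv v f z * g z)" for v
    using Suc.prems by (auto simp: fun_eq_iff differentiable_on_def intro!: dir_deriv_mult)
  moreover have "class_C k f" "class_C k g"
    by (rule Suc.prems[THEN class_C_SucD])+
  ultimately show ?case
    using Suc by (auto intro!: differentiable_on_mult_UNIV class_C_add)
qed (auto intro: continuous_intros)

lemma class_C_bounded_linear:
  assumes "bounded_linear f"
  shows "class_C k f"
proof (cases k)
  case 0
  then show ?thesis using assms by (simp add: linear_continuous_on)
next
  case (Suc m)
  have d: "(f has_derivative f) (at z)" for z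
    using assms by (rule bounded_linear_imp_has_derivative)
  have eq: "dir_deriv v f = (\<lambda>z. f v)" for v
    by (rule ext) (rule dir_deriv_eq[OF d])
  have "f differentiable_on UNIV"
    unfolding differentiable_on_def differentiable_def using d by blast
  then show ?thesis
    unfolding Suc class_C.simps eq by (intro conjI class_C_const)
qed

lemma has_derivative_inverse_dir_deriv:
  "f differentiable_on UNIV \<Longrightarrow> f z \<noteq> 0 \<Longrightarrow> ((\<lambda>z. inverse (f z)) has_derivative
      (\<lambda>v. - (inverse (f z) * dir_deriv v f z * inverse (f z)))) (at z)"
  by (rule Deriv.has_derivative_inverse[OF _ differentiable_on_UNIV_dir_deriv])

lemma class_C_inverse:
  "class_C k f \<Longrightarrow> (\<And>z. f z \<noteq> 0) \<Longrightarrow> class_C k (\<lambda>z. inverse (f z))"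
proof (induction k arbitrary: f)
  case 0
  then show ?case unfolding class_C.simps by (intro continuous_on_inverse) auto
next
  case (Suc k)
  have f: "f differentiable_on UNIV" "class_C k (dir_deriv 1 f)" "class_C k (dir_deriv \<i> f)"
    using Suc.prems(1) by simp_all
  note d = has_derivative_inverse_dir_deriv[OF f(1) Suc.prems(2)]
  have eq: "dir_deriv v (\<lambda>z. inverse (f z)) =
      (\<lambda>z. (- 1) * (inverse (f z) * dir_deriv v f z * inverse (f z)))" for v
    by (intro ext) (simp add: dir_deriv_eq[OF d])
  have i: "class_C k (\<lambda>z. inverse (f z))"
    by (rule Suc.IH[OF class_C_SucD[OF Suc.prems(1)] Suc.prems(2)])
  have di: "(\<lambda>z. inverse (f z)) differentiable_on UNIV"
    unfolding differentiable_on_def differentiable_def by (intro ballI exI) (rule d)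
  show ?case
    unfolding class_C.simps eq
    by (intro conjI di class_C_mult[OF class_C_const class_C_mult[OF class_C_mult[OF i _] i]] f)
qed

text \<open>Cauchy's flat function \<open>exp (- 1 / t)\<close> with an extra pole of order
  \<open>m\<close>. The parameter makes the family stable under differentiation: the derivative of
  member \<open>m\<close> combines the members \<open>m + 1\<close> and \<open>m + 2\<close>, so
  that smoothness follows by an induction that generalizes over \<open>m\<close>.\<close>

definition flat :: "nat \<Rightarrow> real \<Rightarrow> real" where
  "flat m t = (if t > 0 then (1 / t) ^ m * exp (- (1 / t)) else 0)"

lemma flat_nonneg [simp]: "flat m t \<ge> 0"
  and flat_pos_iff [simp]: "flat m t > 0 \<longleftrightarrow> t > 0"
  and flat_eq_0_iff [simp]: "flat m t = 0 \<longleftrightarrow> t \<le> 0"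
  by (auto simp: flat_def)

lemma flat_tendsto_0: "(flat m \<longlongrightarrow> 0) (at_right 0)"
proof -
  have "filterlim (\<lambda>t::real. inverse t) at_top (at_right 0)"
    by (rule filterlim_inverse_at_top_right)
  from filterlim_compose[OF tendsto_power_div_exp_0[of m] this]
  have "((\<lambda>t::real. inverse t ^ m / exp (inverse t)) \<longlongrightarrow> 0) (at_right 0)" .
  moreover have "\<forall>\<^sub>F t in at_right 0. inverse t ^ m / exp (inverse t) = flat m t"
    using eventually_at_right_less[of "0::real"]
    by eventually_elim (simp add: flat_def exp_minus divide_inverse)
  ultimately show ?thesis
    by (rule Lim_transform_eventually)
qed

lemma flat_has_derivative:
  "(flat m has_real_derivative (flat (m + 2) t - real m * flat (m + 1) t)) (at t)"
proof (cases t "0::real" rule: linorder_cases)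
  case less
  have "((\<lambda>_. 0) has_real_derivative 0) (at t)" by simp
  moreover have "eventually (\<lambda>s. s \<in> {..<0}) (nhds t)"
    using less by (intro eventually_nhds_in_open) auto
  then have "eventually (\<lambda>s. flat m s = 0) (nhds t)"
    by eventually_elim (auto simp: flat_def)
  ultimately show ?thesis
    using less by (subst DERIV_cong_ev[OF refl _ refl]) (auto simp: flat_def)
next
  case greater
  have inv: "((\<lambda>t. 1 / t) has_real_derivative - ((1 / t) ^ 2)) (at t)"
    using greater by (auto intro!: derivative_eq_intros simp: power2_eq_square)
  have "((\<lambda>t. (1 / t) ^ m) has_real_derivative - (real m * (1 / t) ^ (m + 1))) (at t)"
  proof (cases m)
    case (Suc n)
    show ?thesis
      unfolding Suc by (rule DERIV_cong[OF DERIV_power_Suc[OF inv]])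
        (simp add: power2_eq_square algebra_simps del: power_one_over)
  qed auto
  moreover have "((\<lambda>t. exp (- (1 / t))) has_real_derivative exp (- (1 / t)) * (1 / t) ^ 2) (at t)"
    by (rule DERIV_cong[OF DERIV_chain2[OF DERIV_exp DERIV_minus[OF inv]]]) simp
  ultimately have "((\<lambda>t. (1 / t) ^ m * exp (- (1 / t))) has_real_derivative
      - (real m * (1 / t) ^ (m + 1)) * exp (- (1 / t)) + exp (- (1 / t)) * (1 / t) ^ 2 * (1 / t) ^ m) (at t)"
    by (rule DERIV_mult)
  also have "- (real m * (1 / t) ^ (m + 1)) * exp (- (1 / t)) + exp (- (1 / t)) * (1 / t) ^ 2 * (1 / t) ^ m
      = flat (m + 2) t - real m * flat (m + 1) t"
    using greater by (simp add: flat_def power_add power2_eq_square algebra_simps del: power_one_over)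
  finally have "((\<lambda>t. (1 / t) ^ m * exp (- (1 / t))) has_real_derivative
      (flat (m + 2) t - real m * flat (m + 1) t)) (at t)" .
  moreover have "eventually (\<lambda>s. s \<in> {0<..}) (nhds t)"
    using greater by (intro eventually_nhds_in_open) auto
  then have "eventually (\<lambda>s. flat m s = (1 / s) ^ m * exp (- (1 / s))) (nhds t)"
    by eventually_elim (auto simp: flat_def)
  ultimately show ?thesis
    by (subst DERIV_cong_ev[OF refl _ refl]) auto
next
  case equal
  \<comment> \<open>For positive \<open>h\<close> the difference quotient is exactly
    \<open>flat (m + 1) h\<close>, so its limit is the decay at \<open>0\<close> of the next member
    of the family; for negative \<open>h\<close> it is \<open>0\<close>.\<close>
  have "((\<lambda>h. (flat m (0 + h) - flat m 0) / h) \<longlongrightarrow> 0) (at_right 0)"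
  proof (rule Lim_transform_eventually[OF flat_tendsto_0[of "m + 1"]])
    show "\<forall>\<^sub>F h in at_right 0. flat (m + 1) h = (flat m (0 + h) - flat m 0) / h"
      using eventually_at_right_less[of "0::real"]
      by eventually_elim (simp add: flat_def)
  qed
  moreover have "((\<lambda>h. (flat m (0 + h) - flat m 0) / h) \<longlongrightarrow> 0) (at_left 0)"
  proof (rule Lim_transform_eventually[OF tendsto_const])
    show "\<forall>\<^sub>F h in at_left 0. 0 = (flat m (0 + h) - flat m 0) / h"
      unfolding eventually_at_filter by (auto simp: flat_def)
  qed
  ultimately show ?thesis
    using equal by (simp add: DERIV_def filterlim_at_split flat_def)
qed

lemma class_C_flat:
  assumes h: "smooth (\<lambda>z. complex_of_real (h z))"
  shows "class_C k (\<lambda>z. of_real (flat m (h z)))"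
proof (induction k arbitrary: m)
  define H where "H = (\<lambda>z. complex_of_real (h z))"
  have H: "(H has_derivative (\<lambda>v. dir_deriv v H z)) (at z)" for z
    using h smooth_iff differentiable_on_UNIV_dir_deriv unfolding H_def by blast
  have h': "(h has_derivative (\<lambda>v. Re (dir_deriv v H z))) (at z)" for z
    using bounded_linear.has_derivative[OF bounded_linear_Re H[of z]] by (simp add: H_def)
  \<comment> \<open>The derivative of a real function is real, so \<open>Re\<close> can be removed
    again. The chain rule then has the factor \<open>dir_deriv v H\<close>, whose smoothness is part
    of the hypothesis.\<close>
  have H': "of_real (Re (dir_deriv v H z)) = dir_deriv v H z" for v z
    using bounded_linear.has_derivative[OF bounded_linear_of_real h'[of z]] dir_deriv_eq
    unfolding H_def by metis
  have D: "((\<lambda>z. complex_of_real (flat m (h z))) has_derivative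
      (\<lambda>v. (of_real (flat (m + 2) (h z)) - of_nat m * of_real (flat (m + 1) (h z))) * dir_deriv v H z)) (at z)" for m z
  proof -
    have "((\<lambda>z. flat m (h z)) has_derivative
       (\<lambda>v. (flat (m + 2) (h z) - real m * flat (m + 1) (h z)) * Re (dir_deriv v H z))) (at z)"
      using has_derivative_compose[OF h'[of z] flat_has_derivative[of m "h z", unfolded has_field_derivative_def]] 
      by simp
    from bounded_linear.has_derivative[OF bounded_linear_of_real this]
    have "((\<lambda>z. complex_of_real (flat m (h z))) has_derivative
       (\<lambda>v. of_real ((flat (m + 2) (h z) - real m * flat (m + 1) (h z)) * Re (dir_deriv v H z)))) (at z)" .
    then show ?thesis by (simp only: of_real_mult of_real_diff H' of_real_of_nat_eq)
  qed
  have d: "(\<lambda>z. complex_of_real (flat m (h z))) differentiable_on UNIV" for m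
    unfolding differentiable_on_def differentiable_def using D by blast
  {
    case 0
    show ?case unfolding class_C.simps by (rule differentiable_imp_continuous_on[OF d])
  next
    case (Suc k)
    have eq: "dir_deriv v (\<lambda>z. complex_of_real (flat m (h z))) =
      (\<lambda>z. (of_real (flat (m + 2) (h z)) + (- of_nat m) * of_real (flat (m + 1) (h z))) * dir_deriv v H z)" for v
      by (intro ext) (simp only: dir_deriv_eq[OF D], simp)
    have "class_C k (dir_deriv 1 H)" "class_C k (dir_deriv \<i> H)"
      using h smooth_iff unfolding H_def by blast+
    then show ?case
      unfolding class_C.simps eq
      by (intro conjI d class_C_mult[OF class_C_add[OF Suc class_C_mult[OF class_C_const Suc]]])
  }
qed

section \<open>Test functions\<close>

lemma test_functionsE:
  assumes "\<phi> \<in> test_functions \<Omega>"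
  obtains K where "smooth \<phi>" "compact K" "K \<subseteq> \<Omega>" "\<And>z. z \<notin> K \<Longrightarrow> \<phi> z = 0"
  using assms unfolding test_functions_def by blast

lemma test_functionsI:
  "smooth \<phi> \<Longrightarrow> compact K \<Longrightarrow> K \<subseteq> \<Omega> \<Longrightarrow> (\<And>z. z \<notin> K \<Longrightarrow> \<phi> z = 0) \<Longrightarrow> \<phi> \<in> test_functions \<Omega>"
  unfolding test_functions_def by blast

lemma test_smooth: "\<phi> \<in> test_functions \<Omega> \<Longrightarrow> smooth \<phi>"
  unfolding test_functions_def by blast

lemma test_mono: "\<phi> \<in> test_functions \<Omega> \<Longrightarrow> \<Omega> \<subseteq> \<Omega>' \<Longrightarrow> \<phi> \<in> test_functions \<Omega>'"
  unfolding test_functions_def by blast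

lemma dir_deriv_eq_0_outside:
  assumes "closed K" "\<And>z. z \<notin> K \<Longrightarrow> \<phi> z = 0" "z \<notin> K"
  shows "(\<phi> has_derivative (\<lambda>_. 0)) (at z)" "dir_deriv v \<phi> z = 0"
proof -
  have "((\<lambda>_. 0) has_derivative (\<lambda>_. 0)) (at z)" by simp
  then show "(\<phi> has_derivative (\<lambda>_. 0)) (at z)"
    by (rule has_derivative_transform_within_open[where s = "- K"]) (use assms in auto)
  then show "dir_deriv v \<phi> z = 0" by (rule dir_deriv_eq)
qed

lemma test_dir_deriv:
  assumes "\<phi> \<in> test_functions \<Omega>"
  shows "dir_deriv 1 \<phi> \<in> test_functions \<Omega>" "dir_deriv \<i> \<phi> \<in> test_functions \<Omega>"
proof -
  obtain K where K: "smooth \<phi>" "compact K" "K \<subseteq> \<Omega>" "\<And>z. z \<notin> K \<Longrightarrow> \<phi> z = 0"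
    using test_functionsE[OF assms] by blast
  have "dir_deriv v \<phi> z = 0" if "z \<notin> K" for v z
    using dir_deriv_eq_0_outside(2)[OF compact_imp_closed[OF K(2)] K(4) that] .
  moreover have "smooth (dir_deriv 1 \<phi>)" "smooth (dir_deriv \<i> \<phi>)"
    using K(1) smooth_iff by blast+
  ultimately show "dir_deriv 1 \<phi> \<in> test_functions \<Omega>" "dir_deriv \<i> \<phi> \<in> test_functions \<Omega>"
    by (auto intro!: test_functionsI[OF _ K(2,3)])
qed

lemma test_smooth_mult:
  assumes "smooth f" "\<phi> \<in> test_functions \<Omega>"
  shows "(\<lambda>z. f z * \<phi> z) \<in> test_functions \<Omega>"
proof -
  obtain K where K: "smooth \<phi>" "compact K" "K \<subseteq> \<Omega>" "\<And>z. z \<notin> K \<Longrightarrow> \<phi> z = 0"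
    using test_functionsE[OF assms(2)] by blast
  show ?thesis
    using assms(1) K(1) by (intro test_functionsI[OF _ K(2,3)] allI class_C_mult) (auto simp: K(4))
qed

lemma test_add:
  assumes "f \<in> test_functions \<Omega>" "\<phi> \<in> test_functions \<Omega>"
  shows "(\<lambda>z. f z + \<phi> z) \<in> test_functions \<Omega>"
proof -
  obtain K where K: "smooth \<phi>" "compact K" "K \<subseteq> \<Omega>" "\<And>z. z \<notin> K \<Longrightarrow> \<phi> z = 0"
    using test_functionsE[OF assms(2)] by blast
  obtain L where L: "smooth f" "compact L" "L \<subseteq> \<Omega>" "\<And>z. z \<notin> L \<Longrightarrow> f z = 0"
    using test_functionsE[OF assms(1)] by blast
  show ?thesis
    using L K by (intro test_functionsI[of _ "K \<union> L"] allI class_C_add) auto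
qed

section \<open>The operator \<open>dbar\<close> on test functions and on products\<close>

lemma dbar_alt: "dbar f = (\<lambda>z. (1 / 2) * (dir_deriv 1 f z + \<i> * dir_deriv \<i> f z))"
  by (simp add: dbar_def)

lemma test_dbar: "\<phi> \<in> test_functions \<Omega> \<Longrightarrow> dbar \<phi> \<in> test_functions \<Omega>"
  unfolding dbar_alt by (intro test_smooth_mult test_add test_dir_deriv allI class_C_const)

lemma dbar_mult:
  assumes "f differentiable (at z)" "g differentiable (at z)"
  shows "dbar (\<lambda>z. f z * g z) z = f z * dbar g z + dbar f z * g z"
  by (simp add: dbar_def dir_deriv_mult[OF assms] algebra_simps add_divide_distrib)

lemma dbar_cnj [simp]: "dbar cnj z = 1"
proof -
  have "dir_deriv v cnj z = cnj v" for v
    by (intro dir_deriv_eq bounded_linear_imp_has_derivative bounded_linear_cnj)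
  then show ?thesis by (simp add: dbar_def)
qed

text \<open>Nothing is known of \<open>h\<close> outside \<open>\<Omega>\<close>. There the product
  vanishes in a neighbourhood, because the support of \<open>\<phi>\<close> is compact in
  \<open>\<Omega>\<close>, and both terms of the formula are zero whatever \<open>deriv h z\<close>
  is.\<close>

lemma has_derivative_mult_test:
  assumes "h holomorphic_on \<Omega>" "open \<Omega>" "\<phi> \<in> test_functions \<Omega>"
  shows "((\<lambda>z. h z * \<phi> z) has_derivative
      (\<lambda>v. h z * dir_deriv v \<phi> z + (deriv h z * v) * \<phi> z)) (at z)"
proof (cases "z \<in> \<Omega>")
  case True
  then have "(h has_derivative (\<lambda>v. deriv h z * v)) (at z)"
    using holomorphic_derivI[OF assms(1,2)] by (simp add: has_field_derivative_def)
  from has_derivative_mult[OF this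
      differentiable_imp_has_derivative_dir_deriv[OF smooth_differentiable[OF test_smooth[OF assms(3)]]]]
  show ?thesis .
next
  case False
  obtain K where K: "smooth \<phi>" "compact K" "K \<subseteq> \<Omega>" "\<And>z. z \<notin> K \<Longrightarrow> \<phi> z = 0"
    using test_functionsE[OF assms(3)] by blast
  note cK = compact_imp_closed[OF K(2)]
  have z: "z \<notin> K" using False K by auto
  have "((\<lambda>z. h z * \<phi> z) has_derivative (\<lambda>_. 0)) (at z)"
    by (rule dir_deriv_eq_0_outside[OF cK _ z]) (simp add: K(4))
  moreover have "dir_deriv v \<phi> z = 0" for v
    by (rule dir_deriv_eq_0_outside[OF cK K(4) z])
  ultimately show ?thesis using z K(4) by simp
qed

text \<open>Each directional derivative of the product is a combination of \<open>h\<close> times a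
  derivative of \<open>\<phi>\<close> and \<open>deriv h\<close> times \<open>\<phi>\<close>, two
  products of the same kind; hence the induction generalizes over \<open>h\<close> and
  \<open>\<phi>\<close>.\<close>

lemma test_holomorphic_mult:
  assumes "h holomorphic_on \<Omega>" "open \<Omega>" "\<phi> \<in> test_functions \<Omega>"
  shows "(\<lambda>z. h z * \<phi> z) \<in> test_functions \<Omega>"
proof -
  have "class_C k (\<lambda>z. h z * \<phi> z)"
    if "h holomorphic_on \<Omega>" "\<phi> \<in> test_functions \<Omega>" for k h \<phi>
    using that
  proof (induction k arbitrary: h \<phi>)
    case 0
    have "(\<lambda>z. h z * \<phi> z) differentiable_on UNIV"
      unfolding differentiable_on_def differentiable_def
      by (intro ballI exI) (rule has_derivative_mult_test[OF 0(1) assms(2) 0(2)])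
    then show ?case unfolding class_C.simps by (rule differentiable_imp_continuous_on)
  next
    case (Suc k)
    note d = has_derivative_mult_test[OF Suc.prems(1) assms(2) Suc.prems(2)]
    have eq: "dir_deriv v (\<lambda>z. h z * \<phi> z) =
        (\<lambda>z. h z * dir_deriv v \<phi> z + v * (deriv h z * \<phi> z))" for v
      by (rule ext) (subst dir_deriv_eq[OF d], simp)
    have diff: "(\<lambda>z. h z * \<phi> z) differentiable_on UNIV"
      unfolding differentiable_on_def differentiable_def by (intro ballI exI) (rule d)
    have c: "class_C k (\<lambda>z. deriv h z * \<phi> z)"
      by (rule Suc.IH[OF holomorphic_deriv[OF Suc.prems(1) assms(2)] Suc.prems(2)])
    show ?case
      unfolding class_C.simps eq
      by (intro conjI diff class_C_add[OF Suc.IH class_C_mult[OF class_C_const c]]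
          Suc.prems(1) test_dir_deriv[OF Suc.prems(2)])
  qed
  note this[OF assms(1,3)]
  moreover obtain K where K: "smooth \<phi>" "compact K" "K \<subseteq> \<Omega>" "\<And>z. z \<notin> K \<Longrightarrow> \<phi> z = 0"
    using test_functionsE[OF assms(3)] by blast
  ultimately show ?thesis
    by (intro test_functionsI[OF _ K(2,3)] allI) (simp_all add: K(4))
qed

lemma dbar_holomorphic_mult:
  assumes "h holomorphic_on \<Omega>" "open \<Omega>" "\<phi> \<in> test_functions \<Omega>"
  shows "dbar (\<lambda>z. h z * \<phi> z) z = h z * dbar \<phi> z"
  unfolding dbar_def by (subst (1 2) dir_deriv_eq[OF has_derivative_mult_test[OF assms]])
    (simp add: field_simps)

section \<open>Cutoff functions and bumps built from \<open>flat\<close>\<close>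

lemma class_C_of_real_coords:
  "class_C k (\<lambda>z. complex_of_real (Re z - c))" "class_C k (\<lambda>z. complex_of_real (c - Re z))"
  "class_C k (\<lambda>z. complex_of_real (Im z - c))" "class_C k (\<lambda>z. complex_of_real (c - Im z))"
  "class_C k (\<lambda>z. complex_of_real ((norm z)\<^sup>2 - c))" "class_C k (\<lambda>z. complex_of_real (c - (norm z)\<^sup>2))"
proof -
  have lin: "class_C k (\<lambda>z. complex_of_real (Re z))" "class_C k (\<lambda>z. complex_of_real (Im z))"
     "class_C k cnj" "class_C k (\<lambda>z. z)"
    by (rule class_C_bounded_linear,
        intro bounded_linear_compose[OF bounded_linear_of_real] bounded_linear_Re bounded_linear_Im
          bounded_linear_cnj bounded_linear_ident)+
  have eq: "complex_of_real ((norm z)\<^sup>2 - c) = z * cnj z + (- of_real c)"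
     "complex_of_real (c - (norm z)\<^sup>2) = of_real c + (- 1) * (z * cnj z)"
     "complex_of_real (Re z - c) = of_real (Re z) + (- of_real c)"
     "complex_of_real (Im z - c) = of_real (Im z) + (- of_real c)"
     "complex_of_real (c - Re z) = of_real c + (- 1) * of_real (Re z)"
     "complex_of_real (c - Im z) = of_real c + (- 1) * of_real (Im z)"
    for z by (simp_all only: of_real_diff complex_norm_square) simp_all
  show "class_C k (\<lambda>z. complex_of_real (Re z - c))" "class_C k (\<lambda>z. complex_of_real (c - Re z))"
  "class_C k (\<lambda>z. complex_of_real (Im z - c))" "class_C k (\<lambda>z. complex_of_real (c - Im z))"
  "class_C k (\<lambda>z. complex_of_real ((norm z)\<^sup>2 - c))" "class_C k (\<lambda>z. complex_of_real (c - (norm z)\<^sup>2))"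
    unfolding eq by (intro class_C_add class_C_const lin class_C_mult)+
qed

lemma smooth_cnj: "smooth cnj"
  by (intro allI class_C_bounded_linear bounded_linear_cnj)

text \<open>The quotient \<open>P / (P + Q)\<close>: \<open>P\<close> is positive exactly inside
  radius \<open>s\<close>, \<open>Q\<close> exactly outside radius \<open>max r 0\<close>, and the
  two never vanish together because \<open>max r 0 < s\<close>. The maximum admits negative
  \<open>r\<close>, for which the ball is empty.\<close>

lemma cutoff_exists:
  assumes "r < 1"
  obtains \<theta> where "\<theta> \<in> test_functions unit_disk" "\<And>z. z \<in> ball 0 r \<Longrightarrow> \<theta> z = 1"
proof -
  obtain s where s: "max r 0 < s" "s < 1"
    using dense[of "max r 0" 1] assms by auto
  define P where "P = (\<lambda>z::complex. flat 0 (s\<^sup>2 - (norm z)\<^sup>2))"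
  define Q where "Q = (\<lambda>z::complex. flat 0 ((norm z)\<^sup>2 - (max r 0)\<^sup>2))"
  have PQ: "P z + Q z > 0" for z
  proof (cases "norm z < s")
    case True
    then have "(norm z)\<^sup>2 < s\<^sup>2" by (intro power_strict_mono) auto
    then show ?thesis by (simp add: P_def Q_def add_pos_nonneg)
  next
    case False
    then have "(max r 0)\<^sup>2 < (norm z)\<^sup>2" using s by (intro power_strict_mono) auto
    then show ?thesis by (simp add: P_def Q_def add_nonneg_pos)
  qed
  define \<theta> where "\<theta> = (\<lambda>z. complex_of_real (P z) * inverse (complex_of_real (P z) + complex_of_real (Q z)))"
  have "smooth \<theta>"
    unfolding \<theta>_def P_def Q_def
  proof (intro allI class_C_mult class_C_inverse class_C_add class_C_flat class_C_of_real_coords)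
    fix z :: complex
    show "complex_of_real (flat 0 (s\<^sup>2 - (cmod z)\<^sup>2)) + complex_of_real (flat 0 ((cmod z)\<^sup>2 - (max r 0)\<^sup>2)) \<noteq> 0"
      using PQ[of z] unfolding P_def Q_def of_real_add[symmetric] of_real_eq_0_iff by linarith
  qed
  moreover have "\<theta> z = 0" if "z \<notin> cball 0 s" for z
  proof -
    have "s\<^sup>2 \<le> (norm z)\<^sup>2" using that s by (intro power_mono) auto
    then show ?thesis by (simp add: \<theta>_def P_def)
  qed
  ultimately have "\<theta> \<in> test_functions unit_disk"
    using s by (intro test_functionsI[of _ "cball 0 s"]) auto
  moreover have "\<theta> z = 1" if "z \<in> ball 0 r" for z
  proof -
    have "(norm z)\<^sup>2 \<le> (max r 0)\<^sup>2" using that by (intro power_mono) auto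
    then have "Q z = 0" by (simp add: Q_def)
    then show ?thesis using PQ[of z] by (simp add: \<theta>_def)
  qed
  ultimately show ?thesis using that by blast
qed

text \<open>\<open>F\<close> is positive exactly on the open box, so
  \<open>F / (F + 1 / (m + 1))\<close> tends to the indicator and stays below it. This is the
  sequence that lets dominated convergence carry orthogonality from test functions to indicators of
  boxes.\<close>

lemma box_bump_exists:
  fixes a b :: complex
  assumes "cbox a b \<subseteq> \<Omega>"
  obtains \<eta> :: "nat \<Rightarrow> complex \<Rightarrow> complex" where "\<And>m. \<eta> m \<in> test_functions \<Omega>"
    "\<And>m z. norm (\<eta> m z) \<le> indicator (box a b) z" "\<And>z. (\<lambda>m. \<eta> m z) \<longlonglongrightarrow> indicator (box a b) z"
proof -
  define F where "F = (\<lambda>z. flat 0 (Re z - Re a) * flat 0 (Re b - Re z) * (flat 0 (Im z - Im a) * flat 0 (Im b - Im z)))"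
  have in_box: "z \<in> box a b \<longleftrightarrow> Re z > Re a \<and> Re b > Re z \<and> Im z > Im a \<and> Im b > Im z" for z
    by (auto simp: box_def Basis_complex_def)
  have F0: "F z = 0" if "z \<notin> box a b" for z
    using that by (auto simp: F_def in_box)
  have F1: "F z > 0" if "z \<in> box a b" for z
    using that by (auto simp: F_def in_box)
  have Fge: "F z \<ge> 0" for z by (cases "z \<in> box a b") (auto dest: F0 F1)
  define \<eta> where "\<eta> = (\<lambda>(m::nat) z. complex_of_real (F z) * inverse (complex_of_real (F z) + complex_of_real (inverse (Suc m))))"
  have \<eta>_alt: "\<eta> m z = of_real (F z / (F z + inverse (Suc m)))" for m z
    by (simp add: \<eta>_def divide_inverse)
  have pos: "F z + inverse (real (Suc m)) > 0" for z m
    using Fge[of z] by (simp add: add_nonneg_pos)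
  have "smooth (\<lambda>z. complex_of_real (F z))"
    unfolding F_def of_real_mult by (intro allI class_C_mult class_C_flat class_C_of_real_coords)
  then have "smooth (\<eta> m)" for m
    unfolding \<eta>_def
  proof (intro allI class_C_mult class_C_inverse class_C_add class_C_const; (blast)?)
    fix z
    show "complex_of_real (F z) + complex_of_real (inverse (real (Suc m))) \<noteq> 0"
      using pos[of z m] unfolding of_real_add[symmetric] of_real_eq_0_iff by linarith
  qed
  then have "\<eta> m \<in> test_functions \<Omega>" for m
    by (rule test_functionsI[OF _ compact_cbox assms])
       (metis F0 \<eta>_def box_subset_cbox mult_zero_left of_real_0 subsetD)
  moreover have "norm (\<eta> m z) \<le> indicator (box a b) z" for m z
    unfolding \<eta>_alt norm_of_real
    using Fge[of z] pos[of z m] by (auto simp: F0 indicator_def abs_of_nonneg)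
  moreover have "(\<lambda>m. \<eta> m z) \<longlonglongrightarrow> indicator (box a b) z" for z
  proof (cases "z \<in> box a b")
    case True
    have "(\<lambda>m. F z / (F z + inverse (real (Suc m)))) \<longlonglongrightarrow> F z / (F z + 0)"
      using F1[OF True] by (intro tendsto_intros LIMSEQ_inverse_real_of_nat) auto
    then have "(\<lambda>m. complex_of_real (F z / (F z + inverse (real (Suc m))))) \<longlonglongrightarrow> of_real (F z / (F z + 0))"
      by (rule tendsto_of_real)
    then show ?thesis using F1[OF True] True by (simp add: \<eta>_alt)
  qed (simp add: \<eta>_alt F0)
  ultimately show ?thesis using that by blast
qed

section \<open>Bounds and Lipschitz constants of test functions\<close>

lemma continuous_compact_support_bounded:
  fixes f :: "complex \<Rightarrow> complex"
  assumes "continuous_on UNIV f" "compact K" "\<And>z. z \<notin> K \<Longrightarrow> f z = 0"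
  obtains B where "B > 0" "\<And>z. norm (f z) \<le> B"
proof -
  have "bounded (f ` K)"
    using assms by (intro compact_imp_bounded compact_continuous_image) (auto intro: continuous_on_subset)
  then obtain B where "B > 0" "\<And>z. z \<in> K \<Longrightarrow> norm (f z) \<le> B"
    by (auto simp: bounded_pos)
  with assms(3) have "norm (f z) \<le> B" for z by (cases "z \<in> K") auto
  with \<open>B > 0\<close> show ?thesis using that by blast
qed

lemma test_bounded:
  assumes "f \<in> test_functions \<Omega>"
  obtains B where "B > 0" "\<And>z. norm (f z) \<le> B"
proof -
  obtain K where K: "smooth f" "compact K" "K \<subseteq> \<Omega>" "\<And>z. z \<notin> K \<Longrightarrow> f z = 0"
    using test_functionsE[OF assms] by blast
  show ?thesis
    using continuous_compact_support_bounded[OF smooth_continuous_on[OF K(1)] K(2,4)] that by blast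
qed

lemma test_lipschitz:
  assumes "f \<in> test_functions \<Omega>"
  obtains B where "B > 0" "\<And>x y. norm (f x - f y) \<le> B * norm (x - y)"
    "\<And>z v. norm (dir_deriv v f z) \<le> B * norm v"
proof -
  obtain B1 where B1: "B1 > 0" "\<And>z. norm (dir_deriv 1 f z) \<le> B1"
    using test_bounded[OF test_dir_deriv(1)[OF assms]] by blast
  obtain B2 where B2: "B2 > 0" "\<And>z. norm (dir_deriv \<i> f z) \<le> B2"
    using test_bounded[OF test_dir_deriv(2)[OF assms]] by blast
  have d: "f differentiable (at z)" for z
    using smooth_differentiable[OF test_smooth[OF assms]] .
  have D: "norm (dir_deriv v f z) \<le> (B1 + B2) * norm v" for v z
  proof -
    have "norm (dir_deriv v f z) \<le> \<bar>Re v\<bar> * norm (dir_deriv 1 f z) + \<bar>Im v\<bar> * norm (dir_deriv \<i> f z)"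
      by (subst dir_deriv_coords[OF d], rule norm_triangle_le) (simp add: norm_mult)
    also have "\<dots> \<le> norm v * B1 + norm v * B2"
      by (intro add_mono mult_mono abs_Re_le_cmod abs_Im_le_cmod B1 B2) auto
    finally show ?thesis by (simp add: algebra_simps)
  qed
  have "norm (f x - f y) \<le> (B1 + B2) * norm (x - y)" for x y
    using B1(1) B2(1) D
    by (intro differentiable_bound[where S = UNIV and f' = "\<lambda>z v. dir_deriv v f z"])
       (auto intro!: differentiable_imp_has_derivative_dir_deriv d onorm_le)
  with D that[of "B1 + B2"] B1(1) B2(1) show ?thesis by auto
qed

section \<open>Lebesgue measure and locally integrable functions\<close>

text \<open>Needed for the completed measure, so that the theorems of Tonelli and Fubini apply to
  the product of \<open>lebesgue\<close> with itself.\<close>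

lemma sigma_finite_lebesgue: "sigma_finite_measure (lebesgue :: complex measure)"
proof
  show "\<exists>A. countable A \<and> A \<subseteq> sets (lebesgue :: complex measure) \<and> \<Union>A = space lebesgue \<and>
      (\<forall>a\<in>A. emeasure lebesgue a \<noteq> \<infinity>)"
  proof (intro exI[of _ "range (\<lambda>n::nat. ball 0 (real n))"] conjI ballI)
    show "\<Union>(range (\<lambda>n::nat. ball (0::complex) (real n))) = space lebesgue"
      using reals_Archimedean2 by auto
    fix a :: "complex set" assume "a \<in> range (\<lambda>n::nat. ball 0 (real n))"
    then show "emeasure lebesgue a \<noteq> \<infinity>"
      using emeasure_bounded_finite[of a] by (auto simp: less_top[symmetric])
  qed auto
qed

interpretation lebesgue: sigma_finite_measure "lebesgue :: complex measure"
  by (rule sigma_finite_lebesgue)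

interpretation lebesgue2: pair_sigma_finite "lebesgue :: complex measure" "lebesgue :: complex measure"
  ..

lemma measurable_ident_lebesgue [measurable]: "(\<lambda>x. x) \<in> lebesgue \<rightarrow>\<^sub>M borel"
  by (intro measurable_completion) simp

lemma continuous_borel_measurable_lebesgue:
  fixes f :: "complex \<Rightarrow> complex"
  shows "continuous_on UNIV f \<Longrightarrow> f \<in> borel_measurable lebesgue"
  by (intro measurable_completion) (simp add: borel_measurable_continuous_onI)

lemma test_measurable: "\<phi> \<in> test_functions \<Omega> \<Longrightarrow> \<phi> \<in> borel_measurable lebesgue"
  by (intro continuous_borel_measurable_lebesgue smooth_continuous_on test_smooth)

section \<open>Translation invariance of Lebesgue measure on the plane\<close>

lemma
  fixes t :: complex
  shows distr_lebesgue_plus: "distr lebesgue lebesgue (\<lambda>x. t + x) = lebesgue"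
    and measurable_lebesgue_plus: "(\<lambda>x. t + x) \<in> lebesgue \<rightarrow>\<^sub>M lebesgue"
proof -
  have eq: "(\<lambda>x. t + (\<Sum>j\<in>Basis. (1 * (x \<bullet> j)) *\<^sub>R j)) = (\<lambda>x. t + x)"
    by (simp add: euclidean_representation)
  show "distr lebesgue lebesgue (\<lambda>x. t + x) = lebesgue"
    using lebesgue_affine_euclidean[of "\<lambda>_. 1" t] unfolding eq by (simp add: density_1)
  show "(\<lambda>x. t + x) \<in> lebesgue \<rightarrow>\<^sub>M lebesgue"
    using lebesgue_affine_measurable[of "\<lambda>_. 1" t] unfolding eq by simp
qed

lemma lebesgue_integral_shift:
  fixes f :: "complex \<Rightarrow> complex"
  assumes "f \<in> borel_measurable lebesgue"
  shows "(LINT x|lebesgue. f (t + x)) = (LINT x|lebesgue. f x)"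
  using integral_distr[OF measurable_lebesgue_plus assms, of t] by (simp add: distr_lebesgue_plus)

lemma lebesgue_integrable_shift:
  fixes f :: "complex \<Rightarrow> complex"
  assumes "integrable lebesgue f"
  shows "integrable lebesgue (\<lambda>x. f (t + x))"
  using integrable_distr[OF measurable_lebesgue_plus, of t f] assms by (simp add: distr_lebesgue_plus)

lemma lebesgue_nn_integral_shift:
  fixes f :: "complex \<Rightarrow> ennreal"
  assumes "f \<in> borel_measurable lebesgue"
  shows "(\<integral>\<^sup>+x. f (t + x) \<partial>lebesgue) = (\<integral>\<^sup>+x. f x \<partial>lebesgue)"
  using nn_integral_distr[OF measurable_lebesgue_plus, of f t] assms by (simp add: distr_lebesgue_plus)

lemma locally_integrable_mult_bounded:
  assumes "f locally_integrable_on \<Omega>" "compact K" "K \<subseteq> \<Omega>"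
    and "\<phi> \<in> borel_measurable lebesgue" "\<And>z. norm (\<phi> z) \<le> B" "\<And>z. z \<notin> K \<Longrightarrow> \<phi> z = 0"
  shows "integrable lebesgue (\<lambda>z. f z * \<phi> z)"
proof -
  have i: "integrable lebesgue (\<lambda>z. indicator K z *\<^sub>R f z)"
    using assms(1-3) unfolding locally_integrable_on_def set_integrable_def[symmetric] by blast
  have "f z * \<phi> z = (indicator K z *\<^sub>R f z) * \<phi> z" for z
    by (simp add: indicator_def assms(6))
  moreover have "integrable lebesgue (\<lambda>z. (indicator K z *\<^sub>R f z) * \<phi> z)"
  proof (rule Bochner_Integration.integrable_bound)
    show "integrable lebesgue (\<lambda>z. B *\<^sub>R (indicator K z *\<^sub>R f z))"
      using i by (rule integrable_scaleR_right)
    show "(\<lambda>z. indicator K z *\<^sub>R f z * \<phi> z) \<in> borel_measurable lebesgue"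
      using assms(4) borel_measurable_integrable[OF i] by (rule borel_measurable_times[rotated])
    have "norm (f z) * norm (\<phi> z) \<le> \<bar>B\<bar> * norm (f z)" for z
      using mult_right_mono[of "norm (\<phi> z)" "\<bar>B\<bar>" "norm (f z)"] assms(5)[of z]
      by (simp add: mult.commute)
    then show "AE z in lebesgue. norm (indicator K z *\<^sub>R f z * \<phi> z) \<le> norm (B *\<^sub>R (indicator K z *\<^sub>R f z))"
      by (intro AE_I2) (simp add: norm_mult indicator_def)
  qed
  ultimately show ?thesis by simp
qed

lemma locally_integrable_mult_test:
  assumes "f locally_integrable_on \<Omega>" "\<phi> \<in> test_functions \<Omega>"
  shows "integrable lebesgue (\<lambda>z. f z * \<phi> z)"
proof -
  obtain K where K: "smooth \<phi>" "compact K" "K \<subseteq> \<Omega>" "\<And>z. z \<notin> K \<Longrightarrow> \<phi> z = 0"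
    using test_functionsE[OF assms(2)] by blast
  obtain B where "B > 0" "\<And>z. norm (\<phi> z) \<le> B"
    using test_bounded[OF assms(2)] by blast
  then show ?thesis
    by (intro locally_integrable_mult_bounded[OF assms(1) K(2,3) test_measurable[OF assms(2)] _ K(4)]) auto
qed

lemma locally_integrable_const: "(\<lambda>_. c) locally_integrable_on \<Omega>"
  unfolding locally_integrable_on_def
  by (auto intro!: absolutely_integrable_on_const lmeasurable_compact)

lemma test_integrable: "\<phi> \<in> test_functions \<Omega> \<Longrightarrow> integrable lebesgue \<phi>"
  using locally_integrable_mult_test[OF locally_integrable_const[of 1]] by simp

lemma LINT_test:
  assumes "\<phi> \<in> test_functions \<Omega>"
  shows "(LINT z:\<Omega>|lebesgue. f z * \<phi> z) = (LINT z|lebesgue. f z * \<phi> z)"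
proof -
  obtain K where K: "smooth \<phi>" "compact K" "K \<subseteq> \<Omega>" "\<And>z. z \<notin> K \<Longrightarrow> \<phi> z = 0"
    using test_functionsE[OF assms] by blast
  then have "indicator \<Omega> z *\<^sub>R (f z * \<phi> z) = f z * \<phi> z" for z
    by (auto simp: indicator_def)
  then show ?thesis by (simp add: set_lebesgue_integral_def)
qed

lemma has_weak_dbar_iff:
  "has_weak_dbar \<Omega> f g \<longleftrightarrow> f locally_integrable_on \<Omega> \<and> g locally_integrable_on \<Omega> \<and>
     (\<forall>\<phi>\<in>test_functions \<Omega>. (LINT z|lebesgue. f z * dbar \<phi> z) = - (LINT z|lebesgue. g z * \<phi> z))"
  unfolding has_weak_dbar_def by (auto simp: LINT_test test_dbar)

section \<open>The fundamental lemma of the calculus of variations\<close>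

lemma AE_eq_0_if_set_integral_0:
  fixes g :: "'a \<Rightarrow> complex"
  assumes g: "integrable M g" and 0: "\<And>A. A \<in> sets M \<Longrightarrow> (LINT z:A|M. g z) = 0"
  shows "AE z in M. g z = 0"
proof -
  \<comment> \<open>Four half-planes suffice: with \<open>c\<close> equal to \<open>1\<close>,
    \<open>- 1\<close>, \<open>\<i>\<close> and \<open>- \<i>\<close> these inequalities force
    \<open>g z = 0\<close>. For each \<open>c\<close> the hypothesis is used on the set where
    \<open>Re (c * g z)\<close> is positive.\<close>
  have "AE z in M. Re (c * g z) \<le> 0" for c
  proof -
    let ?A = "{z \<in> space M. Re (c * g z) > 0}"
    have A: "?A \<in> sets M" using g by measurable
    have i: "integrable M (\<lambda>z. c * (indicator ?A z *\<^sub>R g z))"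
      using A g by (intro integrable_mult_right integrable_mult_indicator)
    have "(LINT z|M. Re (c * (indicator ?A z *\<^sub>R g z))) = Re (LINT z|M. c * (indicator ?A z *\<^sub>R g z))"
      using i by (rule integral_Re)
    also have "\<dots> = 0"
      unfolding integral_mult_right_zero using 0[OF A] by (simp add: set_lebesgue_integral_def)
    finally have "AE z in M. Re (c * (indicator ?A z *\<^sub>R g z)) = 0"
      by (subst (asm) integral_nonneg_eq_0_iff_AE[OF integrable_Re[OF i]]) (auto simp: indicator_def)
    then show ?thesis
      using AE_space by eventually_elim (auto simp: indicator_def split: if_splits)
  qed
  from this[of 1] this[of "- 1"] this[of \<i>] this[of "- \<i>"] show ?thesis
    by eventually_elim (simp add: complex_eq_iff)
qed

text \<open>Open boxes are stable under intersection and generate the Borel sets, so Dynkin's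
  argument reaches all Borel sets; the vanishing total integral serves the complements. A Lebesgue
  set differs from a Borel set by a null set.\<close>

lemma AE_eq_0_if_set_integral_box_0:
  fixes g :: "complex \<Rightarrow> complex"
  assumes g: "integrable lebesgue g" and box: "\<And>a b. (LINT z:box a b|lebesgue. g z) = 0"
    and tot: "(LINT z|lebesgue. g z) = 0"
  shows "AE z in lebesgue. g z = 0"
proof (rule AE_eq_0_if_set_integral_0[OF g])
  have si: "set_integrable lebesgue A g" if "A \<in> sets lebesgue" for A
    unfolding set_integrable_def using integrable_mult_indicator[OF that g] .
  let ?G = "range (\<lambda>(a, b). box a b :: complex set)"
  have borel: "(LINT z:A|lebesgue. g z) = 0" if "A \<in> sets borel" for A
  proof -
    have s: "sigma_sets UNIV ?G = sets borel"
      unfolding borel_eq_box by simp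
    have "Int_stable ?G"
      by (auto simp: Int_stable_def box_Int_box)
    moreover have "?G \<subseteq> Pow UNIV" by simp
    moreover have "A \<in> sigma_sets UNIV ?G" using that s by simp
    ultimately show ?thesis
    proof (induction rule: sigma_sets_induct_disjoint)
      case (basic A)
      then show ?case using box by auto
    next
      case empty
      show ?case by (simp add: set_lebesgue_integral_def)
    next
      case (compl A)
      then have "A \<in> sets lebesgue" using s by auto
      then have "(LINT z:A \<union> (UNIV - A)|lebesgue. g z) = (LINT z:A|lebesgue. g z) + (LINT z:UNIV - A|lebesgue. g z)"
        by (intro set_integral_Un si) auto
      with tot compl show ?case by (simp add: set_lebesgue_integral_def)
    next
      case (union A)
      then have m: "A i \<in> sets lebesgue" for i using s by auto
      have "(LINT z:(\<Union>i. A i)|lebesgue. g z) = (\<Sum>i. (LINT z:(A i)|lebesgue. g z))"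
        using union(1) by (intro lebesgue_integral_countable_add m si sets.countable_UN)
           (auto simp: disjoint_family_on_def m)
      with union show ?case by simp
    qed
  qed
  fix A :: "complex set" assume "A \<in> sets lebesgue"
  then obtain S N N' where A: "A = S \<union> N" "N \<subseteq> N'" "N' \<in> null_sets lborel" "S \<in> sets lborel"
    by (rule sets_completionE)
  have "AE z in lebesgue. z \<notin> N'"
    using A(3) by (intro AE_not_in null_sets_completionI)
  then have "(LINT z:A|lebesgue. g z) = (LINT z:S|lebesgue. g z)"
    unfolding set_lebesgue_integral_def
  proof (intro integral_cong_AE)
    show "AE z in lebesgue. z \<notin> N' \<Longrightarrow> AE x in lebesgue. indicat_real A x *\<^sub>R g x = indicat_real S x *\<^sub>R g x"
      by (erule AE_mp) (use A in \<open>auto simp: indicator_def\<close>)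
  qed (use A \<open>A \<in> sets lebesgue\<close> g in \<open>auto intro!: borel_measurable_scaleR borel_measurable_indicator\<close>)
  with borel[of S] A(4) show "(LINT z:A|lebesgue. g z) = 0" by simp
qed

text \<open>Bumps turn orthogonality into vanishing integrals over the boxes whose closed box lies
  in \<open>\<Omega>\<close>. Restricted to one such box, \<open>f\<close> is integrable on the
  whole plane with zero integral over every box, hence zero almost everywhere; countably many closed
  boxes cover \<open>\<Omega>\<close>.\<close>

lemma AE_eq_0_if_orthogonal_to_test_functions:
  assumes "open \<Omega>" "f locally_integrable_on \<Omega>"
    and orth: "\<And>\<eta>. \<eta> \<in> test_functions \<Omega> \<Longrightarrow> (LINT z|lebesgue. f z * \<eta> z) = 0"
  shows "AE z in lebesgue. z \<in> \<Omega> \<longrightarrow> f z = 0"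
proof -
  have int: "set_integrable lebesgue (cbox c d) f" if "cbox c d \<subseteq> \<Omega>" for c d
    using assms(2) that unfolding locally_integrable_on_def by auto
  have box0: "(LINT z:box c d|lebesgue. f z) = 0" if cd: "cbox c d \<subseteq> \<Omega>" for c d
  proof -
    obtain \<eta> where \<eta>: "\<And>m. \<eta> m \<in> test_functions \<Omega>"
      "\<And>m z. norm (\<eta> m z) \<le> indicator (box c d) z" "\<And>z. (\<lambda>m. \<eta> m z) \<longlonglongrightarrow> indicator (box c d) z"
      using box_bump_exists[OF cd] by blast
    note i = int[OF cd, unfolded set_integrable_def]
    have ib: "integrable lebesgue (\<lambda>z. indicator (box c d) z *\<^sub>R f z)"
      using set_integrable_subset[OF int[OF cd], of "box c d"] box_subset_cbox by (auto simp: set_integrable_def)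
    have "(\<lambda>m. LINT z|lebesgue. f z * \<eta> m z) \<longlonglongrightarrow> (LINT z|lebesgue. indicator (box c d) z *\<^sub>R f z)"
    proof (rule integral_dominated_convergence)
      show "(\<lambda>z. indicator (box c d) z *\<^sub>R f z) \<in> borel_measurable lebesgue"
        using ib by simp
      show "(\<lambda>z. f z * \<eta> m z) \<in> borel_measurable lebesgue" for m
        using locally_integrable_mult_test[OF assms(2) \<eta>(1)] by simp
      show "integrable lebesgue (\<lambda>z. norm (indicator (cbox c d) z *\<^sub>R f z))"
        using i by (rule integrable_norm)
      show "AE z in lebesgue. (\<lambda>m. f z * \<eta> m z) \<longlonglongrightarrow> indicator (box c d) z *\<^sub>R f z"
      proof (rule AE_I2)
        fix z
        have "(\<lambda>m. f z * \<eta> m z) \<longlonglongrightarrow> f z * indicator (box c d) z"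
          by (intro tendsto_intros \<eta>(3))
        then show "(\<lambda>m. f z * \<eta> m z) \<longlonglongrightarrow> indicator (box c d) z *\<^sub>R f z"
          by (cases "z \<in> box c d") (simp_all add: indicator_def)
      qed
      show "AE z in lebesgue. norm (f z * \<eta> m z) \<le> norm (indicator (cbox c d) z *\<^sub>R f z)" for m
      proof (rule AE_I2)
        fix z
        have "norm (f z) * norm (\<eta> m z) \<le> norm (f z) * indicator (box c d) z"
          by (intro mult_left_mono \<eta>(2)) auto
        also have "\<dots> \<le> norm (f z) * indicator (cbox c d) z"
          using box_subset_cbox[of c d] by (intro mult_left_mono) (auto simp: indicator_def)
        finally show "norm (f z * \<eta> m z) \<le> norm (indicator (cbox c d) z *\<^sub>R f z)"
          by (simp add: norm_mult mult.commute)
      qed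
    qed
    then have "(\<lambda>m::nat. 0) \<longlonglongrightarrow> (LINT z|lebesgue. indicator (box c d) z *\<^sub>R f z)"
      by (simp add: orth \<eta>(1))
    then show ?thesis
      unfolding set_lebesgue_integral_def using LIMSEQ_unique tendsto_const by blast
  qed
  have loc: "AE z in lebesgue. z \<in> box c d \<longrightarrow> f z = 0" if cd: "cbox c d \<subseteq> \<Omega>" for c d
  proof -
    let ?g = "\<lambda>z. indicator (box c d) z *\<^sub>R f z"
    have "AE z in lebesgue. ?g z = 0"
    proof (rule AE_eq_0_if_set_integral_box_0)
      show "integrable lebesgue ?g"
        using set_integrable_subset[OF int[OF cd], of "box c d"] box_subset_cbox by (auto simp: set_integrable_def)
      show "(LINT z|lebesgue. ?g z) = 0"
        using box0[OF cd] by (simp add: set_lebesgue_integral_def)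
      fix a b
      have "(LINT z:box a b|lebesgue. ?g z) = (LINT z:box a b \<inter> box c d|lebesgue. f z)"
        unfolding set_lebesgue_integral_def
        by (intro Bochner_Integration.integral_cong) (auto simp: indicator_def)
      also have "\<dots> = 0"
      proof (cases "box a b \<inter> box c d = {}")
        case False
        obtain e h where eh: "box a b \<inter> box c d = box e h"
          unfolding box_Int_box by blast
        \<comment> \<open>Nonemptiness matters: an empty \<open>box e h\<close> can have a nonempty
          \<open>cbox e h\<close>, which need not lie in \<open>cbox c d\<close>.\<close>
        have "cbox e h = closure (box e h)"
          using False eh by (metis closure_box)
        also have "\<dots> \<subseteq> cbox c d"
          unfolding eh[symmetric] using box_subset_cbox by (intro closure_minimal) auto
        finally show ?thesis
          using box0[of e h] cd eh by auto
      qed (simp add: set_lebesgue_integral_def)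
      finally show "(LINT z:box a b|lebesgue. ?g z) = 0" .
    qed
    then show ?thesis by eventually_elim (auto simp: indicator_def)
  qed
  obtain \<D> where \<D>: "countable \<D>" "\<D> \<subseteq> Pow \<Omega>" "\<And>X. X \<in> \<D> \<Longrightarrow> \<exists>a b. X = cbox a b" "\<Union>\<D> = \<Omega>"
    using open_countable_Union_open_cbox[OF \<open>open \<Omega>\<close>] by metis
  have "AE z in lebesgue. z \<in> X \<longrightarrow> f z = 0" if "X \<in> \<D>" for X
  proof -
    obtain a b where X: "X = cbox a b" using \<D>(3) \<open>X \<in> \<D>\<close> by blast
    have "AE z in lebesgue. z \<notin> cbox a b - box a b"
      using negligible_frontier_interval[of a b] by (intro AE_not_in) (simp add: negligible_iff_null_sets)
    moreover have "AE z in lebesgue. z \<in> box a b \<longrightarrow> f z = 0"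
      using \<D>(2) \<open>X \<in> \<D>\<close> X by (intro loc) auto
    ultimately show ?thesis
      by eventually_elim (auto simp: X)
  qed
  then have "AE z in lebesgue. \<forall>X\<in>\<D>. z \<in> X \<longrightarrow> f z = 0"
    using \<D>(1) by (intro AE_ball_countable[THEN iffD2]) auto
  then show ?thesis
    by eventually_elim (use \<D>(4) in auto)
qed

section \<open>The Cauchy transform\<close>

lemma ennreal_le_suminf: "F t \<le> (\<Sum>k. F k :: ennreal)"
  using sum_le_suminf[of F "{t}"] by simp

lemma half_power_eq_powr: "(1 / 2 :: real) ^ k = 2 powr - real k"
  by (simp add: powr_minus powr_realpow power_one_over inverse_eq_divide)

text \<open>Dyadic decomposition: where \<open>(1 / 2) ^ Suc k < norm z \<le> (1 / 2) ^ k\<close>,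
  the integrand is at most \<open>c k\<close>; the disk of radius \<open>(1 / 2) ^ k\<close> has
  area \<open>pi / 4 ^ k\<close>, and the products form a geometric series of ratio
  \<open>2 powr (p - 2) < 1\<close>. At \<open>z = 0\<close> the integrand is \<open>0\<close>,
  since \<open>0 powr - p = 0\<close>.\<close>

lemma nn_integral_norm_powr_finite:
  assumes "0 \<le> p" "p < 2"
  shows "(\<integral>\<^sup>+z. indicator (ball 0 1) z * ennreal (norm (z::complex) powr - p) \<partial>lebesgue) < \<infinity>"
proof -
  define c :: "nat \<Rightarrow> real" where "c = (\<lambda>k. 2 powr (real (Suc k) * p))"
  have le: "indicator (ball 0 1) z * ennreal (norm (z::complex) powr - p) \<le>
      (\<Sum>k. ennreal (c k) * indicator (ball 0 ((1 / 2) ^ k)) z)" for z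
  proof (cases "z \<in> ball 0 1 \<and> z \<noteq> 0")
    case True
    define t where "t = nat \<lfloor>log (1 / 2) (norm z)\<rfloor>"
    have "log (1 / 2) (norm z) \<ge> 0"
      using True ln_le_zero_iff[of "norm z"] by (simp add: log_def ln_div divide_nonpos_pos)
    then have t: "real t \<le> log (1 / 2) (norm z)" "log (1 / 2) (norm z) < real (Suc t)"
      unfolding t_def by linarith+
    have n: "norm z = (1 / 2) powr log (1 / 2) (norm z)"
      using True by simp
    have up: "norm z \<le> (1 / 2) ^ t"
    proof -
      have "norm z \<le> (1 / 2) powr real t"
        using t(1) by (subst n) (intro powr_mono', auto)
      then show ?thesis by (simp add: powr_realpow)
    qed
    have lo: "norm z > (1 / 2) ^ Suc t"
    proof -
      have "(1 / 2) powr real (Suc t) < (1 / 2) powr log (1 / 2) (norm z)"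
        using t(2) by (intro powr_less_mono') auto
      with n show ?thesis by (simp only: powr_realpow)
    qed
    have le2: "norm z powr - p \<le> ((1 / 2) ^ (Suc t)) powr - p" 
      using lo assms True by (intro powr_mono2') auto
    have "((1 / 2) ^ (Suc t)) powr - p = c t"
    proof -
      show ?thesis unfolding half_power_eq_powr c_def by (subst powr_powr) (simp add: algebra_simps)
    qed
    with le2 have le3: "norm z powr - p \<le> c t" by simp
    show ?thesis
    proof (cases "norm z < (1 / 2) ^ t")
      case lt: True
      have "indicator (ball 0 1) z * ennreal (norm z powr - p) \<le> ennreal (c t) * indicator (ball 0 ((1 / 2) ^ t)) z"
        using True lt le3 by (simp add: ennreal_leI)
      also have "\<dots> \<le> (\<Sum>k. ennreal (c k) * indicator (ball 0 ((1 / 2) ^ k)) z)"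
        by (rule ennreal_le_suminf[of "\<lambda>k. ennreal (c k) * indicator (ball 0 ((1 / 2) ^ k)) z" t])
      finally show ?thesis .
    next
      case False
      then have eq: "norm z = (1 / 2) ^ t" using up by simp
      \<comment> \<open>The balls are open, so a point with norm exactly \<open>(1 / 2) ^ t\<close>
        needs the next larger ball, of index \<open>t - 1\<close>. There \<open>c s\<close> equals
        the integrand. The case \<open>t = 0\<close> would mean norm \<open>1\<close>, outside the
        unit ball.\<close>
      then obtain s where s: "t = Suc s" using True by (cases t) auto
      have "c s \<ge> norm z powr - p"
      proof -
        show ?thesis unfolding eq s half_power_eq_powr c_def by (subst powr_powr) (simp add: algebra_simps)
      qed
      moreover have "norm z < (1 / 2) ^ s" using eq s by (simp add: field_simps)
      ultimately have "indicator (ball 0 1) z * ennreal (norm z powr - p) \<le> ennreal (c s) * indicator (ball 0 ((1 / 2) ^ s)) z"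
        using True by (simp add: ennreal_leI)
      also have "\<dots> \<le> (\<Sum>k. ennreal (c k) * indicator (ball 0 ((1 / 2) ^ k)) z)"
        by (rule ennreal_le_suminf[of "\<lambda>k. ennreal (c k) * indicator (ball 0 ((1 / 2) ^ k)) z" s])
      finally show ?thesis .
    qed
  qed (auto simp: indicator_def)
  have "(\<integral>\<^sup>+z. indicator (ball 0 1) z * ennreal (norm (z::complex) powr - p) \<partial>lebesgue)
      \<le> (\<integral>\<^sup>+z. (\<Sum>k. ennreal (c k) * indicator (ball 0 ((1 / 2) ^ k)) (z::complex)) \<partial>lebesgue)"
    by (intro nn_integral_mono le)
  also have "\<dots> = (\<Sum>k. \<integral>\<^sup>+z. ennreal (c k) * indicator (ball 0 ((1 / 2) ^ k)) (z::complex) \<partial>lebesgue)"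
    by (rule nn_integral_suminf)
       (intro borel_measurable_times_ennreal borel_measurable_const borel_measurable_indicator, simp)
  also have "\<dots> = (\<Sum>k. ennreal (c k) * emeasure lebesgue (ball (0::complex) ((1 / 2) ^ k)))"
    by (simp add: nn_integral_cmult_indicator)
  also have "\<dots> = (\<Sum>k. ennreal (2 powr p * pi * (2 powr (p - 2)) ^ k))"
  proof (rule suminf_cong)
    fix k
    have "emeasure lebesgue (ball (0::complex) ((1 / 2) ^ k)) = ennreal (pi * ((1 / 2) ^ k)\<^sup>2)"
      by (simp add: emeasure_ball unit_ball_vol_2)
    moreover have "c k * (pi * ((1 / 2) ^ k)\<^sup>2) = 2 powr p * pi * (2 powr (p - 2)) ^ k"
    proof -
      have "((1 / 2 :: real) ^ k)\<^sup>2 = 2 powr (- 2 * real k)"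
        unfolding half_power_eq_powr power2_eq_square by (subst powr_add[symmetric]) simp
      moreover have "(2 powr (p - 2)) ^ k = 2 powr ((p - 2) * real k)"
        by (simp add: powr_realpow[symmetric] powr_powr)
      ultimately show ?thesis
        by (simp add: c_def powr_add[symmetric] algebra_simps)
    qed
    ultimately show "ennreal (c k) * emeasure lebesgue (ball (0::complex) ((1 / 2) ^ k)) = 
        ennreal (2 powr p * pi * (2 powr (p - 2)) ^ k)"
      by (simp add: ennreal_mult[symmetric] c_def)
  qed
  also have "\<dots> = ennreal (\<Sum>k. 2 powr p * pi * (2 powr (p - 2)) ^ k)"
  proof (rule suminf_ennreal2)
    have "norm ((2::real) powr (p - 2)) < 1"
      using assms powr_less_mono[of "p - 2" 0 "2::real"] by simp
    then show "summable (\<lambda>k. 2 powr p * pi * (2 powr (p - 2)) ^ k)"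
      by (intro summable_mult summable_geometric)
  qed auto
  finally show ?thesis by (auto simp: less_top[symmetric] top_unique)
qed

text \<open>Split at distance \<open>1\<close> from \<open>z\<close>. The near part is bounded by a
  translate of the integral over the unit ball; in the far part the integrand is at most
  \<open>1\<close>, which leaves the measure of \<open>S\<close>. Neither bound depends on
  \<open>z\<close>.\<close>

lemma nn_integral_norm_diff_powr_bounded:
  assumes "0 \<le> p" "p < 2" "bounded S" "S \<in> sets lebesgue"
  obtains C :: real where "C \<ge> 0"
    "\<And>z. (\<integral>\<^sup>+\<zeta>. indicator S \<zeta> * ennreal (norm (\<zeta> - z :: complex) powr - p) \<partial>lebesgue) \<le> ennreal C"
proof -
  define I where "I = (\<integral>\<^sup>+z. indicator (ball 0 1) z * ennreal (norm (z::complex) powr - p) \<partial>lebesgue)"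
  define G :: "complex \<Rightarrow> ennreal" where "G = (\<lambda>w. indicator (ball 0 1) w * ennreal (norm w powr - p))"
  have "G \<in> borel_measurable borel" unfolding G_def
    by (intro borel_measurable_times_ennreal borel_measurable_indicator) (simp, measurable)
  then have G: "G \<in> borel_measurable lebesgue" by (intro measurable_completion) simp
  have Gz: "(\<lambda>\<zeta>. G (\<zeta> - z)) \<in> borel_measurable lebesgue" for z
    using measurable_compose[OF measurable_lebesgue_plus[of "- z"] G] by simp
  have fin: "I + emeasure lebesgue S < \<infinity>"
    using nn_integral_norm_powr_finite[OF assms(1,2)] bounded_set_imp_lmeasurable[OF assms(3,4)]
    by (auto simp: I_def fmeasurable_def)
  have "(\<integral>\<^sup>+\<zeta>. indicator S \<zeta> * ennreal (norm (\<zeta> - z :: complex) powr - p) \<partial>lebesgue) \<le> I + emeasure lebesgue S" for z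
  proof -
    have "indicator S \<zeta> * ennreal (norm (\<zeta> - z) powr - p) \<le>
        G (\<zeta> - z) + indicator S \<zeta>" for \<zeta>
    proof (cases "norm (\<zeta> - z) < 1")
      case True
      then show ?thesis by (cases "\<zeta> \<in> S") (auto simp: G_def add_increasing2)
    next
      case False
      then have "norm (\<zeta> - z) powr - p \<le> 1"
        using assms(1) by (simp add: powr_minus inverse_le_1_iff ge_one_powr_ge_zero)
      then show ?thesis by (cases "\<zeta> \<in> S") (auto simp: add_increasing)
    qed
    then have "(\<integral>\<^sup>+\<zeta>. indicator S \<zeta> * ennreal (norm (\<zeta> - z :: complex) powr - p) \<partial>lebesgue) \<le>
       (\<integral>\<^sup>+\<zeta>. G (\<zeta> - z) + indicator S \<zeta> \<partial>lebesgue)"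
      by (intro nn_integral_mono)
    also have "\<dots> = (\<integral>\<^sup>+\<zeta>. G (\<zeta> - z) \<partial>lebesgue) + emeasure lebesgue S"
      using Gz assms(4) by (subst nn_integral_add) auto
    also have "(\<integral>\<^sup>+\<zeta>. G (\<zeta> - z) \<partial>lebesgue) = I"
      using lebesgue_nn_integral_shift[OF G, of "- z"] by (simp add: I_def G_def)
    finally show ?thesis .
  qed
  moreover obtain C where "C \<ge> 0" "I + emeasure lebesgue S = ennreal C"
    using fin by (cases "I + emeasure lebesgue S") auto
  ultimately show ?thesis using that by metis
qed

text \<open>The integral runs over the whole plane, so functions on the disk are first extended by
  zero. The integrand is \<open>0\<close> at the pole, by division by zero, and the value is
  \<open>0\<close> wherever the integral does not converge.\<close>

definition cauchy :: "(complex \<Rightarrow> complex) \<Rightarrow> complex \<Rightarrow> complex" where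
  "cauchy f z = - (1 / of_real pi) * (LINT \<zeta>|lebesgue. f \<zeta> / (\<zeta> - z))"

text \<open>The one estimate on which the transform is based: it yields convergence of the integral
  at every point, a uniform bound on \<open>cauchy f\<close>, and Fubini's theorem against any
  integrable function. It holds for the coefficient \<open>A\<close>, extended by zero, as well as
  for test functions.\<close>

definition cauchy_bounded :: "(complex \<Rightarrow> complex) \<Rightarrow> real \<Rightarrow> bool" where
  "cauchy_bounded f M \<longleftrightarrow> M \<ge> 0 \<and> f \<in> borel_measurable lebesgue \<and>
     (\<forall>z. (\<integral>\<^sup>+\<zeta>. ennreal (norm (f \<zeta> / (\<zeta> - z))) \<partial>lebesgue) \<le> ennreal M)"

lemma norm_diff_powr_minus_1: "norm (\<zeta> - z) powr - 1 = 1 / norm (\<zeta> - z :: complex)"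
  by (cases "\<zeta> = z") (simp_all add: powr_minus divide_inverse)

text \<open>\<open>C\<close> depends on \<open>K\<close> alone and the bound is linear in
  \<open>B\<close>. Through this linearity a quadratically small remainder keeps a quadratically
  small transform.\<close>

lemma cauchy_bounded_if_bounded:
  assumes "compact K"
  obtains C where "\<And>f B. f \<in> borel_measurable lebesgue \<Longrightarrow> (\<And>z. norm (f z) \<le> B) \<Longrightarrow>
    (\<And>z. z \<notin> K \<Longrightarrow> f z = 0) \<Longrightarrow> cauchy_bounded f (B * C)"
proof -
  have K: "K \<in> sets lebesgue" using assms lmeasurable_compact by blast
  obtain C where C: "C \<ge> 0" "\<And>z. (\<integral>\<^sup>+\<zeta>. indicator K \<zeta> * ennreal (norm (\<zeta> - z) powr - 1) \<partial>lebesgue) \<le> ennreal C"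
    using nn_integral_norm_diff_powr_bounded[of 1 K] assms K compact_imp_bounded by auto
  have "cauchy_bounded f (B * C)"
    if f: "f \<in> borel_measurable lebesgue" and bd: "\<And>z. norm (f z) \<le> B" and supp: "\<And>z. z \<notin> K \<Longrightarrow> f z = 0"
    for f B
  proof -
    have B: "B \<ge> 0" using order_trans[OF norm_ge_zero bd] .
    have "(\<integral>\<^sup>+\<zeta>. ennreal (norm (f \<zeta> / (\<zeta> - z))) \<partial>lebesgue) \<le> ennreal (B * C)" for z
    proof -
      have m: "(\<lambda>\<zeta>. ennreal (norm (\<zeta> - z) powr - 1)) \<in> borel_measurable lebesgue"
        by (intro measurable_completion) (simp, measurable)
      have "ennreal (norm (f \<zeta> / (\<zeta> - z))) \<le> ennreal B * (indicator K \<zeta> * ennreal (norm (\<zeta> - z) powr - 1))" for \<zeta>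
        using bd[of \<zeta>] supp[of \<zeta>] B
        by (auto simp: norm_diff_powr_minus_1 indicator_def norm_mult norm_inverse ennreal_mult[symmetric] divide_inverse
            intro!: ennreal_leI mult_right_mono)
      then have "(\<integral>\<^sup>+\<zeta>. ennreal (norm (f \<zeta> / (\<zeta> - z))) \<partial>lebesgue) \<le>
         (\<integral>\<^sup>+\<zeta>. ennreal B * (indicator K \<zeta> * ennreal (norm (\<zeta> - z) powr - 1)) \<partial>lebesgue)"
        by (intro nn_integral_mono)
      also have "\<dots> = ennreal B * (\<integral>\<^sup>+\<zeta>. indicator K \<zeta> * ennreal (norm (\<zeta> - z) powr - 1) \<partial>lebesgue)"
        using m K by (intro nn_integral_cmult) auto
      also have "\<dots> \<le> ennreal B * ennreal C"
        by (intro mult_left_mono C) auto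
      finally show ?thesis using B C by (simp add: ennreal_mult)
    qed
    with f B C(1) show ?thesis by (simp add: cauchy_bounded_def)
  qed
  then show ?thesis using that by blast
qed

text \<open>Young's inequality replaces Hoelder's: \<open>x * y \<le> x powr q + y powr p\<close> with conjugate exponents, and \<open>p < 2\<close>.\<close>

lemma cauchy_bounded_Lspace:
  assumes "q > 2" "A \<in> Lspace q \<Omega>" "\<Omega> \<in> sets lebesgue" "bounded \<Omega>"
  obtains M where "cauchy_bounded (\<lambda>z. indicator \<Omega> z *\<^sub>R A z) M"
proof -
  define p where "p = q / (q - 1)"
  have p: "0 \<le> p" "p < 2" "p > 1" using assms(1) by (auto simp: p_def field_simps)
  have qp: "1 / q + 1 / p = 1" using assms(1) by (simp add: p_def field_simps)
  obtain C where C: "C \<ge> 0" "\<And>z. (\<integral>\<^sup>+\<zeta>. indicator \<Omega> \<zeta> * ennreal (norm (\<zeta> - z) powr - p) \<partial>lebesgue) \<le> ennreal C"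
    using nn_integral_norm_diff_powr_bounded[of p \<Omega>] p assms(3,4) by auto
  have A: "A \<in> borel_measurable (lebesgue_on \<Omega>)" "integrable (lebesgue_on \<Omega>) (\<lambda>z. norm (A z) powr q)"
    using assms(2) by (auto simp: Lspace_def)
  have mA: "(\<lambda>z. indicator \<Omega> z *\<^sub>R A z) \<in> borel_measurable lebesgue"
    using A(1) assms(3) by (simp add: borel_measurable_restrict_space_iff)
  define N where "N = (LINT z|lebesgue. indicator \<Omega> z *\<^sub>R norm (A z) powr q)"
  have iN: "integrable lebesgue (\<lambda>z. indicator \<Omega> z *\<^sub>R norm (A z) powr q)"
    using A(2) assms(3) by (simp add: integrable_restrict_space)
  have N: "(\<integral>\<^sup>+z. ennreal (indicator \<Omega> z *\<^sub>R norm (A z) powr q) \<partial>lebesgue) = ennreal N" "N \<ge> 0"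
    unfolding N_def using iN by (intro nn_integral_eq_integral integral_nonneg_AE AE_I2; simp)+
  have "(\<integral>\<^sup>+\<zeta>. ennreal (norm ((indicator \<Omega> \<zeta> *\<^sub>R A \<zeta>) / (\<zeta> - z))) \<partial>lebesgue) \<le> ennreal (N + C)" for z
  proof -
    have m: "(\<lambda>\<zeta>. ennreal (norm (\<zeta> - z) powr - p)) \<in> borel_measurable lebesgue"
      by (intro measurable_completion) (simp, measurable)
    have "ennreal (norm ((indicator \<Omega> \<zeta> *\<^sub>R A \<zeta>) / (\<zeta> - z))) \<le>
        ennreal (indicator \<Omega> \<zeta> *\<^sub>R norm (A \<zeta>) powr q) + indicator \<Omega> \<zeta> * ennreal (norm (\<zeta> - z) powr - p)" for \<zeta>
    proof (cases "\<zeta> \<in> \<Omega>")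
      case True
      have "norm (A \<zeta>) * (norm (\<zeta> - z) powr - 1) \<le>
          (norm (A \<zeta>)) powr q / q + (norm (\<zeta> - z) powr - 1) powr p / p"
        using qp assms(1) p by (intro Youngs_inequality) auto
      also have "\<dots> \<le> (norm (A \<zeta>)) powr q + (norm (\<zeta> - z) powr - 1) powr p"
      proof (intro add_mono)
        have "p \<ge> 1" using assms(1) by (simp add: p_def field_simps)
        then show "(norm (\<zeta> - z) powr - 1) powr p / p \<le> (norm (\<zeta> - z) powr - 1) powr p"
          by (simp add: divide_le_eq mult_left_le mult_le_cancel_left1)
        show "(norm (A \<zeta>)) powr q / q \<le> (norm (A \<zeta>)) powr q"
          using assms(1) by (simp add: divide_le_eq mult_left_le mult_le_cancel_left1)
      qed
      also have "(norm (\<zeta> - z) powr - 1) powr p = norm (\<zeta> - z) powr - p"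
        by (subst powr_powr) simp
      finally have "norm (A \<zeta> / (\<zeta> - z)) \<le> norm (A \<zeta>) powr q + norm (\<zeta> - z) powr - p"
        by (simp add: norm_diff_powr_minus_1 norm_divide)
      then show ?thesis
        using True by (simp add: ennreal_plus[symmetric] ennreal_leI del: ennreal_plus)
    qed simp
    then have "(\<integral>\<^sup>+\<zeta>. ennreal (norm ((indicator \<Omega> \<zeta> *\<^sub>R A \<zeta>) / (\<zeta> - z))) \<partial>lebesgue) \<le>
       (\<integral>\<^sup>+\<zeta>. ennreal (indicator \<Omega> \<zeta> *\<^sub>R norm (A \<zeta>) powr q) + indicator \<Omega> \<zeta> * ennreal (norm (\<zeta> - z) powr - p) \<partial>lebesgue)"
      by (intro nn_integral_mono)
    also have "\<dots> = ennreal N + (\<integral>\<^sup>+\<zeta>. indicator \<Omega> \<zeta> * ennreal (norm (\<zeta> - z) powr - p) \<partial>lebesgue)"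
      unfolding N(1)[symmetric] using iN m assms(3) by (intro nn_integral_add) auto
    also have "\<dots> \<le> ennreal N + ennreal C"
      by (intro add_left_mono C)
    finally show ?thesis using N(2) C(1) by simp
  qed
  then have "cauchy_bounded (\<lambda>z. indicator \<Omega> z *\<^sub>R A z) (N + C)"
    using mA N(2) C(1) by (simp add: cauchy_bounded_def)
  then show ?thesis using that by blast
qed

lemma cauchy_bounded_integrable:
  assumes "cauchy_bounded f M"
  shows "integrable lebesgue (\<lambda>\<zeta>. f \<zeta> / (\<zeta> - z))"
proof (rule integrableI_bounded)
  show "(\<lambda>\<zeta>. f \<zeta> / (\<zeta> - z)) \<in> borel_measurable lebesgue"
    using assms unfolding cauchy_bounded_def
    by (auto intro!: borel_measurable_divide borel_measurable_diff)
  have "(\<integral>\<^sup>+\<zeta>. ennreal (norm (f \<zeta> / (\<zeta> - z))) \<partial>lebesgue) \<le> ennreal M"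
    using assms by (simp add: cauchy_bounded_def)
  also have "\<dots> < \<infinity>" by simp
  finally show "(\<integral>\<^sup>+\<zeta>. ennreal (norm (f \<zeta> / (\<zeta> - z))) \<partial>lebesgue) < \<infinity>" .
qed

lemma norm_cauchy_le:
  assumes "cauchy_bounded f M"
  shows "norm (cauchy f z) \<le> M"
proof -
  have M: "M \<ge> 0" using assms by (simp add: cauchy_bounded_def)
  have "ennreal (norm (LINT \<zeta>|lebesgue. f \<zeta> / (\<zeta> - z))) \<le> (\<integral>\<^sup>+\<zeta>. ennreal (norm (f \<zeta> / (\<zeta> - z))) \<partial>lebesgue)"
    by (rule integral_norm_bound_ennreal[OF cauchy_bounded_integrable[OF assms]])
  also have "\<dots> \<le> ennreal M" using assms by (simp add: cauchy_bounded_def)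
  finally have "norm (LINT \<zeta>|lebesgue. f \<zeta> / (\<zeta> - z)) \<le> M" using M by simp
  moreover have "norm (cauchy f z) = norm (LINT \<zeta>|lebesgue. f \<zeta> / (\<zeta> - z)) / pi"
    by (simp add: cauchy_def norm_mult norm_divide)
  moreover have "\<dots> \<le> norm (LINT \<zeta>|lebesgue. f \<zeta> / (\<zeta> - z))"
    using pi_gt3 by (simp add: divide_le_eq mult_left_le mult_le_cancel_left1)
  ultimately show ?thesis by linarith
qed

section \<open>Measurability and Fubini's theorem for the transform\<close>

lemma cauchy_kernel_measurable:
  fixes f g :: "complex \<Rightarrow> complex"
  assumes "f \<in> borel_measurable lebesgue" "g \<in> borel_measurable lebesgue"
  shows "(\<lambda>(\<zeta>, z). f \<zeta> * g z / (\<zeta> - z)) \<in> borel_measurable (lebesgue \<Otimes>\<^sub>M lebesgue)"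
proof -
  have D: "(\<lambda>x. fst x - snd x) \<in> lebesgue \<Otimes>\<^sub>M lebesgue \<rightarrow>\<^sub>M (borel :: complex measure)"
    by (rule borel_measurable_diff[OF measurable_compose[OF measurable_fst measurable_ident_lebesgue]
      measurable_compose[OF measurable_snd measurable_ident_lebesgue]])
  show ?thesis unfolding split_beta'
    by (rule borel_measurable_divide[OF borel_measurable_times[OF 
        measurable_compose[OF measurable_fst assms(1)] measurable_compose[OF measurable_snd assms(2)]] D])
qed

lemma cauchy_measurable:
  assumes "f \<in> borel_measurable lebesgue"
  shows "cauchy f \<in> borel_measurable lebesgue"
proof -
  have "(\<lambda>z. LINT \<zeta>|lebesgue. f \<zeta> * 1 / (\<zeta> - z)) \<in> borel_measurable lebesgue"
    using measurable_pair_swap[OF cauchy_kernel_measurable[OF assms borel_measurable_const[of 1]]]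
    by (intro lebesgue.borel_measurable_lebesgue_integral) simp
  then show ?thesis
    unfolding cauchy_def[abs_def] by (intro borel_measurable_times borel_measurable_const) simp
qed

text \<open>The sign comes from the antisymmetry of the kernel in its two variables. The uniform
  bound is required of \<open>f\<close> only: integrating first in the variable of \<open>f\<close>
  gives at most \<open>M\<close> times the norm of \<open>g\<close>, so \<open>g\<close> may be any
  integrable function, although the integral defining \<open>cauchy g\<close> may then diverge at
  some points.\<close>

lemma cauchy_Fubini:
  assumes f: "cauchy_bounded f M" and g: "integrable lebesgue g"
  shows cauchy_Fubini_integrable1: "integrable lebesgue (\<lambda>z. cauchy f z * g z)"
    and cauchy_Fubini_integrable2: "integrable lebesgue (\<lambda>z. f z * cauchy g z)"
    and cauchy_Fubini_eq: "(LINT z|lebesgue. cauchy f z * g z) = - (LINT z|lebesgue. f z * cauchy g z)"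
proof -
  let ?H = "\<lambda>(\<zeta>, z). f \<zeta> * g z / (\<zeta> - z)"
  have fm: "f \<in> borel_measurable lebesgue" and gm: "g \<in> borel_measurable lebesgue"
    using f g by (auto simp: cauchy_bounded_def)
  note Hm = cauchy_kernel_measurable[OF fm gm]
  have H: "integrable (lebesgue \<Otimes>\<^sub>M lebesgue) ?H"
  proof (rule integrableI_bounded[OF Hm])
    have "(\<integral>\<^sup>+x. ennreal (norm (?H x)) \<partial>(lebesgue \<Otimes>\<^sub>M lebesgue)) =
       (\<integral>\<^sup>+z. (\<integral>\<^sup>+\<zeta>. ennreal (norm (?H (\<zeta>, z))) \<partial>lebesgue) \<partial>lebesgue)"
      by (rule lebesgue2.nn_integral_snd[symmetric])
         (rule measurable_compose[OF measurable_compose[OF Hm borel_measurable_norm] measurable_ennreal])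
    also have "\<dots> \<le> (\<integral>\<^sup>+z. ennreal M * ennreal (norm (g z)) \<partial>lebesgue)"
    proof (intro nn_integral_mono)
      fix z
      have "(\<integral>\<^sup>+\<zeta>. ennreal (norm (?H (\<zeta>, z))) \<partial>lebesgue) = 
        (\<integral>\<^sup>+\<zeta>. ennreal (norm (g z)) * ennreal (norm (f \<zeta> / (\<zeta> - z))) \<partial>lebesgue)"
        by (intro nn_integral_cong) (simp add: ennreal_mult[symmetric] norm_mult norm_divide)
      also have "\<dots> = ennreal (norm (g z)) * (\<integral>\<^sup>+\<zeta>. ennreal (norm (f \<zeta> / (\<zeta> - z))) \<partial>lebesgue)"
        using borel_measurable_integrable[OF cauchy_bounded_integrable[OF f]] by (intro nn_integral_cmult) simp
      also have "\<dots> \<le> ennreal (norm (g z)) * ennreal M"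
        using f by (intro mult_left_mono) (auto simp: cauchy_bounded_def)
      finally show "(\<integral>\<^sup>+\<zeta>. ennreal (norm (?H (\<zeta>, z))) \<partial>lebesgue) \<le> ennreal M * ennreal (norm (g z))"
        by (simp add: mult.commute)
    qed
    also have "\<dots> = ennreal M * (\<integral>\<^sup>+z. ennreal (norm (g z)) \<partial>lebesgue)"
      using gm by (intro nn_integral_cmult) simp
    also have "\<dots> < \<infinity>"
      using g by (simp add: integrable_iff_bounded ennreal_mult_less_top)
    finally show "(\<integral>\<^sup>+x. ennreal (norm (?H x)) \<partial>(lebesgue \<Otimes>\<^sub>M lebesgue)) < \<infinity>" .
  qed
  have I1: "(LINT \<zeta>|lebesgue. f \<zeta> * g z / (\<zeta> - z)) = - of_real pi * (cauchy f z * g z)" for z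
  proof -
    have "(LINT \<zeta>|lebesgue. f \<zeta> * g z / (\<zeta> - z)) = (LINT \<zeta>|lebesgue. g z * (f \<zeta> / (\<zeta> - z)))"
      by (intro Bochner_Integration.integral_cong) auto
    then show ?thesis by (simp only: integral_mult_right_zero cauchy_def) simp
  qed
  have I2: "(LINT z|lebesgue. f \<zeta> * g z / (\<zeta> - z)) = of_real pi * (f \<zeta> * cauchy g \<zeta>)" for \<zeta>
  proof -
    have "(LINT z|lebesgue. f \<zeta> * g z / (\<zeta> - z)) = (LINT z|lebesgue. - f \<zeta> * (g z / (z - \<zeta>)))"
    proof (intro Bochner_Integration.integral_cong refl)
      fix z
      show "f \<zeta> * g z / (\<zeta> - z) = - f \<zeta> * (g z / (z - \<zeta>))"
        using minus_divide_right[of "f \<zeta> * g z" "z - \<zeta>"] by simp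
    qed
    then show ?thesis by (simp only: integral_mult_right_zero cauchy_def) simp
  qed
  have "integrable lebesgue (\<lambda>z. - of_real pi * (cauchy f z * g z))"
    using lebesgue2.integrable_snd[of "\<lambda>\<zeta> z. f \<zeta> * g z / (\<zeta> - z)"] H unfolding I1 by simp
  from integrable_mult_right[OF this, of "- 1 / of_real pi"]
  show "integrable lebesgue (\<lambda>z. cauchy f z * g z)" by simp
  have "integrable lebesgue (\<lambda>\<zeta>. of_real pi * (f \<zeta> * cauchy g \<zeta>))"
    using lebesgue2.integrable_fst[of "\<lambda>\<zeta> z. f \<zeta> * g z / (\<zeta> - z)"] H unfolding I2 by simp
  from integrable_mult_right[OF this, of "1 / of_real pi"]
  show "integrable lebesgue (\<lambda>z. f z * cauchy g z)" by simp
  have "(LINT z|lebesgue. LINT \<zeta>|lebesgue. f \<zeta> * g z / (\<zeta> - z)) = (LINT \<zeta>|lebesgue. LINT z|lebesgue. f \<zeta> * g z / (\<zeta> - z))"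
    using lebesgue2.Fubini_integral[of "\<lambda>\<zeta> z. f \<zeta> * g z / (\<zeta> - z)"] H by simp
  then have "of_real pi * - (LINT z|lebesgue. cauchy f z * g z) = of_real pi * (LINT z|lebesgue. f z * cauchy g z)"
    unfolding I1 I2 by (simp only: integral_mult_right_zero) simp
  then have "- (LINT z|lebesgue. cauchy f z * g z) = (LINT z|lebesgue. f z * cauchy g z)"
    by (subst (asm) mult_left_cancel) auto
  then show "(LINT z|lebesgue. cauchy f z * g z) = - (LINT z|lebesgue. f z * cauchy g z)"
    by (metis minus_minus)
qed

section \<open>The Cauchy--Pompeiu formula\<close>

lemma has_derivative_difference_quotient:
  fixes f :: "complex \<Rightarrow> complex"
  assumes "(f has_derivative D) (at z)"
  shows "(\<lambda>n. real (Suc n) *\<^sub>R (f (v /\<^sub>R real (Suc n) + z) - f z)) \<longlonglongrightarrow> D v"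
proof (cases "v = 0")
  case True
  then show ?thesis using linear_0[OF has_derivative_linear[OF assms]] by simp
next
  case False
  define y where "y = (\<lambda>n. v /\<^sub>R real (Suc n) + z)"
  have "(\<lambda>n. inverse (real (Suc n)) *\<^sub>R v) \<longlonglongrightarrow> 0 *\<^sub>R v"
    by (intro tendsto_intros LIMSEQ_inverse_real_of_nat)
  then have "y \<longlonglongrightarrow> 0 *\<^sub>R v + z"
    unfolding y_def by (rule tendsto_add[OF _ tendsto_const])
  then have y: "filterlim y (at z) sequentially"
    unfolding filterlim_at using False by (auto simp: y_def)
  have "((\<lambda>y. norm (f y - f z - D (y - z)) / norm (y - z)) \<longlongrightarrow> 0) (at z)"
    using assms unfolding has_derivative_iff_norm by simp
  from tendsto_mult[OF filterlim_compose[OF this y] tendsto_const[of "norm v"]]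
  have "(\<lambda>n. norm (f (y n) - f z - D (y n - z)) / norm (y n - z) * norm v) \<longlonglongrightarrow> 0"
    by simp
  moreover have "norm (f (y n) - f z - D (y n - z)) / norm (y n - z) * norm v
      = norm (real (Suc n) *\<^sub>R (f (y n) - f z) - D v)" for n
  proof -
    have "D (y n - z) = D v /\<^sub>R real (Suc n)"
      using linear_scale[OF has_derivative_linear[OF assms]] by (simp add: y_def)
    then have "real (Suc n) *\<^sub>R (f (y n) - f z) - D v = real (Suc n) *\<^sub>R (f (y n) - f z - D (y n - z))"
      by (simp add: scaleR_diff_right)
    moreover have "norm (y n - z) = norm v / real (Suc n)"
      by (simp add: y_def divide_inverse mult.commute)
    ultimately show ?thesis
      using False by (simp only: norm_scaleR) simp
  qed
  ultimately have "(\<lambda>n. norm (real (Suc n) *\<^sub>R (f (y n) - f z) - D v)) \<longlonglongrightarrow> 0" by simp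
  then show ?thesis
    unfolding y_def by (subst (asm) tendsto_norm_zero_iff) (rule Lim_null[THEN iffD2])
qed

text \<open>By translation invariance the difference quotients have integral zero; the Lipschitz
  constant and the compact support supply a majorant, so the limit has integral zero too.
  Differentiability almost everywhere suffices, which admits the truncated kernel with its circle of
  corners.\<close>

lemma integral_derivative_lipschitz_compact_support:
  fixes f :: "complex \<Rightarrow> complex"
  assumes lip: "\<And>x y. norm (f x - f y) \<le> L * norm (x - y)"
    and K: "compact K" "\<And>z. z \<notin> K \<Longrightarrow> f z = 0"
    and D: "AE z in lebesgue. (f has_derivative D z) (at z)"
    and meas: "(\<lambda>z. D z v) \<in> borel_measurable lebesgue"
  shows "integrable lebesgue (\<lambda>z. D z v)" "(LINT z|lebesgue. D z v) = 0"
proof -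
  obtain R where R: "\<And>z. z \<in> K \<Longrightarrow> norm z \<le> R"
    using compact_imp_bounded[OF K(1)] by (auto simp: bounded_iff)
  have L: "L \<ge> 0" using lip[of 1 0] order_trans[OF norm_ge_zero] by fastforce
  have cont: "continuous_on UNIV f"
    using lipschitz_on_continuous_on[of L UNIV f] lip L by (auto simp: lipschitz_on_def dist_norm)
  note fm = continuous_borel_measurable_lebesgue[OF cont]
  have fi: "integrable lebesgue f"
  proof -
    obtain B where "\<And>z. norm (f z) \<le> B"
      using continuous_compact_support_bounded[OF cont K] by blast
    from locally_integrable_mult_bounded[OF locally_integrable_const[of 1 UNIV] K(1) _ fm this K(2)]
    show ?thesis by simp
  qed
  define s where "s = (\<lambda>n z. real (Suc n) *\<^sub>R (f (v /\<^sub>R real (Suc n) + z) - f z))"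
  have si: "integrable lebesgue (s n)" for n
    unfolding s_def by (intro integrable_scaleR_right Bochner_Integration.integrable_diff lebesgue_integrable_shift fi)
  have s0: "(LINT z|lebesgue. s n z) = 0" for n
    unfolding s_def using lebesgue_integral_shift[OF fm]
    by (simp add: Bochner_Integration.integral_diff lebesgue_integrable_shift fi)
  have conv: "AE z in lebesgue. (\<lambda>n. s n z) \<longlonglongrightarrow> D z v"
    using D unfolding s_def by eventually_elim (rule has_derivative_difference_quotient)
  \<comment> \<open>Every step \<open>v / (n + 1)\<close> is no longer than \<open>v\<close>, so all
    quotients vanish outside one ball.\<close>
  have bound: "norm (s n z) \<le> indicator (cball 0 (R + norm v)) z *\<^sub>R (L * norm v)" for n z
  proof (cases "z \<in> cball 0 (R + norm v)")
    case True
    have "norm (s n z) \<le> real (Suc n) * (L * norm (v /\<^sub>R real (Suc n)))"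
      using lip[of "v /\<^sub>R real (Suc n) + z" z] unfolding s_def norm_scaleR by (intro mult_mono) auto
    also have "\<dots> = L * norm v" by simp
    finally show ?thesis using True by simp
  next
    case False
    have "norm (v /\<^sub>R real (Suc n)) \<le> norm v"
      by (simp add: field_simps mult_left_le inverse_le_1_iff)
    then have "norm (v /\<^sub>R real (Suc n) + z) \<ge> norm z - norm v"
      using norm_diff_ineq[of z "v /\<^sub>R real (Suc n)"] by (simp add: add.commute)
    then have "f (v /\<^sub>R real (Suc n) + z) = 0"
      using False R[of "v /\<^sub>R real (Suc n) + z"] by (intro K(2)) auto
    moreover have "f z = 0"
      using False R[of z] norm_ge_zero[of v] by (intro K(2)) (auto simp del: norm_ge_zero)
    ultimately show ?thesis using False by (simp add: s_def)
  qed
  have wi: "integrable lebesgue (\<lambda>z. indicator (cball (0::complex) (R + norm v)) z *\<^sub>R (L * norm v))"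
    using lmeasurable_cball[of "0::complex" "R + norm v"]
    by (intro integrable_scaleR_left integrable_real_indicator) (auto simp: fmeasurable_def)
  note dct = meas borel_measurable_integrable[OF si] wi conv AE_I2[OF bound]
  show "integrable lebesgue (\<lambda>z. D z v)"
    by (rule integrable_dominated_convergence[OF dct])
  have "(\<lambda>n. LINT z|lebesgue. s n z) \<longlonglongrightarrow> (LINT z|lebesgue. D z v)"
    by (rule integral_dominated_convergence[OF dct])
  then show "(LINT z|lebesgue. D z v) = 0"
    unfolding s0 using LIMSEQ_unique tendsto_const by blast
qed

text \<open>A Lipschitz truncation of the kernel \<open>1 / w\<close>, whose \<open>dbar\<close> is the normalized indicator of a disk.\<close>

definition kreg :: "real \<Rightarrow> complex \<Rightarrow> complex" where
  "kreg \<delta> w = (if norm w \<le> \<delta> then cnj w / of_real (\<delta>\<^sup>2) else 1 / w)"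

text \<open>On each side of the circle the difference is computed explicitly. For points on
  different sides, inversion is expressed through reflection in the circle, which reduces the
  estimate to a comparison of two distances.\<close>

lemma kreg_lipschitz:
  assumes "\<delta> > 0"
  shows "norm (kreg \<delta> a - kreg \<delta> b) \<le> (1 / \<delta>\<^sup>2) * norm (a - b)"
proof -
  have mixed: "norm (kreg \<delta> a - kreg \<delta> b) \<le> (1 / \<delta>\<^sup>2) * norm (a - b)"
    if a: "norm a \<le> \<delta>" and b: "\<delta> < norm b" for a b
  proof -
    \<comment> \<open>\<open>t *\<^sub>R b\<close> is the reflection of \<open>b\<close> in the
      circle of radius \<open>\<delta>\<close>, and \<open>1 / b\<close> is its conjugate divided by
      \<open>\<delta>\<^sup>2\<close>. It remains to see that the reflected point is no farther than
      \<open>b\<close> from the point \<open>a\<close> of the disk.\<close>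
    define t where "t = \<delta>\<^sup>2 / (norm b)\<^sup>2"
    have b0: "b \<noteq> 0" "norm b > 0" using assms b by auto
    have t: "0 \<le> t" "t \<le> 1"
      using assms b by (auto simp: t_def divide_le_eq_1 intro!: power_mono)
    have "1 / b = cnj b / of_real ((norm b)\<^sup>2)"
      using b0 by (simp add: complex_norm_square field_simps del: of_real_power)
    also have "\<dots> = cnj (t *\<^sub>R b) / of_real (\<delta>\<^sup>2)"
      using assms b0 by (simp add: t_def scaleR_conv_of_real)
    finally have "kreg \<delta> a - kreg \<delta> b = cnj (a - t *\<^sub>R b) / of_real (\<delta>\<^sup>2)"
      using a b by (simp add: kreg_def diff_divide_distrib)
    then have eq: "norm (kreg \<delta> a - kreg \<delta> b) = norm (a - t *\<^sub>R b) / \<delta>\<^sup>2"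
      by (simp only: norm_divide complex_mod_cnj norm_of_real) simp
    have "a \<bullet> b \<le> norm a * norm b" by (rule norm_cauchy_schwarz)
    also have "\<dots> \<le> \<delta> * norm b" using a by (intro mult_right_mono) auto
    finally have ab: "2 * (a \<bullet> b) \<le> (norm b)\<^sup>2 + \<delta>\<^sup>2"
      using sum_squares_bound[of \<delta> "norm b"] by linarith
    have tb: "t * (b \<bullet> b) = \<delta>\<^sup>2"
      using b0 by (simp add: t_def power2_norm_eq_inner[symmetric])
    have "(norm (a - b))\<^sup>2 - (norm (a - t *\<^sub>R b))\<^sup>2 = (1 - t) * ((1 + t) * (b \<bullet> b) - 2 * (a \<bullet> b))"
      by (simp add: power2_norm_eq_inner inner_diff_left inner_diff_right inner_commute algebra_simps)
    also have "(1 + t) * (b \<bullet> b) = (norm b)\<^sup>2 + \<delta>\<^sup>2"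
      by (simp add: distrib_right tb power2_norm_eq_inner)
    also have "(1 - t) * ((norm b)\<^sup>2 + \<delta>\<^sup>2 - 2 * (a \<bullet> b)) \<ge> 0"
      using t ab by (intro mult_nonneg_nonneg) auto
    finally have "(norm (a - t *\<^sub>R b))\<^sup>2 \<le> (norm (a - b))\<^sup>2" by linarith
    then have "norm (a - t *\<^sub>R b) \<le> norm (a - b)"
      by (rule power2_le_imp_le) (rule norm_ge_zero)
    then show ?thesis
      unfolding eq using assms by (simp add: divide_right_mono)
  qed
  consider "norm a \<le> \<delta>" "norm b \<le> \<delta>" | "norm a \<le> \<delta>" "\<delta> < norm b" | "\<delta> < norm a" "norm b \<le> \<delta>"
    | "\<delta> < norm a" "\<delta> < norm b" by linarith
  then show ?thesis
  proof cases
    case 1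
    then have "kreg \<delta> a - kreg \<delta> b = cnj (a - b) / of_real (\<delta>\<^sup>2)"
      by (simp add: kreg_def diff_divide_distrib)
    then have "norm (kreg \<delta> a - kreg \<delta> b) = norm (a - b) / \<delta>\<^sup>2"
      by (simp only: norm_divide complex_mod_cnj norm_of_real) simp
    then show ?thesis by simp
  next
    case 2
    then show ?thesis by (rule mixed)
  next
    case 3
    from mixed[OF 3(2,1)] show ?thesis by (simp add: norm_minus_commute)
  next
    case 4
    then have ab: "a \<noteq> 0" "b \<noteq> 0" using assms by auto
    then have "kreg \<delta> a - kreg \<delta> b = (b - a) / (a * b)"
      using 4 by (simp add: kreg_def field_simps)
    then have "norm (kreg \<delta> a - kreg \<delta> b) = norm (a - b) / (norm a * norm b)"
      by (simp add: norm_divide norm_mult norm_minus_commute)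
    also have "\<dots> \<le> norm (a - b) / (\<delta> * \<delta>)"
      using 4 assms ab by (intro divide_left_mono mult_mono mult_pos_pos) auto
    finally show ?thesis by (simp add: power2_eq_square)
  qed
qed

lemma norm_kreg: "norm (kreg \<delta> w) = (if norm w \<le> \<delta> then norm w / \<delta>\<^sup>2 else 1 / norm w)"
  unfolding kreg_def by (simp only: norm_divide complex_mod_cnj norm_of_real if_distrib[of norm]) simp

lemma norm_kreg_le: "norm (kreg \<delta> w) \<le> 1 / \<delta>" if "\<delta> > 0"
proof (cases "norm w \<le> \<delta>")
  case True
  then have "norm w / \<delta>\<^sup>2 \<le> \<delta> / \<delta>\<^sup>2" by (intro divide_right_mono) auto
  with True that show ?thesis by (simp add: norm_kreg power2_eq_square)
qed (use that in \<open>simp add: norm_kreg frac_le\<close>)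

text \<open>Supplies the majorant, independent of \<open>\<delta>\<close>, for removing the
  truncation. At \<open>w = 0\<close> both sides are \<open>0\<close>.\<close>

lemma norm_kreg_le': "norm (kreg \<delta> w) \<le> norm (1 / w)" if "\<delta> > 0"
proof (cases "norm w \<le> \<delta> \<and> w \<noteq> 0")
  case True
  then have "norm w * norm w \<le> \<delta> * \<delta>" using that by (intro mult_mono) auto
  with True that show ?thesis
    by (simp add: norm_kreg norm_divide power2_eq_square field_simps)
qed (auto simp: norm_kreg norm_divide)

lemma kreg_has_derivative:
  assumes "norm w \<noteq> \<delta>" "\<delta> > 0"
  shows "(kreg \<delta> has_derivative (\<lambda>v. if norm w < \<delta> then cnj v / of_real (\<delta>\<^sup>2) else - v / w\<^sup>2)) (at w)"
proof (cases "norm w < \<delta>")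
  case True
  have "((\<lambda>w. cnj w / of_real (\<delta>\<^sup>2)) has_derivative (\<lambda>v. cnj v / of_real (\<delta>\<^sup>2))) (at w)"
    by (intro bounded_linear_imp_has_derivative bounded_linear_compose[OF bounded_linear_divide bounded_linear_cnj])
  then have "(kreg \<delta> has_derivative (\<lambda>v. cnj v / of_real (\<delta>\<^sup>2))) (at w)"
    by (rule has_derivative_transform_within_open[where s = "ball 0 \<delta>"]) (use True in \<open>auto simp: kreg_def\<close>)
  then show ?thesis using True by simp
next
  case False
  then have w: "norm w > \<delta>" "w \<noteq> 0" using assms by auto
  have "((\<lambda>w. 1 / w) has_field_derivative - 1 / w\<^sup>2) (at w)"
    using w by (auto intro!: derivative_eq_intros simp: power2_eq_square)
  then have "((\<lambda>w. 1 / w) has_derivative (\<lambda>v. - v / w\<^sup>2)) (at w)"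
    unfolding has_field_derivative_def by (rule has_derivative_eq_rhs) (simp add: fun_eq_iff)
  then have "(kreg \<delta> has_derivative (\<lambda>v. - v / w\<^sup>2)) (at w)"
    by (rule has_derivative_transform_within_open[where s = "- cball 0 \<delta>"]) (use w in \<open>auto simp: kreg_def\<close>)
  then show ?thesis using False by simp
qed

text \<open>The product of \<open>\<eta>\<close> with the truncated kernel is Lipschitz with compact
  support, so the integral of its \<open>dbar\<close> vanishes. The kernel itself contributes
  \<open>1 / \<delta>\<^sup>2\<close> inside the disk and, being holomorphic there, \<open>0\<close>
  outside; the circle is a null set.\<close>

lemma integral_dbar_mult_kreg:
  assumes \<eta>: "\<eta> \<in> test_functions UNIV" and \<delta>: "\<delta> > 0"
  shows "(LINT \<zeta>|lebesgue. dbar \<eta> \<zeta> * kreg \<delta> (\<zeta> - z)) =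
    - (LINT \<zeta>:ball z \<delta>|lebesgue. \<eta> \<zeta>) / of_real (\<delta>\<^sup>2)"
proof -
  define k' where "k' = (\<lambda>w v. if norm w < \<delta> then cnj v / of_real (\<delta>\<^sup>2) else - v / w\<^sup>2 :: complex)"
  define D where "D = (\<lambda>\<zeta> v. \<eta> \<zeta> * k' (\<zeta> - z) v + dir_deriv v \<eta> \<zeta> * kreg \<delta> (\<zeta> - z))"
  define f where "f = (\<lambda>\<zeta>. \<eta> \<zeta> * kreg \<delta> (\<zeta> - z))"
  obtain K where K: "smooth \<eta>" "compact K" "K \<subseteq> UNIV" "\<And>z. z \<notin> K \<Longrightarrow> \<eta> z = 0"
    using test_functionsE[OF \<eta>] by blast
  obtain B where B: "B > 0" "\<And>z. norm (\<eta> z) \<le> B" using test_bounded[OF \<eta>] by blast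
  obtain L where L: "L > 0" "\<And>x y. norm (\<eta> x - \<eta> y) \<le> L * norm (x - y)" using test_lipschitz[OF \<eta>] by metis
  have lip: "norm (f x - f y) \<le> (B / \<delta>\<^sup>2 + L / \<delta>) * norm (x - y)" for x y
  proof -
    have "f x - f y = \<eta> x * (kreg \<delta> (x - z) - kreg \<delta> (y - z)) + (\<eta> x - \<eta> y) * kreg \<delta> (y - z)"
      by (simp add: f_def algebra_simps)
    also have "norm \<dots> \<le> norm (\<eta> x) * norm (kreg \<delta> (x - z) - kreg \<delta> (y - z)) + norm (\<eta> x - \<eta> y) * norm (kreg \<delta> (y - z))"
      by (intro norm_triangle_le add_mono) (simp_all add: norm_mult)
    also have "\<dots> \<le> B * ((1 / \<delta>\<^sup>2) * norm (x - y)) + (L * norm (x - y)) * (1 / \<delta>)"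
      using kreg_lipschitz[OF \<delta>, of "x - z" "y - z"] B L \<delta>
      by (intro add_mono mult_mono norm_kreg_le) (auto intro: less_imp_le)
    finally show ?thesis by (simp add: algebra_simps)
  qed
  have "AE \<zeta> in lebesgue. \<zeta> \<notin> sphere z \<delta>"
    using negligible_sphere[of z \<delta>] by (intro AE_not_in) (simp add: negligible_iff_null_sets)
  then have der: "AE \<zeta> in lebesgue. (f has_derivative D \<zeta>) (at \<zeta>)"
  proof (rule AE_mp, intro AE_I2 impI)
    fix \<zeta> assume "\<zeta> \<notin> sphere z \<delta>"
    then have *: "norm (\<zeta> - z) \<noteq> \<delta>" by (auto simp: dist_norm norm_minus_commute)
    have "((\<lambda>\<zeta>. \<zeta> - z) has_derivative (\<lambda>v. v)) (at \<zeta>)"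
      by (auto intro!: derivative_eq_intros)
    from has_derivative_compose[OF this kreg_has_derivative[OF * \<delta>]]
    have "((\<lambda>\<zeta>. kreg \<delta> (\<zeta> - z)) has_derivative k' (\<zeta> - z)) (at \<zeta>)"
      unfolding k'_def .
    from has_derivative_mult[OF differentiable_imp_has_derivative_dir_deriv[OF smooth_differentiable[OF K(1)]] this]
    show "(f has_derivative D \<zeta>) (at \<zeta>)"
      unfolding f_def D_def .
  qed
  have km: "(\<lambda>\<zeta>. kreg \<delta> (\<zeta> - z)) \<in> borel_measurable lebesgue"
  proof (rule continuous_borel_measurable_lebesgue, rule lipschitz_on_continuous_on)
    show "(1 / \<delta>\<^sup>2)-lipschitz_on UNIV (\<lambda>\<zeta>. kreg \<delta> (\<zeta> - z))"
      using kreg_lipschitz[OF \<delta>, of "_ - z" "_ - z"] by (intro lipschitz_onI) (auto simp: dist_norm)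
  qed
  have k'm: "(\<lambda>\<zeta>. k' (\<zeta> - z) v) \<in> borel_measurable lebesgue" for v
  proof -
    have "(\<lambda>\<zeta>. k' (\<zeta> - z) v) \<in> borel_measurable borel"
      unfolding k'_def by measurable
    then show ?thesis by (intro measurable_completion) simp
  qed
  have Dm: "(\<lambda>\<zeta>. D \<zeta> v) \<in> borel_measurable lebesgue" if "v = 1 \<or> v = \<i>" for v
    using that test_measurable[OF test_dir_deriv(1)[OF \<eta>]] test_measurable[OF test_dir_deriv(2)[OF \<eta>]]
    unfolding D_def by (auto intro!: borel_measurable_add borel_measurable_times km k'm test_measurable[OF \<eta>])
  have f0: "f \<zeta> = 0" if "\<zeta> \<notin> K" for \<zeta> using that K(4) by (simp add: f_def)
  note I = integral_derivative_lipschitz_compact_support[OF lip K(2) f0 der Dm]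
  have I1: "integrable lebesgue (\<lambda>\<zeta>. D \<zeta> 1)" and Ii: "integrable lebesgue (\<lambda>\<zeta>. D \<zeta> \<i>)"
    by (intro I(1); simp)+
  have "(LINT \<zeta>|lebesgue. (D \<zeta> 1 + \<i> * D \<zeta> \<i>) / 2) = 0"
    using I1 Ii I(2)[of 1] I(2)[of \<i>] by simp
  moreover have D: "(D \<zeta> 1 + \<i> * D \<zeta> \<i>) / 2 = dbar \<eta> \<zeta> * kreg \<delta> (\<zeta> - z) + (indicator (ball z \<delta>) \<zeta> *\<^sub>R \<eta> \<zeta>) / of_real (\<delta>\<^sup>2)" for \<zeta>
  proof -
    have "(k' w 1 + \<i> * k' w \<i>) / 2 = (if norm w < \<delta> then 1 / of_real (\<delta>\<^sup>2) else 0)" for w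
      by (simp add: k'_def)
    note k = this[of "\<zeta> - z"]
    have "(D \<zeta> 1 + \<i> * D \<zeta> \<i>) / 2 = dbar \<eta> \<zeta> * kreg \<delta> (\<zeta> - z) + \<eta> \<zeta> * ((k' (\<zeta> - z) 1 + \<i> * k' (\<zeta> - z) \<i>) / 2)"
      by (simp add: D_def dbar_def algebra_simps add_divide_distrib)
    then show ?thesis
      unfolding k by (simp add: indicator_def dist_norm norm_minus_commute)
  qed
  moreover have i1: "integrable lebesgue (\<lambda>\<zeta>. (indicator (ball z \<delta>) \<zeta> *\<^sub>R \<eta> \<zeta>) / of_real (\<delta>\<^sup>2))"
    by (intro integrable_divide integrable_mult_indicator test_integrable[OF \<eta>]) auto
  moreover have "integrable lebesgue (\<lambda>\<zeta>. dbar \<eta> \<zeta> * kreg \<delta> (\<zeta> - z))"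
  proof -
    have "integrable lebesgue (\<lambda>\<zeta>. (D \<zeta> 1 + \<i> * D \<zeta> \<i>) / 2 - (indicator (ball z \<delta>) \<zeta> *\<^sub>R \<eta> \<zeta>) / of_real (\<delta>\<^sup>2))"
      by (rule Bochner_Integration.integrable_diff[OF integrable_divide[OF
          Bochner_Integration.integrable_add[OF I1 integrable_mult_right[OF Ii]]] i1])
    then show ?thesis unfolding D by simp
  qed
  ultimately have "(LINT \<zeta>|lebesgue. dbar \<eta> \<zeta> * kreg \<delta> (\<zeta> - z)) + (LINT \<zeta>:ball z \<delta>|lebesgue. \<eta> \<zeta>) / of_real (\<delta>\<^sup>2) = 0"
    by (simp add: set_lebesgue_integral_def)
  then show ?thesis by (simp add: add_eq_0_iff)
qed

lemma test_cauchy_bounded: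
  assumes "\<eta> \<in> test_functions \<Omega>"
  obtains M where "cauchy_bounded \<eta> M"
proof -
  obtain K where K: "smooth \<eta>" "compact K" "K \<subseteq> \<Omega>" "\<And>z. z \<notin> K \<Longrightarrow> \<eta> z = 0"
    using test_functionsE[OF assms] by blast
  obtain C where C: "\<And>f B. f \<in> borel_measurable lebesgue \<Longrightarrow> (\<And>z. norm (f z) \<le> B) \<Longrightarrow>
    (\<And>z. z \<notin> K \<Longrightarrow> f z = 0) \<Longrightarrow> cauchy_bounded f (B * C)"
    using cauchy_bounded_if_bounded[OF K(2)] by blast
  obtain B where "\<And>z. norm (\<eta> z) \<le> B" using test_bounded[OF assms] by blast
  from that[OF C[OF test_measurable[OF assms] this K(4)]] show ?thesis .
qed

text \<open>Let the radius of the truncation tend to \<open>0\<close>: the integral against the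
  truncated kernel tends to the singular integral, and the other side is \<open>- pi\<close> times
  the mean of \<open>\<eta>\<close> over a shrinking disk.\<close>

lemma cauchy_pompeiu:
  assumes "\<eta> \<in> test_functions \<Omega>"
  shows "cauchy (dbar \<eta>) z = \<eta> z"
proof -
  have \<eta>: "\<eta> \<in> test_functions UNIV" using test_mono[OF assms] by simp
  obtain M where M: "cauchy_bounded (dbar \<eta>) M" using test_cauchy_bounded[OF test_dbar[OF \<eta>]] .
  note i = cauchy_bounded_integrable[OF M, of z]
  obtain L where L: "L > 0" "\<And>x y. norm (\<eta> x - \<eta> y) \<le> L * norm (x - y)" using test_lipschitz[OF \<eta>] by metis
  define d where "d = (\<lambda>n. inverse (real (Suc n)))"
  have d: "d n > 0" for n by (simp add: d_def)
  have d0: "d \<longlonglongrightarrow> 0" unfolding d_def by (rule LIMSEQ_inverse_real_of_nat)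
  have ball: "emeasure lebesgue (ball z r) = ennreal (pi * r\<^sup>2)" if "r > 0" for r
    using that by (simp add: emeasure_ball unit_ball_vol_2)
  have mball: "measure lebesgue (ball z r) = pi * r\<^sup>2" if "r > 0" for r
    using ball[OF that] by (simp add: measure_def)
  have km: "(\<lambda>\<zeta>. kreg r (\<zeta> - z)) \<in> borel_measurable lebesgue" if "r > 0" for r
  proof (rule continuous_borel_measurable_lebesgue, rule lipschitz_on_continuous_on)
    show "(1 / r\<^sup>2)-lipschitz_on UNIV (\<lambda>\<zeta>. kreg r (\<zeta> - z))"
      using kreg_lipschitz[OF that, of "_ - z" "_ - z"] by (intro lipschitz_onI) (auto simp: dist_norm)
  qed
  have lim1: "(\<lambda>n. LINT \<zeta>|lebesgue. dbar \<eta> \<zeta> * kreg (d n) (\<zeta> - z)) \<longlonglongrightarrow> (LINT \<zeta>|lebesgue. dbar \<eta> \<zeta> / (\<zeta> - z))"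
  proof (rule integral_dominated_convergence)
    show "(\<lambda>\<zeta>. dbar \<eta> \<zeta> / (\<zeta> - z)) \<in> borel_measurable lebesgue" using i by simp
    show "(\<lambda>\<zeta>. dbar \<eta> \<zeta> * kreg (d n) (\<zeta> - z)) \<in> borel_measurable lebesgue" for n
      by (intro borel_measurable_times test_measurable[OF test_dbar[OF \<eta>]] km d)
    show "integrable lebesgue (\<lambda>\<zeta>. norm (dbar \<eta> \<zeta> / (\<zeta> - z)))" using i by (rule integrable_norm)
    show "AE \<zeta> in lebesgue. norm (dbar \<eta> \<zeta> * kreg (d n) (\<zeta> - z)) \<le> norm (dbar \<eta> \<zeta> / (\<zeta> - z))" for n
    proof (rule AE_I2)
      fix \<zeta>
      have "norm (dbar \<eta> \<zeta>) * norm (kreg (d n) (\<zeta> - z)) \<le> norm (dbar \<eta> \<zeta>) * norm (1 / (\<zeta> - z))"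
        by (intro mult_left_mono norm_kreg_le' d) auto
      then show "norm (dbar \<eta> \<zeta> * kreg (d n) (\<zeta> - z)) \<le> norm (dbar \<eta> \<zeta> / (\<zeta> - z))"
        by (simp add: norm_mult norm_divide)
    qed
    show "AE \<zeta> in lebesgue. (\<lambda>n. dbar \<eta> \<zeta> * kreg (d n) (\<zeta> - z)) \<longlonglongrightarrow> dbar \<eta> \<zeta> / (\<zeta> - z)"
    proof (rule AE_I2)
      fix \<zeta>
      show "(\<lambda>n. dbar \<eta> \<zeta> * kreg (d n) (\<zeta> - z)) \<longlonglongrightarrow> dbar \<eta> \<zeta> / (\<zeta> - z)"
      proof (cases "\<zeta> = z")
        case True
        \<comment> \<open>At the pole both sides are \<open>0\<close>: the truncated kernel vanishes
          at \<open>0\<close>, and the quotient is a division by zero.\<close>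
        then show ?thesis using d by (simp add: kreg_def less_imp_le)
      next
        case False
        then have "eventually (\<lambda>n. d n < norm (\<zeta> - z)) sequentially"
          using order_tendstoD(2)[OF d0] by simp
        then have "eventually (\<lambda>n. dbar \<eta> \<zeta> / (\<zeta> - z) = dbar \<eta> \<zeta> * kreg (d n) (\<zeta> - z)) sequentially"
          by eventually_elim (simp add: kreg_def)
        then show ?thesis by (rule Lim_transform_eventually[OF tendsto_const])
      qed
    qed
  qed
  have lim2: "(\<lambda>n. - (LINT \<zeta>:ball z (d n)|lebesgue. \<eta> \<zeta>) / of_real ((d n)\<^sup>2)) \<longlonglongrightarrow> - (of_real pi * \<eta> z)"
  proof -
    \<comment> \<open>Replacing \<open>\<eta>\<close> by its value at the centre costs at most
      \<open>L * r\<close> per unit of area, and the area \<open>pi * r\<^sup>2\<close> cancels the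
      denominator up to the factor \<open>pi\<close>.\<close>
    have bd: "norm ((LINT \<zeta>:ball z r|lebesgue. \<eta> \<zeta>) / of_real (r\<^sup>2) - of_real pi * \<eta> z) \<le> pi * L * r" if r: "r > 0" for r
    proof -
      have ic: "set_integrable lebesgue (ball z r) (\<lambda>_. \<eta> z)"
        unfolding set_integrable_def using ball[OF r] by (intro integrable_scaleR_left integrable_real_indicator) auto
      have ie: "set_integrable lebesgue (ball z r) \<eta>"
        unfolding set_integrable_def by (intro integrable_mult_indicator test_integrable[OF \<eta>]) auto
      have c: "(LINT \<zeta>:ball z r|lebesgue. \<eta> z) = of_real (pi * r\<^sup>2) * \<eta> z"
        using ball[OF r] mball[OF r] by (simp add: set_lebesgue_integral_def scaleR_conv_of_real)
      have "(LINT \<zeta>:ball z r|lebesgue. \<eta> \<zeta>) - of_real (pi * r\<^sup>2) * \<eta> z = (LINT \<zeta>:ball z r|lebesgue. \<eta> \<zeta> - \<eta> z)"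
        unfolding c[symmetric] using set_integral_diff(2)[OF ie ic] by simp
      also have "norm \<dots> \<le> (LINT \<zeta>|lebesgue. indicator (ball z r) \<zeta> *\<^sub>R (L * r))"
        unfolding set_lebesgue_integral_def
      proof (rule Bochner_Integration.integral_norm_bound_integral)
        show "integrable lebesgue (\<lambda>\<zeta>. indicat_real (ball z r) \<zeta> *\<^sub>R (\<eta> \<zeta> - \<eta> z))"
          using set_integral_diff(1)[OF ie ic] by (simp add: set_integrable_def)
        show "integrable lebesgue (\<lambda>\<zeta>. indicat_real (ball z r) \<zeta> *\<^sub>R (L * r))"
          using ball[OF r] by (intro integrable_scaleR_left integrable_real_indicator) auto
        fix \<zeta>
        have "norm (\<eta> \<zeta> - \<eta> z) \<le> L * r" if "\<zeta> \<in> ball z r"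
        proof -
          have "norm (\<eta> \<zeta> - \<eta> z) \<le> L * norm (\<zeta> - z)" by (rule L)
          also have "\<dots> \<le> L * r" using L(1) that by (intro mult_left_mono) (auto simp: dist_norm norm_minus_commute)
          finally show ?thesis .
        qed
        then show "norm (indicat_real (ball z r) \<zeta> *\<^sub>R (\<eta> \<zeta> - \<eta> z)) \<le> indicat_real (ball z r) \<zeta> *\<^sub>R (L * r)"
          by (simp add: indicator_def)
      qed
      also have "\<dots> = pi * r\<^sup>2 * (L * r)"
        using ball[OF r] mball[OF r] by simp
      finally have "norm ((LINT \<zeta>:ball z r|lebesgue. \<eta> \<zeta>) - of_real (pi * r\<^sup>2) * \<eta> z) / r\<^sup>2 \<le> pi * r\<^sup>2 * (L * r) / r\<^sup>2"
        by (rule divide_right_mono) simp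
      moreover have "norm ((LINT \<zeta>:ball z r|lebesgue. \<eta> \<zeta>) - of_real (pi * r\<^sup>2) * \<eta> z) / r\<^sup>2
          = norm (((LINT \<zeta>:ball z r|lebesgue. \<eta> \<zeta>) - of_real (pi * r\<^sup>2) * \<eta> z) / of_real (r\<^sup>2))"
        by (simp add: norm_divide norm_power)
      moreover have "((LINT \<zeta>:ball z r|lebesgue. \<eta> \<zeta>) - of_real (pi * r\<^sup>2) * \<eta> z) / of_real (r\<^sup>2)
          = (LINT \<zeta>:ball z r|lebesgue. \<eta> \<zeta>) / of_real (r\<^sup>2) - of_real pi * \<eta> z"
        using r by (simp add: diff_divide_distrib)
      ultimately show ?thesis using r by simp
    qed
    have "(\<lambda>n. (LINT \<zeta>:ball z (d n)|lebesgue. \<eta> \<zeta>) / of_real ((d n)\<^sup>2) - of_real pi * \<eta> z) \<longlonglongrightarrow> 0"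
    proof (rule Lim_null_comparison[OF always_eventually])
      show "\<forall>n. norm ((LINT \<zeta>:ball z (d n)|lebesgue. \<eta> \<zeta>) / of_real ((d n)\<^sup>2) - of_real pi * \<eta> z) \<le> pi * L * d n"
        using bd d by blast
      show "(\<lambda>n. pi * L * d n) \<longlonglongrightarrow> 0" using tendsto_mult_right_zero[OF d0] by simp
    qed
    then have "(\<lambda>n. (LINT \<zeta>:ball z (d n)|lebesgue. \<eta> \<zeta>) / of_real ((d n)\<^sup>2)) \<longlonglongrightarrow> of_real pi * \<eta> z"
      by (rule LIM_zero_cancel)
    from tendsto_minus[OF this] show ?thesis by simp
  qed
  have "(LINT \<zeta>|lebesgue. dbar \<eta> \<zeta> / (\<zeta> - z)) = - (of_real pi * \<eta> z)"
    using LIMSEQ_unique[OF lim1[unfolded integral_dbar_mult_kreg[OF \<eta> d]] lim2] .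
  then show ?thesis by (simp add: cauchy_def)
qed

section \<open>Smoothness of the transform of a test function\<close>

lemma cauchy_add:
  assumes "cauchy_bounded f M" "cauchy_bounded g N"
  shows "cauchy (\<lambda>z. f z + g z) z = cauchy f z + cauchy g z"
  using cauchy_bounded_integrable[OF assms(1)] cauchy_bounded_integrable[OF assms(2)]
  by (simp add: cauchy_def add_divide_distrib ring_distribs)

lemma cauchy_cmult: "cauchy (\<lambda>z. c * f z) z = c * cauchy f z"
proof -
  have "(LINT \<zeta>|lebesgue. c * f \<zeta> / (\<zeta> - z)) = (LINT \<zeta>|lebesgue. c * (f \<zeta> / (\<zeta> - z)))" by simp
  then show ?thesis unfolding cauchy_def by (simp only: integral_mult_right_zero) simp
qed

lemma cauchy_shift:
  assumes "f \<in> borel_measurable lebesgue"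
  shows "cauchy f (z + h) = cauchy (\<lambda>\<zeta>. f (h + \<zeta>)) z"
proof -
  have "(\<lambda>\<zeta>. f \<zeta> / (\<zeta> - (z + h))) \<in> borel_measurable lebesgue"
    using assms by (intro borel_measurable_divide borel_measurable_diff) auto
  from lebesgue_integral_shift[OF this, of h] show ?thesis
    by (simp add: cauchy_def algebra_simps)
qed

lemma test_shift:
  assumes "\<eta> \<in> test_functions UNIV"
  shows "(\<lambda>\<zeta>. \<eta> (h + \<zeta>)) \<in> borel_measurable lebesgue"
  using measurable_compose[OF measurable_lebesgue_plus test_measurable[OF assms]] .

lemma has_derivative_if_quadratic_remainder:
  fixes f :: "'a :: real_normed_vector \<Rightarrow> 'b :: real_normed_vector"
  assumes "bounded_linear f'" "\<rho> > 0" "b \<ge> 0"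
    and main: "\<And>h. norm h \<le> \<rho> \<Longrightarrow> norm (f (z + h) - f z - f' h) \<le> b * (norm h)\<^sup>2"
  shows "(f has_derivative f') (at z)"
  unfolding has_derivative_at_alt
proof (intro conjI allI impI assms(1))
  fix e :: real assume e: "e > 0"
  show "\<exists>d>0. \<forall>y. norm (y - z) < d \<longrightarrow> norm (f y - f z - f' (y - z)) \<le> e * norm (y - z)"
  proof (intro exI[of _ "min \<rho> (e / (b + 1))"] conjI allI impI)
    show "min \<rho> (e / (b + 1)) > 0" using e assms by simp
    fix y assume y: "norm (y - z) < min \<rho> (e / (b + 1))"
    have "b * norm (y - z) \<le> (b + 1) * (e / (b + 1))"
      using y assms by (intro mult_mono) auto
    then have "b * norm (y - z) \<le> e" using assms by simp
    then have "b * (norm (y - z))\<^sup>2 \<le> e * norm (y - z)"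
      unfolding power2_eq_square mult.assoc[symmetric] by (rule mult_right_mono) simp
    with main[of "y - z"] y show "norm (f y - f z - f' (y - z)) \<le> e * norm (y - z)"
      by simp
  qed
qed

text \<open>The derivative of the kernel is too singular for differentiation under the integral.
  Translation moves the increment \<open>h\<close> onto \<open>\<eta>\<close>, whose first-order
  remainder is quadratic in \<open>h\<close>, uniformly in the point; so is the transform of this
  remainder.\<close>

lemma cauchy_test_has_derivative:
  assumes \<eta>: "\<eta> \<in> test_functions UNIV"
  shows "(cauchy \<eta> has_derivative
    (\<lambda>v. of_real (Re v) * cauchy (dir_deriv 1 \<eta>) z + of_real (Im v) * cauchy (dir_deriv \<i> \<eta>) z)) (at z)"
proof -
  note t1 = test_dir_deriv(1)[OF \<eta>] and t2 = test_dir_deriv(2)[OF \<eta>]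
  obtain K where K: "smooth \<eta>" "compact K" "K \<subseteq> UNIV" "\<And>z. z \<notin> K \<Longrightarrow> \<eta> z = 0"
    using test_functionsE[OF \<eta>] by blast
  obtain R where R: "\<And>z. z \<in> K \<Longrightarrow> norm z \<le> R"
    using compact_imp_bounded[OF K(2)] by (auto simp: bounded_iff)
  \<comment> \<open>One ball for all increments with \<open>norm h \<le> 1\<close>: the shifted
    supports stay within radius \<open>R + 1\<close>, which makes \<open>C\<close> independent of
    \<open>h\<close>.\<close>
  obtain C where C: "\<And>f B. f \<in> borel_measurable lebesgue \<Longrightarrow> (\<And>z. norm (f z) \<le> B) \<Longrightarrow>
    (\<And>z. z \<notin> cball 0 (R + 1) \<Longrightarrow> f z = 0) \<Longrightarrow> cauchy_bounded f (B * C)"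
    using cauchy_bounded_if_bounded[OF compact_cball[of 0 "R + 1"]] by blast
  obtain L1 where L1: "L1 > 0" "\<And>x y. norm (dir_deriv 1 \<eta> x - dir_deriv 1 \<eta> y) \<le> L1 * norm (x - y)"
    using test_lipschitz[OF t1] by metis
  obtain L2 where L2: "L2 > 0" "\<And>x y. norm (dir_deriv \<i> \<eta> x - dir_deriv \<i> \<eta> y) \<le> L2 * norm (x - y)"
    using test_lipschitz[OF t2] by metis
  obtain M0 where M0: "cauchy_bounded \<eta> M0" using test_cauchy_bounded[OF \<eta>] .
  obtain M1 where M1: "cauchy_bounded (dir_deriv 1 \<eta>) M1" using test_cauchy_bounded[OF t1] .
  obtain M2 where M2: "cauchy_bounded (dir_deriv \<i> \<eta>) M2" using test_cauchy_bounded[OF t2] .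
  note diff = smooth_differentiable[OF K(1)]
  define S where "S = (\<lambda>x v. of_real (Re v) * dir_deriv 1 \<eta> x + of_real (Im v) * dir_deriv \<i> \<eta> x)"
  have Sder: "(\<eta> has_derivative S x) (at x)" for x
  proof (rule has_derivative_eq_rhs[OF differentiable_imp_has_derivative_dir_deriv[OF diff]], rule ext)
    show "dir_deriv v \<eta> x = S x v" for v
      unfolding S_def by (rule dir_deriv_coords[OF diff])
  qed
  have Slip: "norm (S x v - S y v) \<le> (L1 + L2) * norm (x - y) * norm v" for x y v
  proof -
    have "S x v - S y v = of_real (Re v) * (dir_deriv 1 \<eta> x - dir_deriv 1 \<eta> y) + of_real (Im v) * (dir_deriv \<i> \<eta> x - dir_deriv \<i> \<eta> y)"
      by (simp add: S_def algebra_simps)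
    also have "norm \<dots> \<le> \<bar>Re v\<bar> * norm (dir_deriv 1 \<eta> x - dir_deriv 1 \<eta> y) + \<bar>Im v\<bar> * norm (dir_deriv \<i> \<eta> x - dir_deriv \<i> \<eta> y)"
      by (intro norm_triangle_le add_mono) (simp_all add: norm_mult)
    also have "\<dots> \<le> norm v * (L1 * norm (x - y)) + norm v * (L2 * norm (x - y))"
      by (intro add_mono mult_mono abs_Re_le_cmod abs_Im_le_cmod L1 L2) auto
    finally show ?thesis by (simp add: algebra_simps)
  qed
  have rem: "norm (\<eta> (h + x) - \<eta> x - S x h) \<le> (L1 + L2) * (norm h)\<^sup>2" for x h
  proof -
    have seg: "onorm (\<lambda>v. S y v - S x v) \<le> (L1 + L2) * norm h" if "y \<in> closed_segment x (x + h)" for y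
    proof (rule onorm_le, goal_cases)
      case (1 v)
      have "norm (y - x) \<le> norm h"
        using segment_bound(1)[OF that] by simp
      then have "(L1 + L2) * norm (y - x) * norm v \<le> (L1 + L2) * norm h * norm v"
        using L1(1) L2(1) by (intro mult_right_mono mult_left_mono) auto
      with Slip[of y v x] show ?case by linarith
    qed
    have "norm (\<eta> (x + h) - \<eta> x - S x (x + h - x)) \<le> norm (x + h - x) * ((L1 + L2) * norm h)"
    proof (rule differentiable_bound_linearization[where S = "closed_segment x (x + h)" and f' = S])
      show "x + t *\<^sub>R (x + h - x) \<in> closed_segment x (x + h)" if "t \<in> {0..1}" for t
        unfolding in_segment using that by (intro exI[of _ t]) (simp add: algebra_simps)
      show "(\<eta> has_derivative S y) (at y within closed_segment x (x + h))" for y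
        by (rule has_derivative_at_withinI[OF Sder])
      show "onorm (S y - S x) \<le> (L1 + L2) * norm h" if "y \<in> closed_segment x (x + h)" for y
        using seg[OF that] by (simp add: fun_diff_def)
    qed simp
    then show ?thesis by (simp add: power2_eq_square algebra_simps)
  qed
  define b where "b = \<bar>(L1 + L2) * C\<bar>"
  have main: "norm (cauchy \<eta> (z + h) - cauchy \<eta> z
      - (of_real (Re h) * cauchy (dir_deriv 1 \<eta>) z + of_real (Im h) * cauchy (dir_deriv \<i> \<eta>) z)) \<le> b * (norm h)\<^sup>2"
    if h: "norm h \<le> 1" for h
  proof -
    define r where "r = (\<lambda>\<zeta>. \<eta> (h + \<zeta>) - \<eta> \<zeta> - S \<zeta> h)"
    have rm: "r \<in> borel_measurable lebesgue"
      unfolding r_def S_def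
      by (intro borel_measurable_diff borel_measurable_add borel_measurable_times borel_measurable_const
          test_shift[OF \<eta>] test_measurable[OF \<eta>] test_measurable[OF t1] test_measurable[OF t2])
    have r0: "r \<zeta> = 0" if "\<zeta> \<notin> cball 0 (R + 1)" for \<zeta>
    proof -
      have "norm (h + \<zeta>) \<ge> norm \<zeta> - norm h" using norm_diff_ineq[of \<zeta> h] by (simp add: add.commute)
      then have n: "h + \<zeta> \<notin> K" "\<zeta> \<notin> K" using R[of "h + \<zeta>"] R[of \<zeta>] that h by auto
      have "dir_deriv v \<eta> \<zeta> = 0" for v
        by (rule dir_deriv_eq_0_outside(2)[OF compact_imp_closed[OF K(2)] K(4) n(2)])
      then show ?thesis using n K(4) by (simp add: r_def S_def)
    qed
    have "cauchy_bounded r ((L1 + L2) * (norm h)\<^sup>2 * C)"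
      using rm _ r0 by (rule C) (simp add: r_def rem)
    note rb = this norm_cauchy_le[OF this, of z]
    define g1 where "g1 = (\<lambda>\<zeta>. of_real (Re h) * dir_deriv 1 \<eta> \<zeta>)"
    define g2 where "g2 = (\<lambda>\<zeta>. of_real (Im h) * dir_deriv \<i> \<eta> \<zeta>)"
    have g: "g1 \<in> test_functions UNIV" "g2 \<in> test_functions UNIV"
      unfolding g1_def g2_def by (auto intro!: test_smooth_mult t1 t2)
    obtain N where N: "cauchy_bounded (\<lambda>\<zeta>. \<eta> \<zeta> + (g1 \<zeta> + g2 \<zeta>)) N"
      using test_cauchy_bounded[OF test_add[OF \<eta> test_add[OF g]]] .
    obtain N' where N': "cauchy_bounded (\<lambda>\<zeta>. g1 \<zeta> + g2 \<zeta>) N'"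
      using test_cauchy_bounded[OF test_add[OF g]] .
    obtain N1 where N1: "cauchy_bounded g1 N1" using test_cauchy_bounded[OF g(1)] .
    obtain N2 where N2: "cauchy_bounded g2 N2" using test_cauchy_bounded[OF g(2)] .
    have "cauchy \<eta> (z + h) = cauchy (\<lambda>\<zeta>. \<eta> (h + \<zeta>)) z"
      by (rule cauchy_shift[OF test_measurable[OF \<eta>]])
    also have "(\<lambda>\<zeta>. \<eta> (h + \<zeta>)) = (\<lambda>\<zeta>. r \<zeta> + (\<eta> \<zeta> + (g1 \<zeta> + g2 \<zeta>)))"
      by (auto simp: r_def S_def g1_def g2_def)
    also have "cauchy \<dots> z = cauchy r z + (cauchy \<eta> z + (cauchy g1 z + cauchy g2 z))"
      by (simp only: cauchy_add[OF rb(1) N] cauchy_add[OF M0 N'] cauchy_add[OF N1 N2])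
    finally have "cauchy \<eta> (z + h) - cauchy \<eta> z - (cauchy g1 z + cauchy g2 z) = cauchy r z" by simp
    moreover have "(L1 + L2) * (norm h)\<^sup>2 * C \<le> b * (norm h)\<^sup>2"
      unfolding b_def using mult_right_mono[OF abs_ge_self, of "(norm h)\<^sup>2" "(L1 + L2) * C"] by (simp add: algebra_simps)
    ultimately show ?thesis
      using rb(2) by (simp add: g1_def g2_def cauchy_cmult)
  qed
  have "bounded_linear (\<lambda>v. of_real (Re v) * cauchy (dir_deriv 1 \<eta>) z + of_real (Im v) * cauchy (dir_deriv \<i> \<eta>) z)"
    by (intro bounded_linear_add bounded_linear_compose[OF bounded_linear_mult_left]
        bounded_linear_compose[OF bounded_linear_of_real] bounded_linear_Re bounded_linear_Im)
  then show ?thesis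
    using main by (intro has_derivative_if_quadratic_remainder[of _ 1 b]) (simp_all add: b_def)
qed

lemma dir_deriv_cauchy_test:
  assumes "\<eta> \<in> test_functions UNIV"
  shows "dir_deriv 1 (cauchy \<eta>) = cauchy (dir_deriv 1 \<eta>)" "dir_deriv \<i> (cauchy \<eta>) = cauchy (dir_deriv \<i> \<eta>)"
  by (rule ext, subst dir_deriv_eq[OF cauchy_test_has_derivative[OF assms]], simp)+

text \<open>The transform in general has no compact support, so it serves as a smooth multiplier of
  test functions rather than as a test function.\<close>

lemma class_C_cauchy_test: "\<eta> \<in> test_functions UNIV \<Longrightarrow> class_C k (cauchy \<eta>)"
proof (induction k arbitrary: \<eta>)
  case 0
  have "cauchy \<eta> differentiable_on UNIV"
    unfolding differentiable_on_def differentiable_def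
    by (intro ballI exI) (rule cauchy_test_has_derivative[OF 0])
  then show ?case unfolding class_C.simps by (rule differentiable_imp_continuous_on)
next
  case (Suc k)
  have "cauchy \<eta> differentiable_on UNIV"
    unfolding differentiable_on_def differentiable_def
    by (intro ballI exI) (rule cauchy_test_has_derivative[OF Suc.prems])
  then show ?case
    unfolding class_C.simps dir_deriv_cauchy_test[OF Suc.prems]
    using Suc.IH[OF test_dir_deriv(1)[OF Suc.prems]] Suc.IH[OF test_dir_deriv(2)[OF Suc.prems]] by blast
qed

text \<open>Derivatives pass under the transform, so this is the formula of Cauchy and Pompeiu with
  the two operators interchanged.\<close>

lemma dbar_cauchy_test:
  assumes "\<eta> \<in> test_functions UNIV"
  shows "dbar (cauchy \<eta>) z = \<eta> z"
proof -
  note t1 = test_dir_deriv(1)[OF assms] and t2 = test_dir_deriv(2)[OF assms]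
  obtain M1 where M1: "cauchy_bounded (dir_deriv 1 \<eta>) M1" using test_cauchy_bounded[OF t1] .
  have t2': "(\<lambda>z. \<i> * dir_deriv \<i> \<eta> z) \<in> test_functions UNIV" 
    by (intro test_smooth_mult t2) simp
  obtain M2 where M2: "cauchy_bounded (\<lambda>z. \<i> * dir_deriv \<i> \<eta> z) M2" using test_cauchy_bounded[OF t2'] .
  have "cauchy (dbar \<eta>) z = dbar (cauchy \<eta>) z"
    unfolding dbar_alt dir_deriv_cauchy_test[OF assms] cauchy_cmult cauchy_add[OF M1 M2] ..
  then show ?thesis using cauchy_pompeiu[OF assms] by simp
qed

section \<open>Weak derivatives with respect to the conjugate variable\<close>

lemma locally_integrable_if_continuous:
  assumes "continuous_on \<Omega> f"
  shows "f locally_integrable_on \<Omega>"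
  unfolding locally_integrable_on_def
proof (intro allI impI)
  fix K :: "complex set" assume K: "compact K \<and> K \<subseteq> \<Omega>"
  then have "integrable lborel (\<lambda>x. indicator K x *\<^sub>R f x)"
    using assms by (intro borel_integrable_compact continuous_on_subset[OF assms]) auto
  then show "f absolutely_integrable_on K"
    unfolding set_integrable_def by (subst integrable_completion) auto
qed

lemma locally_integrable_add:
  "f locally_integrable_on \<Omega> \<Longrightarrow> g locally_integrable_on \<Omega> \<Longrightarrow> (\<lambda>z. f z + g z) locally_integrable_on \<Omega>"
  unfolding locally_integrable_on_def by (auto intro: set_integral_add(1))

lemma locally_integrable_bounded_mult:
  assumes "f locally_integrable_on \<Omega>" "u \<in> borel_measurable lebesgue" "\<And>z. norm (u z) \<le> B"
  shows "(\<lambda>z. u z * f z) locally_integrable_on \<Omega>"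
  unfolding locally_integrable_on_def
proof (intro allI impI)
  fix K :: "complex set" assume K: "compact K \<and> K \<subseteq> \<Omega>"
  then have m: "K \<in> sets lebesgue" using lmeasurable_compact by blast
  have B: "B \<ge> 0" using order_trans[OF norm_ge_zero assms(3)] .
  have "integrable lebesgue (\<lambda>z. f z * (indicator K z *\<^sub>R u z))"
    using K m assms(2) assms(3) B
    by (intro locally_integrable_mult_bounded[OF assms(1), of K _ B]) (auto simp: indicator_def)
  then show "(\<lambda>z. u z * f z) absolutely_integrable_on K"
    unfolding set_integrable_def by (simp add: mult.commute)
qed

lemma locally_integrable_cmult:
  "f locally_integrable_on \<Omega> \<Longrightarrow> (\<lambda>z. c * f z) locally_integrable_on \<Omega>"
  by (rule locally_integrable_bounded_mult[of _ _ "\<lambda>_. c" "norm c"]) auto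

lemma has_weak_dbarD:
  assumes "has_weak_dbar \<Omega> f g"
  shows has_weak_dbar_loc1: "f locally_integrable_on \<Omega>" and has_weak_dbar_loc2: "g locally_integrable_on \<Omega>"
    and has_weak_dbar_eq: "\<phi> \<in> test_functions \<Omega> \<Longrightarrow>
      (LINT z|lebesgue. f z * dbar \<phi> z) = - (LINT z|lebesgue. g z * \<phi> z)"
  using assms unfolding has_weak_dbar_iff by blast+

lemma has_weak_dbar_add:
  assumes f: "has_weak_dbar \<Omega> f g" and f': "has_weak_dbar \<Omega> f' g'"
  shows "has_weak_dbar \<Omega> (\<lambda>z. f z + f' z) (\<lambda>z. g z + g' z)"
  unfolding has_weak_dbar_iff
proof (intro conjI ballI locally_integrable_add has_weak_dbarD[OF f] has_weak_dbarD[OF f'])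
  fix \<phi> assume \<phi>: "\<phi> \<in> test_functions \<Omega>"
  note i = locally_integrable_mult_test
  show "(LINT z|lebesgue. (f z + f' z) * dbar \<phi> z) = - (LINT z|lebesgue. (g z + g' z) * \<phi> z)"
    using i[OF has_weak_dbarD(1)[OF f] test_dbar[OF \<phi>]] i[OF has_weak_dbarD(1)[OF f'] test_dbar[OF \<phi>]]
      i[OF has_weak_dbarD(2)[OF f] \<phi>] i[OF has_weak_dbarD(2)[OF f'] \<phi>]
    by (simp add: distrib_right has_weak_dbar_eq[OF f \<phi>] has_weak_dbar_eq[OF f' \<phi>])
qed

lemma has_weak_dbar_cmult:
  assumes f: "has_weak_dbar \<Omega> f g"
  shows "has_weak_dbar \<Omega> (\<lambda>z. c * f z) (\<lambda>z. c * g z)"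
  unfolding has_weak_dbar_iff
proof (intro conjI ballI locally_integrable_cmult has_weak_dbarD[OF f])
  fix \<phi> assume \<phi>: "\<phi> \<in> test_functions \<Omega>"
  show "(LINT z|lebesgue. c * f z * dbar \<phi> z) = - (LINT z|lebesgue. c * g z * \<phi> z)"
    unfolding mult.assoc integral_mult_right_zero has_weak_dbar_eq[OF f \<phi>] by simp
qed

lemma has_weak_dbar_AE_0:
  assumes f: "has_weak_dbar \<Omega> f g" and 0: "AE z in lebesgue. z \<in> \<Omega> \<longrightarrow> g z = 0"
  shows "has_weak_dbar \<Omega> f (\<lambda>_. 0)"
  unfolding has_weak_dbar_iff
proof (intro conjI ballI locally_integrable_const has_weak_dbarD(1)[OF f])
  fix \<phi> assume \<phi>: "\<phi> \<in> test_functions \<Omega>"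
  obtain K where K: "smooth \<phi>" "compact K" "K \<subseteq> \<Omega>" "\<And>z. z \<notin> K \<Longrightarrow> \<phi> z = 0"
    using test_functionsE[OF \<phi>] by blast
  have "AE z in lebesgue. g z * \<phi> z = 0"
    using 0 by eventually_elim (use K in auto)
  then have "(LINT z|lebesgue. g z * \<phi> z) = 0" by (rule integral_eq_zero_AE)
  then show "(LINT z|lebesgue. f z * dbar \<phi> z) = - (LINT z|lebesgue. 0 * \<phi> z)"
    by (simp add: has_weak_dbar_eq[OF f \<phi>])
qed

text \<open>The formula of Cauchy and Pompeiu for the compactly supported function \<open>v \<phi>\<close>, by duality: test against \<open>cauchy \<eta> \<phi>\<close>.\<close>

lemma weak_cauchy_pompeiu:
  assumes "open \<Omega>" and v: "has_weak_dbar \<Omega> v b" and \<phi>: "\<phi> \<in> test_functions \<Omega>"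
  shows "integrable lebesgue (\<lambda>z. v z * dbar \<phi> z + b z * \<phi> z)"
    and "AE z in lebesgue. z \<in> \<Omega> \<longrightarrow> v z * \<phi> z = cauchy (\<lambda>z. v z * dbar \<phi> z + b z * \<phi> z) z"
proof -
  define G where "G = (\<lambda>z. v z * dbar \<phi> z + b z * \<phi> z)"
  note i = locally_integrable_mult_test
  note vl = has_weak_dbarD(1)[OF v] and bl = has_weak_dbarD(2)[OF v]
  have G: "integrable lebesgue G"
    unfolding G_def by (intro Bochner_Integration.integrable_add i[OF vl test_dbar[OF \<phi>]] i[OF bl \<phi>])
  then show "integrable lebesgue (\<lambda>z. v z * dbar \<phi> z + b z * \<phi> z)" by (simp add: G_def)
  have v\<phi>: "integrable lebesgue (\<lambda>z. v z * \<phi> z)" by (rule i[OF vl \<phi>])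
  \<comment> \<open>\<open>G\<close> is merely integrable, so no pointwise bound on
    \<open>cauchy G\<close> is at hand. Fubini's theorem with the indicator of \<open>K\<close> as
    the bounded factor gives its integrability over \<open>K\<close>.\<close>
  have "(\<lambda>z. v z * \<phi> z - cauchy G z) locally_integrable_on \<Omega>"
    unfolding locally_integrable_on_def
  proof (intro allI impI)
    fix K :: "complex set" assume K: "compact K \<and> K \<subseteq> \<Omega>"
    then have m: "K \<in> sets lebesgue" using lmeasurable_compact by blast
    obtain C where C: "\<And>f B. f \<in> borel_measurable lebesgue \<Longrightarrow> (\<And>z. norm (f z) \<le> B) \<Longrightarrow>
      (\<And>z. z \<notin> K \<Longrightarrow> f z = 0) \<Longrightarrow> cauchy_bounded f (B * C)"
      using cauchy_bounded_if_bounded[of K] K by blast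
    have "cauchy_bounded (\<lambda>z. indicator K z *\<^sub>R 1) (1 * C)"
      using m by (intro C) (auto simp: indicator_def)
    from cauchy_Fubini(2)[OF this G]
    have "integrable lebesgue (\<lambda>z. indicator K z *\<^sub>R cauchy G z)"
      by (simp add: scaleR_conv_of_real)
    then have "set_integrable lebesgue K (cauchy G)" by (simp add: set_integrable_def)
    moreover have "set_integrable lebesgue K (\<lambda>z. v z * \<phi> z)"
      unfolding set_integrable_def by (rule integrable_mult_indicator[OF m v\<phi>])
    ultimately show "(\<lambda>z. v z * \<phi> z - cauchy G z) absolutely_integrable_on K"
      by (intro set_integral_diff(1))
  qed
  moreover have "(LINT z|lebesgue. (v z * \<phi> z - cauchy G z) * \<eta> z) = 0" if \<eta>: "\<eta> \<in> test_functions \<Omega>" for \<eta>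
  proof -
    have \<eta>': "\<eta> \<in> test_functions UNIV" using test_mono[OF \<eta>] by simp
    have sc: "smooth (cauchy \<eta>)" using class_C_cauchy_test[OF \<eta>'] by blast
    obtain M where M: "cauchy_bounded \<eta> M" using test_cauchy_bounded[OF \<eta>] .
    note t = test_smooth_mult[OF sc \<phi>]
    \<comment> \<open>The extra term \<open>\<eta> z * \<phi> z\<close> is the point of testing with
      \<open>cauchy \<eta> z * \<phi> z\<close>: it makes the integral of
      \<open>v \<phi> \<eta>\<close> appear in the weak equation.\<close>
    have d: "dbar (\<lambda>z. cauchy \<eta> z * \<phi> z) z = cauchy \<eta> z * dbar \<phi> z + \<eta> z * \<phi> z" for z
      using dbar_mult[OF smooth_differentiable[OF sc] smooth_differentiable[OF test_smooth[OF \<phi>]]]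
      by (simp add: dbar_cauchy_test[OF \<eta>'])
    have i1: "integrable lebesgue (\<lambda>z. v z * (cauchy \<eta> z * dbar \<phi> z))"
      by (intro i[OF vl] test_smooth_mult[OF sc] test_dbar \<phi>)
    have i2: "integrable lebesgue (\<lambda>z. v z * (\<eta> z * \<phi> z))"
      by (intro i[OF vl] test_smooth_mult test_smooth[OF \<eta>] \<phi>)
    have i3: "integrable lebesgue (\<lambda>z. b z * (cauchy \<eta> z * \<phi> z))"
      by (intro i[OF bl] t)
    have alg: "x + y = - t \<Longrightarrow> s = x + t \<Longrightarrow> s = - u \<Longrightarrow> y - u = 0" for x y s t u :: complex
      by algebra
    have "(LINT z|lebesgue. v z * (cauchy \<eta> z * dbar \<phi> z)) + (LINT z|lebesgue. v z * (\<eta> z * \<phi> z))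
        = - (LINT z|lebesgue. b z * (cauchy \<eta> z * \<phi> z))"
      using has_weak_dbar_eq[OF v t] i1 i2 by (simp add: d distrib_left)
    moreover have "(LINT z|lebesgue. cauchy \<eta> z * G z)
        = (LINT z|lebesgue. v z * (cauchy \<eta> z * dbar \<phi> z)) + (LINT z|lebesgue. b z * (cauchy \<eta> z * \<phi> z))"
      unfolding Bochner_Integration.integral_add[OF i1 i3, symmetric]
      by (intro Bochner_Integration.integral_cong) (simp_all add: G_def algebra_simps)
    moreover have "(LINT z|lebesgue. cauchy \<eta> z * G z) = - (LINT z|lebesgue. \<eta> z * cauchy G z)"
      by (rule cauchy_Fubini(3)[OF M G])
    ultimately have "(LINT z|lebesgue. v z * (\<eta> z * \<phi> z)) - (LINT z|lebesgue. \<eta> z * cauchy G z) = 0"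
      by (rule alg)
    moreover have "(LINT z|lebesgue. (v z * \<phi> z - cauchy G z) * \<eta> z)
        = (LINT z|lebesgue. v z * (\<eta> z * \<phi> z)) - (LINT z|lebesgue. \<eta> z * cauchy G z)"
      unfolding Bochner_Integration.integral_diff[OF i2 cauchy_Fubini(2)[OF M G], symmetric]
      by (intro Bochner_Integration.integral_cong) (simp_all add: algebra_simps)
    ultimately show ?thesis by simp
  qed
  ultimately have "AE z in lebesgue. z \<in> \<Omega> \<longrightarrow> v z * \<phi> z - cauchy G z = 0"
    by (intro AE_eq_0_if_orthogonal_to_test_functions[OF assms(1)])
  then show "AE z in lebesgue. z \<in> \<Omega> \<longrightarrow> v z * \<phi> z = cauchy (\<lambda>z. v z * dbar \<phi> z + b z * \<phi> z) z"
    by eventually_elim (simp add: G_def)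
qed

text \<open>Near a point of \<open>U\<close> the kernel stays away from its pole wherever
  \<open>G\<close> is nonzero. With \<open>p = \<zeta> - z\<close>, the remainder
  \<open>1 / (p - h) - 1 / p - h / p ^ 2\<close> equals \<open>h ^ 2 / ((p - h) * p ^ 2)\<close>,
  quadratic in \<open>h\<close> uniformly in \<open>\<zeta>\<close>, so integrability of
  \<open>G\<close> is enough. The linear part is multiplication by a complex number, which gives
  complex differentiability at once.\<close>

lemma cauchy_holomorphic_outside_support:
  assumes G: "integrable lebesgue G" and U: "open U" "\<And>z. z \<in> U \<Longrightarrow> G z = 0"
  shows "cauchy G holomorphic_on U"
proof (rule holomorphic_onI)
  fix z assume z: "z \<in> U"
  obtain e where e: "e > 0" "ball z e \<subseteq> U" using U(1) z openE by blast
  \<comment> \<open>Half the radius, so that points with nonzero \<open>G\<close> keep distance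
    \<open>2 * \<rho>\<close> from \<open>z\<close> and still \<open>\<rho>\<close> from
    \<open>z + h\<close>.\<close>
  define \<rho> where "\<rho> = e / 2"
  have \<rho>: "\<rho> > 0" using e by (simp add: \<rho>_def)
  have far: "norm (\<zeta> - z) \<ge> 2 * \<rho>" if "G \<zeta> \<noteq> 0" for \<zeta>
  proof (rule ccontr)
    assume "\<not> ?thesis"
    then have "\<zeta> \<in> U" using e(2) by (auto simp: \<rho>_def dist_norm norm_minus_commute)
    with U(2) that show False by blast
  qed
  have far': "norm (\<zeta> - (z + h)) \<ge> \<rho>" if "G \<zeta> \<noteq> 0" "norm h \<le> \<rho>" for \<zeta> h
    using far[OF that(1)] that(2) norm_triangle_ineq2[of "\<zeta> - z" h] by (simp add: diff_diff_eq)
  have Gm: "G \<in> borel_measurable lebesgue" using G by simp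
  have bnd: "integrable lebesgue (\<lambda>\<zeta>. G \<zeta> * k \<zeta>)"
    if "k \<in> borel_measurable lebesgue" and k: "\<And>\<zeta>. G \<zeta> \<noteq> 0 \<Longrightarrow> norm (k \<zeta>) \<le> B" for k :: "complex \<Rightarrow> complex" and B
  proof (rule Bochner_Integration.integrable_bound)
    show "integrable lebesgue (\<lambda>\<zeta>. of_real \<bar>B\<bar> * G \<zeta>)" using G by (rule integrable_mult_right)
    show "(\<lambda>\<zeta>. G \<zeta> * k \<zeta>) \<in> borel_measurable lebesgue" by (intro borel_measurable_times Gm that)
    have "norm (G \<zeta>) * norm (k \<zeta>) \<le> norm (G \<zeta>) * \<bar>B\<bar>" for \<zeta>
      using k[of \<zeta>] by (cases "G \<zeta> = 0") (auto intro!: mult_left_mono)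
    then show "AE \<zeta> in lebesgue. norm (G \<zeta> * k \<zeta>) \<le> norm (of_real \<bar>B\<bar> * G \<zeta>)"
      by (intro AE_I2) (simp add: norm_mult mult.commute)
  qed
  have km: "(\<lambda>\<zeta>. 1 / (\<zeta> - y)) \<in> borel_measurable lebesgue" for y :: complex
    by (intro borel_measurable_divide borel_measurable_diff) auto
  have k2m: "(\<lambda>\<zeta>. 1 / (\<zeta> - z)\<^sup>2) \<in> borel_measurable lebesgue"
    by (intro borel_measurable_divide borel_measurable_power borel_measurable_diff) auto
  have i1: "integrable lebesgue (\<lambda>\<zeta>. G \<zeta> * (1 / (\<zeta> - (z + h))))" if "norm h \<le> \<rho>" for h
  proof (rule bnd[OF km])
    show "norm (1 / (\<zeta> - (z + h))) \<le> 1 / \<rho>" if "G \<zeta> \<noteq> 0" for \<zeta>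
      using far'[OF that \<open>norm h \<le> \<rho>\<close>] \<rho> by (simp add: norm_divide frac_le)
  qed
  have i2: "integrable lebesgue (\<lambda>\<zeta>. G \<zeta> * (1 / (\<zeta> - z)\<^sup>2))"
  proof (rule bnd[OF k2m])
    fix \<zeta> assume "G \<zeta> \<noteq> 0"
    then have "\<rho>\<^sup>2 \<le> (norm (\<zeta> - z))\<^sup>2" using far[of \<zeta>] \<rho> by (intro power_mono) auto
    then show "norm (1 / (\<zeta> - z)\<^sup>2) \<le> 1 / \<rho>\<^sup>2"
      using \<rho> by (simp add: norm_divide norm_power frac_le)
  qed
  define I where "I = (LINT \<zeta>|lebesgue. G \<zeta> * (1 / (\<zeta> - z)\<^sup>2))"
  define N where "N = (LINT \<zeta>|lebesgue. norm (G \<zeta>))"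
  have "norm (cauchy G (z + h) - cauchy G z - - (1 / of_real pi) * I * h) \<le> N / \<rho> ^ 3 * (norm h)\<^sup>2"
    if h: "norm h \<le> \<rho>" for h
  proof -
    define k where "k = (\<lambda>\<zeta>. 1 / (\<zeta> - (z + h)) - 1 / (\<zeta> - z) - h * (1 / (\<zeta> - z)\<^sup>2))"
    have kb: "norm (k \<zeta>) \<le> (norm h)\<^sup>2 / \<rho> ^ 3" if "G \<zeta> \<noteq> 0" for \<zeta>
    proof -
      have ne: "\<zeta> - z \<noteq> 0" "\<zeta> - (z + h) \<noteq> 0"
        using far[OF that] far'[OF that h] \<rho> by auto
      have "k \<zeta> = h\<^sup>2 / ((\<zeta> - (z + h)) * (\<zeta> - z)\<^sup>2)"
      proof -
        define p where "p = \<zeta> - z"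
        have "1 / (p - h) - 1 / p - h * (1 / p\<^sup>2) = h\<^sup>2 / ((p - h) * p\<^sup>2)"
          using ne by (simp add: p_def divide_simps) (simp add: algebra_simps power2_eq_square)
        then show ?thesis by (simp add: k_def p_def algebra_simps)
      qed
      then have "norm (k \<zeta>) = (norm h)\<^sup>2 / (norm (\<zeta> - (z + h)) * (norm (\<zeta> - z))\<^sup>2)"
        by (simp add: norm_divide norm_mult norm_power)
      also have "\<dots> \<le> (norm h)\<^sup>2 / (\<rho> * \<rho>\<^sup>2)"
        using far[OF that] far'[OF that h] \<rho> ne
        by (intro divide_left_mono mult_mono power_mono mult_pos_pos) auto
      finally show ?thesis by (simp add: power3_eq_cube power2_eq_square mult.assoc)
    qed
    have ka: "k \<in> borel_measurable lebesgue"
      unfolding k_def by (intro borel_measurable_diff borel_measurable_times km k2m) auto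
    have i0: "integrable lebesgue (\<lambda>\<zeta>. G \<zeta> * (1 / (\<zeta> - z)))" using i1[of 0] \<rho> by simp
    have "(LINT \<zeta>|lebesgue. G \<zeta> * k \<zeta>) = (LINT \<zeta>|lebesgue. G \<zeta> * (1 / (\<zeta> - (z + h)))
        - G \<zeta> * (1 / (\<zeta> - z)) - h * (G \<zeta> * (1 / (\<zeta> - z)\<^sup>2)))"
      by (intro Bochner_Integration.integral_cong) (simp_all add: k_def algebra_simps)
    also have "\<dots> = (LINT \<zeta>|lebesgue. G \<zeta> * (1 / (\<zeta> - (z + h)))) - (LINT \<zeta>|lebesgue. G \<zeta> * (1 / (\<zeta> - z))) - h * I"
      unfolding I_def
      by (subst Bochner_Integration.integral_diff[OF Bochner_Integration.integrable_diff[OF i1[OF h] i0] integrable_mult_right[OF i2]],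
          subst Bochner_Integration.integral_diff[OF i1[OF h] i0], subst integral_mult_right_zero) simp
    finally have K: "(LINT \<zeta>|lebesgue. G \<zeta> * k \<zeta>) = (LINT \<zeta>|lebesgue. G \<zeta> * (1 / (\<zeta> - (z + h))))
        - (LINT \<zeta>|lebesgue. G \<zeta> * (1 / (\<zeta> - z))) - h * I" .
    have alg: "c * x - c * y - c * i * h = c * (x - y - h * i)" for x y i c :: complex
      by algebra
    have c: "cauchy G y = - (1 / of_real pi) * (LINT \<zeta>|lebesgue. G \<zeta> * (1 / (\<zeta> - y)))" for y
      by (simp add: cauchy_def)
    have eq: "cauchy G (z + h) - cauchy G z - - (1 / of_real pi) * I * h = - (1 / of_real pi) * (LINT \<zeta>|lebesgue. G \<zeta> * k \<zeta>)"
      unfolding K c by (rule alg)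
    have "norm (LINT \<zeta>|lebesgue. G \<zeta> * k \<zeta>) \<le> (LINT \<zeta>|lebesgue. norm (G \<zeta>) * ((norm h)\<^sup>2 / \<rho> ^ 3))"
    proof (rule Bochner_Integration.integral_norm_bound_integral)
      show "integrable lebesgue (\<lambda>\<zeta>. G \<zeta> * k \<zeta>)" by (rule bnd[OF ka kb])
      show "integrable lebesgue (\<lambda>\<zeta>. norm (G \<zeta>) * ((norm h)\<^sup>2 / \<rho> ^ 3))"
        using G by (intro integrable_mult_left integrable_norm)
      fix \<zeta>
      show "norm (G \<zeta> * k \<zeta>) \<le> norm (G \<zeta>) * ((norm h)\<^sup>2 / \<rho> ^ 3)"
        using mult_left_mono[OF kb[of \<zeta>], of "norm (G \<zeta>)"] by (cases "G \<zeta> = 0") (auto simp: norm_mult)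
    qed
    also have "\<dots> = N * ((norm h)\<^sup>2 / \<rho> ^ 3)" by (simp add: N_def)
    finally have le: "norm (LINT \<zeta>|lebesgue. G \<zeta> * k \<zeta>) \<le> N / \<rho> ^ 3 * (norm h)\<^sup>2" by simp
    have "norm (- (1 / of_real pi) * (LINT \<zeta>|lebesgue. G \<zeta> * k \<zeta>)) = norm (LINT \<zeta>|lebesgue. G \<zeta> * k \<zeta>) / pi"
      by (simp add: norm_mult norm_divide)
    also have "\<dots> \<le> norm (LINT \<zeta>|lebesgue. G \<zeta> * k \<zeta>) / 1"
      using pi_gt3 by (intro divide_left_mono) auto
    finally show ?thesis unfolding eq using le by simp
  qed
  moreover have "N \<ge> 0" unfolding N_def by simp
  ultimately have "(cauchy G has_derivative (\<lambda>h. - (1 / of_real pi) * I * h)) (at z)"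
    using \<rho> by (intro has_derivative_if_quadratic_remainder[of _ \<rho> "N / \<rho> ^ 3"] bounded_linear_mult_right) auto
  then have "(cauchy G has_field_derivative - (1 / of_real pi) * I) (at z)"
    unfolding has_field_derivative_def .
  then show "cauchy G field_differentiable at z within U"
    using field_differentiable_at_within field_differentiable_def by blast
qed

lemma continuous_AE_eq_imp_eq:
  fixes f g :: "complex \<Rightarrow> complex"
  assumes "open S" "continuous_on S f" "continuous_on S g" "AE z in lebesgue. z \<in> S \<longrightarrow> f z = g z" "z \<in> S"
  shows "f z = g z"
proof (rule ccontr)
  assume ne: "f z \<noteq> g z"
  let ?T = "S \<inter> (\<lambda>z. f z - g z) -` (- {0})"
  have "open ?T"
    by (intro continuous_open_preimage continuous_on_diff assms) auto
  moreover have "z \<in> ?T" using ne assms(5) by simp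
  ultimately have "\<not> negligible ?T" using open_not_negligible by blast
  moreover have "AE z in lebesgue. z \<notin> ?T" using assms(4) by eventually_elim auto
  then have "?T \<in> null_sets lebesgue"
    using \<open>open ?T\<close> by (subst AE_iff_null_sets) auto
  ultimately show False by (simp add: negligible_iff_null_sets)
qed

text \<open>A cutoff \<open>\<theta>\<close> equal to \<open>1\<close> on a smaller ball gives
  \<open>v = cauchy (v dbar \<theta>)\<close> there, and \<open>v dbar \<theta>\<close> vanishes on
  that ball. Cutoffs are compactly supported, so this yields one holomorphic function for each ball
  of an exhaustion; any two agree on the smaller ball, being continuous and equal almost everywhere,
  and are glued.\<close>

lemma weyl_lemma_dbar:
  assumes v: "has_weak_dbar unit_disk v (\<lambda>_. 0)"
  obtains h where "h holomorphic_on unit_disk" "AE z in lebesgue. z \<in> unit_disk \<longrightarrow> v z = h z"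
proof -
  have ex: "\<exists>h. h holomorphic_on ball 0 r \<and> (AE z in lebesgue. z \<in> ball 0 r \<longrightarrow> v z = h z)" if r: "r < 1" for r
  proof -
    obtain \<theta> where \<theta>: "\<theta> \<in> test_functions unit_disk" "\<And>z. z \<in> ball 0 r \<Longrightarrow> \<theta> z = 1"
      using cutoff_exists[OF r] by blast
    define G where "G = (\<lambda>z. v z * dbar \<theta> z + 0 * \<theta> z)"
    note w = weak_cauchy_pompeiu[OF open_ball v \<theta>(1), folded G_def]
    have "dir_deriv d \<theta> z = 0" if "z \<in> ball 0 r" for z d
    proof (rule dir_deriv_eq)
      have "((\<lambda>_. 1) has_derivative (\<lambda>_. 0)) (at z)" by simp
      then show "(\<theta> has_derivative (\<lambda>_. 0)) (at z)"
        by (rule has_derivative_transform_within_open[where s = "ball 0 r"]) (use \<theta>(2) that in auto)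
    qed
    then have "G z = 0" if "z \<in> ball 0 r" for z using that by (simp add: G_def dbar_def)
    then have "cauchy G holomorphic_on ball 0 r"
      by (intro cauchy_holomorphic_outside_support[OF w(1)]) auto
    moreover have "AE z in lebesgue. z \<in> ball 0 r \<longrightarrow> v z = cauchy G z"
      using w(2) by eventually_elim (use r \<theta>(2) in auto)
    ultimately show ?thesis by blast
  qed
  define r where "r = (\<lambda>n. 1 - inverse (real (Suc n)))"
  have r: "r n < 1" for n by (simp add: r_def)
  have r_mono: "r m \<le> r n" if "m \<le> n" for m n using that by (simp add: r_def le_imp_inverse_le)
  have "\<forall>n. \<exists>h. h holomorphic_on ball 0 (r n) \<and> (AE z in lebesgue. z \<in> ball 0 (r n) \<longrightarrow> v z = h z)"
    using ex r by blast
  then obtain h where h: "\<And>n. h n holomorphic_on ball 0 (r n)"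
    "\<And>n. AE z in lebesgue. z \<in> ball 0 (r n) \<longrightarrow> v z = h n z" by metis
  have agree: "h m z = h n z" if "m \<le> n" "z \<in> ball 0 (r m)" for m n z
  proof (rule continuous_AE_eq_imp_eq[of "ball 0 (r m)" "h m" "h n"])
    show "continuous_on (ball 0 (r m)) (h m)" "continuous_on (ball 0 (r m)) (h n)"
      using holomorphic_on_imp_continuous_on[OF h(1)] r_mono[OF that(1)]
      by (auto intro: continuous_on_subset[OF _ subset_ball])
    show "AE z in lebesgue. z \<in> ball 0 (r m) \<longrightarrow> h m z = h n z"
      using h(2)[of m] h(2)[of n] by eventually_elim (use r_mono[OF that(1)] in auto)
  qed (use that in auto)
  define H where "H = (\<lambda>z. h (LEAST n. z \<in> ball 0 (r n)) z)"
  have H: "H z = h n z" if "z \<in> ball 0 (r n)" for z n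
    unfolding H_def
    by (rule agree[OF Least_le[of "\<lambda>n. z \<in> ball 0 (r n)", OF that] LeastI[of "\<lambda>n. z \<in> ball 0 (r n)", OF that]])
  have cover: "unit_disk = (\<Union>n. ball 0 (r n))"
  proof (intro equalityI subsetI)
    fix z :: complex assume "z \<in> unit_disk"
    then have "1 - norm z > 0" by simp
    then obtain n where "inverse (real (Suc n)) < 1 - norm z" using reals_Archimedean by blast
    then show "z \<in> (\<Union>n. ball 0 (r n))" by (auto simp: r_def intro!: exI[of _ n])
  next
    fix z :: complex assume "z \<in> (\<Union>n. ball 0 (r n))"
    then obtain n where "norm z < r n" by auto
    with r[of n] show "z \<in> unit_disk" by simp
  qed
  have "H holomorphic_on ball 0 (r n)" for n
    using h(1)[of n] by (rule holomorphic_transform) (simp add: H)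
  then have "H holomorphic_on unit_disk"
    unfolding cover by (intro holomorphic_on_UN_open) auto
  moreover have "AE z in lebesgue. \<forall>n. z \<in> ball 0 (r n) \<longrightarrow> v z = h n z"
    using h(2) by (simp add: AE_all_countable)
  then have "AE z in lebesgue. z \<in> unit_disk \<longrightarrow> v z = H z"
    by eventually_elim (use cover H in auto)
  ultimately show ?thesis using that by blast
qed

text \<open>Even the local integrability of \<open>a v\<close> needs an argument, since
  \<open>a\<close> may be unbounded and \<open>v\<close> is merely locally integrable. It comes from
  the same duality: \<open>a\<close> times \<open>cauchy G\<close> is integrable by Fubini's
  theorem, and \<open>cauchy G\<close> is \<open>v \<phi>\<close> almost everywhere in the
  disk.\<close>

lemma weak_dbar_cauchy_mult:
  assumes a: "cauchy_bounded a M" "\<And>z. z \<notin> unit_disk \<Longrightarrow> a z = 0" and v: "has_weak_dbar unit_disk v b"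
  shows "(\<lambda>z. a z * v z) locally_integrable_on unit_disk"
    and "has_weak_dbar unit_disk (\<lambda>z. cauchy a z * v z) (\<lambda>z. a z * v z + cauchy a z * b z)"
proof -
  note i = locally_integrable_mult_test
  note vl = has_weak_dbarD(1)[OF v] and bl = has_weak_dbarD(2)[OF v]
  have am: "a \<in> borel_measurable lebesgue" using a(1) by (simp add: cauchy_bounded_def)
  \<comment> \<open>The identity for \<open>v \<phi>\<close> is known in the disk only; outside it
    both sides vanish with \<open>a\<close>.\<close>
  have ae: "AE z in lebesgue. a z * cauchy (\<lambda>z. v z * dbar \<phi> z + b z * \<phi> z) z = a z * (v z * \<phi> z)"
    if \<phi>: "\<phi> \<in> test_functions unit_disk" for \<phi>
    using weak_cauchy_pompeiu(2)[OF open_ball v \<phi>] by eventually_elim (use a(2) in force)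
  have av: "integrable lebesgue (\<lambda>z. a z * (v z * \<phi> z))" if \<phi>: "\<phi> \<in> test_functions unit_disk" for \<phi>
  proof (rule integrable_cong_AE_imp[OF cauchy_Fubini(2)[OF a(1) weak_cauchy_pompeiu(1)[OF open_ball v \<phi>]]])
    show "(\<lambda>z. a z * (v z * \<phi> z)) \<in> borel_measurable lebesgue"
      by (intro borel_measurable_times[OF am] borel_measurable_integrable i[OF vl \<phi>])
  qed (use ae[OF \<phi>] in auto)
  show avl: "(\<lambda>z. a z * v z) locally_integrable_on unit_disk"
    unfolding locally_integrable_on_def
  proof (intro allI impI)
    fix K :: "complex set" assume K: "compact K \<and> K \<subseteq> unit_disk"
    then have m: "K \<in> sets lebesgue" using lmeasurable_compact by blast
    \<comment> \<open>The cutoffs equal \<open>1\<close> on balls about \<open>0\<close>, so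
      \<open>K\<close> is enclosed in such a ball, with a radius above its largest norm and below
      \<open>1\<close>.\<close>
    obtain r where r: "r < 1" "K \<subseteq> ball 0 r"
    proof (cases "K = {}")
      case False
      obtain x where x: "x \<in> K" "\<And>y. y \<in> K \<Longrightarrow> norm y \<le> norm x"
        using continuous_attains_sup[of K norm] K False continuous_on_norm_id by blast
      then have "norm x < 1" using K by auto
      then obtain r where "norm x < r" "r < 1" using dense by blast
      with x that show ?thesis by fastforce
    qed (use that[of 0] in auto)
    obtain \<theta> where \<theta>: "\<theta> \<in> test_functions unit_disk" "\<And>z. z \<in> ball 0 r \<Longrightarrow> \<theta> z = 1"
      using cutoff_exists[OF r(1)] by blast
    have "integrable lebesgue (\<lambda>z. indicator K z *\<^sub>R (a z * (v z * \<theta> z)))"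
      by (rule integrable_mult_indicator[OF m av[OF \<theta>(1)]])
    moreover have "indicator K z *\<^sub>R (a z * (v z * \<theta> z)) = indicator K z *\<^sub>R (a z * v z)" for z
      using \<theta>(2)[of z] r(2) by (auto simp: indicator_def)
    ultimately show "(\<lambda>z. a z * v z) absolutely_integrable_on K"
      unfolding set_integrable_def by simp
  qed
  have ub: "(\<lambda>z. cauchy a z * f z) locally_integrable_on unit_disk" if "f locally_integrable_on unit_disk" for f
    using that by (rule locally_integrable_bounded_mult[OF _ cauchy_measurable[OF am] norm_cauchy_le[OF a(1)]])
  show "has_weak_dbar unit_disk (\<lambda>z. cauchy a z * v z) (\<lambda>z. a z * v z + cauchy a z * b z)"
    unfolding has_weak_dbar_iff
  proof (intro conjI ballI locally_integrable_add avl ub vl bl)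
    fix \<phi> assume \<phi>: "\<phi> \<in> test_functions unit_disk"
    let ?G = "\<lambda>z. v z * dbar \<phi> z + b z * \<phi> z"
    have i1: "integrable lebesgue (\<lambda>z. cauchy a z * v z * dbar \<phi> z)" by (rule i[OF ub[OF vl] test_dbar[OF \<phi>]])
    have i2: "integrable lebesgue (\<lambda>z. cauchy a z * b z * \<phi> z)" by (rule i[OF ub[OF bl] \<phi>])
    have i3: "integrable lebesgue (\<lambda>z. a z * v z * \<phi> z)" by (rule i[OF avl \<phi>])
    have "(LINT z|lebesgue. cauchy a z * v z * dbar \<phi> z) + (LINT z|lebesgue. cauchy a z * b z * \<phi> z)
        = (LINT z|lebesgue. cauchy a z * ?G z)"
      unfolding Bochner_Integration.integral_add[OF i1 i2, symmetric]
      by (intro Bochner_Integration.integral_cong) (simp_all add: algebra_simps)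
    also have "\<dots> = - (LINT z|lebesgue. a z * cauchy ?G z)"
      by (rule cauchy_Fubini(3)[OF a(1) weak_cauchy_pompeiu(1)[OF open_ball v \<phi>]])
    also have "(LINT z|lebesgue. a z * cauchy ?G z) = (LINT z|lebesgue. a z * (v z * \<phi> z))"
      by (intro integral_cong_AE ae[OF \<phi>] borel_measurable_integrable av[OF \<phi>]
          cauchy_Fubini(2)[OF a(1) weak_cauchy_pompeiu(1)[OF open_ball v \<phi>]])
    finally show "(LINT z|lebesgue. cauchy a z * v z * dbar \<phi> z)
        = - (LINT z|lebesgue. (a z * v z + cauchy a z * b z) * \<phi> z)"
      unfolding distrib_right Bochner_Integration.integral_add[OF i3 i2]
      by (simp add: mult.assoc eq_neg_iff_add_eq_0 algebra_simps)
  qed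
qed

section \<open>The integrating factor and the representation of solutions\<close>

lemma norm_exp_partial_sum_le:
  fixes x :: complex
  shows "norm (\<Sum>k<N. x ^ k /\<^sub>R fact k) \<le> exp (norm x)"
proof -
  have "norm (\<Sum>k<N. x ^ k /\<^sub>R fact k) \<le> (\<Sum>k<N. norm x ^ k /\<^sub>R fact k)"
    by (rule order_trans[OF norm_sum]) (simp add: norm_power)
  also have "\<dots> \<le> exp (norm x)"
    unfolding exp_def by (rule sum_le_suminf[OF summable_exp_generic]) auto
  finally show ?thesis .
qed

text \<open>The product rule applies again to \<open>cauchy a ^ k\<close> times \<open>w\<close>,
  which has a weak derivative by induction. For \<open>k = 0\<close> the truncated exponent
  \<open>k - 1\<close> does no harm, its term having the factor \<open>0\<close>.\<close>

lemma weak_dbar_power_mult: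
  assumes a: "cauchy_bounded a M" "\<And>z. z \<notin> unit_disk \<Longrightarrow> a z = 0" and w: "has_weak_dbar unit_disk w g"
  shows "has_weak_dbar unit_disk (\<lambda>z. cauchy a z ^ k * w z)
    (\<lambda>z. cauchy a z ^ k * g z + of_nat k * cauchy a z ^ (k - 1) * (a z * w z))"
proof (induction k)
  case 0
  then show ?case using w by simp
next
  case (Suc k)
  have eq: "a z * (cauchy a z ^ k * w z) + cauchy a z * (cauchy a z ^ k * g z + of_nat k * cauchy a z ^ (k - 1) * (a z * w z))
      = cauchy a z ^ Suc k * g z + of_nat (Suc k) * cauchy a z ^ (Suc k - 1) * (a z * w z)" for z
    by (cases k) (simp_all add: algebra_simps)
  have eq': "cauchy a z * (cauchy a z ^ k * w z) = cauchy a z ^ Suc k * w z" for z by simp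
  show ?case
    using weak_dbar_cauchy_mult(2)[OF a Suc] unfolding eq eq' .
qed

text \<open>Differentiating the exponential series shifts it by one index, so \<open>a w\<close> is
  multiplied by a partial sum with one term fewer. In the limit both sums give the same
  exponential.\<close>

lemma weak_dbar_exp_partial_sum_mult:
  assumes a: "cauchy_bounded a M" "\<And>z. z \<notin> unit_disk \<Longrightarrow> a z = 0" and w: "has_weak_dbar unit_disk w g"
  shows "has_weak_dbar unit_disk (\<lambda>z. (\<Sum>k<Suc N. (- cauchy a z) ^ k /\<^sub>R fact k) * w z)
    (\<lambda>z. (\<Sum>k<Suc N. (- cauchy a z) ^ k /\<^sub>R fact k) * g z - (\<Sum>k<N. (- cauchy a z) ^ k /\<^sub>R fact k) * (a z * w z))"
proof (induction N)
  case 0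
  then show ?case using w by simp
next
  case (Suc N)
  \<comment> \<open>The coefficient of \<open>cauchy a ^ Suc N\<close> in the series of
    \<open>exp (- cauchy a)\<close>. Multiplied by \<open>Suc N\<close> it is minus the preceding
    coefficient, which makes the sums match.\<close>
  define c :: complex where "c = (- 1) ^ Suc N / fact (Suc N)"
  have c1: "(- u) ^ Suc N /\<^sub>R fact (Suc N) = c * u ^ Suc N" for u :: complex
    by (subst power_minus) (simp add: c_def scaleR_conv_of_real divide_inverse mult_ac)
  have c2: "c * (of_nat (Suc N) * u ^ (Suc N - 1)) = - ((- u) ^ N /\<^sub>R fact N)" for u :: complex
  proof -
    have "fact (Suc N) = of_nat (Suc N) * (fact N :: complex)" by simp
    then have "c * of_nat (Suc N) = - ((- 1) ^ N / fact N)"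
      unfolding c_def by (simp add: field_simps del: of_nat_Suc fact_Suc) 
    then have "c * of_nat (Suc N) * u ^ N = - ((- 1) ^ N / fact N) * u ^ N" by simp
    also have "\<dots> = - ((- u) ^ N /\<^sub>R fact N)"
      by (subst (2) power_minus) (simp add: scaleR_conv_of_real divide_inverse mult_ac)
    finally show ?thesis by (simp add: mult.assoc)
  qed
  have s1: "(\<Sum>k<Suc N. (- u) ^ k /\<^sub>R fact k) * x + c * (u ^ Suc N * x) = (\<Sum>k<Suc (Suc N). (- u) ^ k /\<^sub>R fact k) * x"
    for u x :: complex
    unfolding sum.lessThan_Suc[of _ "Suc N"] c1 by (simp only: distrib_right mult.assoc)
  have s2: "(\<Sum>k<Suc N. (- u) ^ k /\<^sub>R fact k) * y - (\<Sum>k<N. (- u) ^ k /\<^sub>R fact k) * x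
        + c * (u ^ Suc N * y + of_nat (Suc N) * u ^ (Suc N - 1) * x)
      = (\<Sum>k<Suc (Suc N). (- u) ^ k /\<^sub>R fact k) * y - (\<Sum>k<Suc N. (- u) ^ k /\<^sub>R fact k) * x"
    for u x y :: complex
  proof -
    have "c * (u ^ Suc N * y + of_nat (Suc N) * u ^ (Suc N - 1) * x) =
      c * (u ^ Suc N * y) - ((- u) ^ N /\<^sub>R fact N) * x"
      unfolding distrib_left mult.assoc[symmetric, of c] c2[unfolded mult.assoc[symmetric]] by simp
    then show ?thesis
      unfolding s1[symmetric] sum.lessThan_Suc[of "\<lambda>k. (- u) ^ k /\<^sub>R fact k" N] by (simp add: algebra_simps)
  qed
  show ?case
    using has_weak_dbar_add[OF Suc has_weak_dbar_cmult[OF weak_dbar_power_mult[OF a w, of "Suc N"], of c]]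
    unfolding s1 s2 .
qed

lemma integral_exp_partial_sum_tendsto:
  fixes u f :: "complex \<Rightarrow> complex"
  assumes u: "u \<in> borel_measurable lebesgue" "\<And>z. norm (u z) \<le> M" and f: "integrable lebesgue f"
  shows "(\<lambda>N. LINT z|lebesgue. (\<Sum>k<N. (- u z) ^ k /\<^sub>R fact k) * f z) \<longlonglongrightarrow>
    (LINT z|lebesgue. exp (- u z) * f z)"
proof (rule integral_dominated_convergence)
  have fm: "f \<in> borel_measurable lebesgue" using f by simp
  show "(\<lambda>z. exp (- u z) * f z) \<in> borel_measurable lebesgue"
    by (rule borel_measurable_times[OF measurable_compose[OF borel_measurable_uminus[OF u(1)] borel_measurable_exp] fm])
  show "(\<lambda>z. (\<Sum>k<N. (- u z) ^ k /\<^sub>R fact k) * f z) \<in> borel_measurable lebesgue" for N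
    using u(1) by (intro borel_measurable_times fm borel_measurable_sum borel_measurable_scaleR borel_measurable_power) auto
  show "integrable lebesgue (\<lambda>z. exp M * norm (f z))"
    using f by (intro integrable_mult_right integrable_norm)
  show "AE z in lebesgue. (\<lambda>N. (\<Sum>k<N. (- u z) ^ k /\<^sub>R fact k) * f z) \<longlonglongrightarrow> exp (- u z) * f z"
    using exp_converges[of "- u _"] by (intro AE_I2 tendsto_mult tendsto_const) (simp add: sums_def)
  show "AE z in lebesgue. norm ((\<Sum>k<N. (- u z) ^ k /\<^sub>R fact k) * f z) \<le> exp M * norm (f z)" for N
  proof (rule AE_I2)
    fix z
    have "norm (\<Sum>k<N. (- u z) ^ k /\<^sub>R fact k) \<le> exp M"
      using order_trans[OF norm_exp_partial_sum_le] u(2)[of z] by (metis exp_le_cancel_iff norm_minus_cancel)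
    then show "norm ((\<Sum>k<N. (- u z) ^ k /\<^sub>R fact k) * f z) \<le> exp M * norm (f z)"
      unfolding norm_mult by (rule mult_right_mono) simp
  qed
qed

text \<open>The integrating factor. For each fixed test function all integrals in the weak identity
  of the partial sums converge, because the partial sums are uniformly bounded by
  \<open>exp M\<close> and the remaining factors are integrable; the limit of the identity is the
  claim.\<close>

lemma weak_dbar_exp_mult:
  assumes a: "cauchy_bounded a M" "\<And>z. z \<notin> unit_disk \<Longrightarrow> a z = 0" and w: "has_weak_dbar unit_disk w g"
  shows "has_weak_dbar unit_disk (\<lambda>z. exp (- cauchy a z) * w z) (\<lambda>z. exp (- cauchy a z) * (g z - a z * w z))"
proof -
  let ?u = "cauchy a"
  let ?S = "\<lambda>N z. \<Sum>k<N. (- ?u z) ^ k /\<^sub>R fact k"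
  have am: "a \<in> borel_measurable lebesgue" using a(1) by (simp add: cauchy_bounded_def)
  note um = cauchy_measurable[OF am] and ub = norm_cauchy_le[OF a(1)]
  have Em: "(\<lambda>z. exp (- ?u z)) \<in> borel_measurable lebesgue"
    by (rule measurable_compose[OF borel_measurable_uminus[OF um] borel_measurable_exp])
  have Eb: "norm (exp (- ?u z)) \<le> exp M" for z
    using norm_exp[of "- ?u z"] ub[of z] by (metis exp_le_cancel_iff norm_minus_cancel order_trans)
  note wl = has_weak_dbarD(1)[OF w] and gl = has_weak_dbarD(2)[OF w]
  have awl: "(\<lambda>z. a z * w z) locally_integrable_on unit_disk"
    by (rule weak_dbar_cauchy_mult(1)[OF a(1) _ w]) (rule a(2))
  have gaw: "(\<lambda>z. g z - a z * w z) locally_integrable_on unit_disk"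
    using locally_integrable_add[OF gl locally_integrable_cmult[OF awl, of "- 1"]] by simp
  note i = locally_integrable_mult_test
  show ?thesis
    unfolding has_weak_dbar_iff
  proof (intro conjI ballI locally_integrable_bounded_mult[OF _ Em Eb] wl gaw)
    fix \<phi> assume \<phi>: "\<phi> \<in> test_functions unit_disk"
    note j1 = i[OF wl test_dbar[OF \<phi>]] and j2 = i[OF gl \<phi>] and j3 = i[OF awl \<phi>]
    note lim = integral_exp_partial_sum_tendsto[OF um ub]
    have Sint: "integrable lebesgue (\<lambda>z. ?S N z * f z)" if "integrable lebesgue f" for N f
    proof (rule Bochner_Integration.integrable_bound)
      show "integrable lebesgue (\<lambda>z. of_real (exp M) * f z)" using that by (rule integrable_mult_right)
      have "f \<in> borel_measurable lebesgue" using that by simp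
      then show "(\<lambda>z. ?S N z * f z) \<in> borel_measurable lebesgue"
        using um by (intro borel_measurable_times borel_measurable_sum borel_measurable_scaleR borel_measurable_power) auto
      show "AE z in lebesgue. norm (?S N z * f z) \<le> norm (of_real (exp M) * f z)"
      proof (rule AE_I2)
        fix z
        have "norm (?S N z) \<le> exp M"
          using order_trans[OF norm_exp_partial_sum_le] ub[of z] by (metis exp_le_cancel_iff norm_minus_cancel)
        then show "norm (?S N z * f z) \<le> norm (of_real (exp M) * f z)"
          unfolding norm_mult by (intro mult_right_mono) auto
      qed
    qed
    have "(LINT z|lebesgue. ?S (Suc N) z * (w z * dbar \<phi> z)) =
       (LINT z|lebesgue. ?S N z * (a z * w z * \<phi> z)) - (LINT z|lebesgue. ?S (Suc N) z * (g z * \<phi> z))" for N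
    proof -
      have "(LINT z|lebesgue. ?S (Suc N) z * (w z * dbar \<phi> z)) = (LINT z|lebesgue. ?S (Suc N) z * w z * dbar \<phi> z)"
        by (simp only: mult.assoc)
      also have "\<dots> = - (LINT z|lebesgue. (?S (Suc N) z * g z - ?S N z * (a z * w z)) * \<phi> z)"
        by (rule has_weak_dbar_eq[OF weak_dbar_exp_partial_sum_mult[OF a w] \<phi>])
      also have "(\<lambda>z. (?S (Suc N) z * g z - ?S N z * (a z * w z)) * \<phi> z)
          = (\<lambda>z. ?S (Suc N) z * (g z * \<phi> z) - ?S N z * (a z * w z * \<phi> z))"
        by (simp only: left_diff_distrib mult.assoc)
      also have "- integral\<^sup>L lebesgue \<dots> = 
          (LINT z|lebesgue. ?S N z * (a z * w z * \<phi> z)) - (LINT z|lebesgue. ?S (Suc N) z * (g z * \<phi> z))"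
        by (subst Bochner_Integration.integral_diff[OF Sint[OF j2] Sint[OF j3]]) (rule minus_diff_eq)
      finally show ?thesis .
    qed
    then have "(\<lambda>N. LINT z|lebesgue. ?S (Suc N) z * (w z * dbar \<phi> z)) \<longlonglongrightarrow>
        (LINT z|lebesgue. exp (- ?u z) * (a z * w z * \<phi> z)) - (LINT z|lebesgue. exp (- ?u z) * (g z * \<phi> z))"
      using tendsto_diff[OF lim[OF j3] LIMSEQ_Suc[OF lim[OF j2]]] by (simp only:)
    then have "(LINT z|lebesgue. exp (- ?u z) * (w z * dbar \<phi> z)) =
        (LINT z|lebesgue. exp (- ?u z) * (a z * w z * \<phi> z)) - (LINT z|lebesgue. exp (- ?u z) * (g z * \<phi> z))"
      using LIMSEQ_unique[OF LIMSEQ_Suc[OF lim[OF j1]]] by blast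
    moreover have Eint: "integrable lebesgue (\<lambda>z. exp (- ?u z) * f z * \<phi> z)" if "f locally_integrable_on unit_disk" for f
      by (rule i[OF locally_integrable_bounded_mult[OF that Em Eb] \<phi>])
    have "(LINT z|lebesgue. exp (- ?u z) * (g z - a z * w z) * \<phi> z)
        = (LINT z|lebesgue. exp (- ?u z) * g z * \<phi> z) - (LINT z|lebesgue. exp (- ?u z) * (a z * w z) * \<phi> z)"
      unfolding Bochner_Integration.integral_diff[OF Eint[OF gl] Eint[OF awl], symmetric]
      by (intro Bochner_Integration.integral_cong) (simp_all add: algebra_simps)
    ultimately show "(LINT z|lebesgue. exp (- ?u z) * w z * dbar \<phi> z)
        = - (LINT z|lebesgue. exp (- ?u z) * (g z - a z * w z) * \<phi> z)"
      by (simp add: mult.assoc)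
  qed
qed

section \<open>Polynomials in \<open>cnj z\<close> with holomorphic coefficients\<close>

lemma integral_dbar_test:
  assumes "\<phi> \<in> test_functions \<Omega>"
  shows "(LINT z|lebesgue. dbar \<phi> z) = 0"
proof -
  obtain K where K: "smooth \<phi>" "compact K" "K \<subseteq> \<Omega>" "\<And>z. z \<notin> K \<Longrightarrow> \<phi> z = 0"
    using test_functionsE[OF assms] by blast
  obtain L where L: "\<And>x y. norm (\<phi> x - \<phi> y) \<le> L * norm (x - y)" using test_lipschitz[OF assms] by metis
  have d: "AE z in lebesgue. (\<phi> has_derivative (\<lambda>v. dir_deriv v \<phi> z)) (at z)"
    by (intro AE_I2 differentiable_imp_has_derivative_dir_deriv smooth_differentiable[OF K(1)])
  have I: "integrable lebesgue (\<lambda>z. dir_deriv v \<phi> z)" "(LINT z|lebesgue. dir_deriv v \<phi> z) = 0"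
    if "dir_deriv v \<phi> \<in> borel_measurable lebesgue" for v
    by (rule integral_derivative_lipschitz_compact_support[OF L K(2) _ d that], erule K(4))+
  note I1 = I[OF test_measurable[OF test_dir_deriv(1)[OF assms]]]
    and I2 = I[OF test_measurable[OF test_dir_deriv(2)[OF assms]]]
  show ?thesis
    unfolding dbar_alt using I1 I2 by simp
qed

lemma smooth_cnj_power: "smooth (\<lambda>z. cnj z ^ m)"
proof (induction m)
  case (Suc m)
  then show ?case using smooth_cnj by (auto intro: class_C_mult)
qed simp

lemma dbar_cnj_power: "dbar (\<lambda>z. cnj z ^ m) z = of_nat m * cnj z ^ (m - 1)"
proof (induction m)
  case 0
  have "dir_deriv v (\<lambda>z. 1) z = 0" for v by (rule dir_deriv_eq) simp
  then show ?case by (simp add: dbar_def)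
next
  case (Suc m)
  have "dbar (\<lambda>z. cnj z * cnj z ^ m) z = cnj z * (of_nat m * cnj z ^ (m - 1)) + cnj z ^ m"
    using dbar_mult[OF smooth_differentiable[OF smooth_cnj] smooth_differentiable[OF smooth_cnj_power]]
    by (simp add: Suc)
  then show ?case by (cases m) (simp_all add: algebra_simps)
qed

text \<open>Classical integration by parts: \<open>cnj z ^ m * (h z * \<phi> z)\<close> is a test
  function, so the integral of its \<open>dbar\<close> vanishes, and \<open>dbar\<close> sees
  \<open>h\<close> as a constant.\<close>

lemma has_weak_dbar_cnj_power_holomorphic:
  assumes "open \<Omega>" and h: "h holomorphic_on \<Omega>"
  shows "has_weak_dbar \<Omega> (\<lambda>z. cnj z ^ m * h z) (\<lambda>z. of_nat m * cnj z ^ (m - 1) * h z)"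
  unfolding has_weak_dbar_iff
proof (intro conjI ballI locally_integrable_if_continuous continuous_intros holomorphic_on_imp_continuous_on[OF h])
  fix \<phi> assume \<phi>: "\<phi> \<in> test_functions \<Omega>"
  note t = test_holomorphic_mult[OF h assms(1) \<phi>]
  note t' = test_smooth_mult[OF smooth_cnj_power[of m] t]
  have d: "dbar (\<lambda>z. cnj z ^ m * (h z * \<phi> z)) z = cnj z ^ m * h z * dbar \<phi> z + of_nat m * cnj z ^ (m - 1) * h z * \<phi> z" for z
    using dbar_mult[OF smooth_differentiable[OF smooth_cnj_power] smooth_differentiable[OF test_smooth[OF t]]]
    by (simp add: dbar_cnj_power dbar_holomorphic_mult[OF h assms(1) \<phi>])
  have l: "(\<lambda>z. cnj z ^ m * h z) locally_integrable_on \<Omega>" "(\<lambda>z. of_nat m * cnj z ^ (m - 1) * h z) locally_integrable_on \<Omega>"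
    by (intro locally_integrable_if_continuous continuous_intros holomorphic_on_imp_continuous_on[OF h])+
  have "(LINT z|lebesgue. cnj z ^ m * h z * dbar \<phi> z) + (LINT z|lebesgue. of_nat m * cnj z ^ (m - 1) * h z * \<phi> z) = 0"
    using integral_dbar_test[OF t'] 
      Bochner_Integration.integral_add[OF locally_integrable_mult_test[OF l(1) test_dbar[OF \<phi>]] locally_integrable_mult_test[OF l(2) \<phi>]]
    unfolding d by simp
  then show "(LINT z|lebesgue. cnj z ^ m * h z * dbar \<phi> z) = - (LINT z|lebesgue. of_nat m * cnj z ^ (m - 1) * h z * \<phi> z)"
    by (simp add: eq_neg_iff_add_eq_0)
qed

text \<open>Termwise integration in \<open>cnj z\<close>, with the holomorphic coefficients as
  constants. It provides a particular solution, so that an equation with polynomial right-hand side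
  reduces to the homogeneous one.\<close>

lemma has_weak_dbar_cnj_polynomial:
  assumes "open \<Omega>" and h: "\<And>k. k < n \<Longrightarrow> h k holomorphic_on \<Omega>"
  shows "has_weak_dbar \<Omega> (\<lambda>z. \<Sum>k<n. cnj z ^ Suc k * (h k z / of_nat (Suc k))) (\<lambda>z. \<Sum>k<n. cnj z ^ k * h k z)"
  using h
proof (induction n)
  case 0
  then show ?case by (simp add: has_weak_dbar_iff locally_integrable_const)
next
  case (Suc n)
  have "(\<lambda>z. h n z / of_nat (Suc n)) holomorphic_on \<Omega>"
    by (intro holomorphic_intros Suc.prems) (simp_all del: of_nat_Suc)
  from has_weak_dbar_cnj_power_holomorphic[OF assms(1) this, of "Suc n"]
  have "has_weak_dbar \<Omega> (\<lambda>z. cnj z ^ Suc n * (h n z / of_nat (Suc n))) (\<lambda>z. cnj z ^ n * h n z)"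
    by (simp del: of_nat_Suc power_Suc)
  from has_weak_dbar_add[OF Suc.IH this] Suc.prems show ?case by simp
qed

lemma psi_eq_cauchy: "psi A = cauchy (\<lambda>z. indicator unit_disk z *\<^sub>R A z)"
  by (simp add: psi_def cauchy_def set_lebesgue_integral_def fun_eq_iff scaleR_conv_of_real)

text \<open>The first application of the operator is split off: its result \<open>v\<close>
  satisfies the equation of order \<open>n\<close>, hence is \<open>exp (psi A)\<close> times a
  polynomial in \<open>cnj z\<close>. The integrating factor turns this polynomial into the weak
  derivative of \<open>exp (- psi A) w\<close>; subtracting its antiderivative leaves a function to
  which Weyl's lemma applies.\<close>

lemma iterated_dbar_minus_solution:
  assumes a: "cauchy_bounded (\<lambda>z. indicator unit_disk z *\<^sub>R A z) M"
    and "(dbar_minus unit_disk A ^^ n) w (\<lambda>_. 0)"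
  shows "\<exists>h :: nat \<Rightarrow> complex \<Rightarrow> complex. (\<forall>k<n. h k holomorphic_on unit_disk) \<and>
    (AE z in lebesgue. z \<in> unit_disk \<longrightarrow> w z = exp (psi A z) * (\<Sum>k<n. cnj z ^ k * h k z))"
  using assms(2)
proof (induction n arbitrary: w)
  case 0
  then show ?case by simp
next
  case (Suc n)
  then obtain v where v: "dbar_minus unit_disk A w v" "(dbar_minus unit_disk A ^^ n) v (\<lambda>_. 0)"
    by (metis relpowp_Suc_D2)
  from Suc.IH[OF v(2)] obtain h where h: "\<And>k. k < n \<Longrightarrow> h k holomorphic_on unit_disk"
    "AE z in lebesgue. z \<in> unit_disk \<longrightarrow> v z = exp (psi A z) * (\<Sum>k<n. cnj z ^ k * h k z)" by blast
  from v(1) obtain g where g: "has_weak_dbar unit_disk w g"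
    "AE z in lebesgue_on unit_disk. v z = g z - A z * w z"
    unfolding dbar_minus_def by blast
  have g2: "AE z in lebesgue. z \<in> unit_disk \<longrightarrow> v z = g z - A z * w z"
    using g(2) by (subst (asm) AE_restrict_space_iff) auto
  let ?a = "\<lambda>z. indicator unit_disk z *\<^sub>R A z"
  have E: "has_weak_dbar unit_disk (\<lambda>z. exp (- psi A z) * w z) (\<lambda>z. exp (- psi A z) * (g z - ?a z * w z))"
    unfolding psi_eq_cauchy by (rule weak_dbar_exp_mult[OF a _ g(1)]) simp
  let ?q = "\<lambda>z. \<Sum>k<n. cnj z ^ Suc k * (h k z / of_nat (Suc k))"
  let ?p = "\<lambda>z. \<Sum>k<n. cnj z ^ k * h k z"
  have "has_weak_dbar unit_disk ?q ?p"
    by (rule has_weak_dbar_cnj_polynomial[OF open_ball h(1)])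
  from has_weak_dbar_add[OF E has_weak_dbar_cmult[OF this, of "- 1"]]
  have "has_weak_dbar unit_disk (\<lambda>z. exp (- psi A z) * w z + - 1 * ?q z)
      (\<lambda>z. exp (- psi A z) * (g z - ?a z * w z) + - 1 * ?p z)" .
  moreover have "AE z in lebesgue. z \<in> unit_disk \<longrightarrow> exp (- psi A z) * (g z - ?a z * w z) + - 1 * ?p z = 0"
    using h(2) g2
  proof eventually_elim
    case (elim z)
    show ?case
    proof
      assume z: "z \<in> unit_disk"
      have "g z - ?a z * w z = exp (psi A z) * ?p z" using elim z by simp
      then show "exp (- psi A z) * (g z - ?a z * w z) + - 1 * ?p z = 0"
        by (simp add: mult.assoc[symmetric] exp_add[symmetric])
    qed
  qed
  ultimately have "has_weak_dbar unit_disk (\<lambda>z. exp (- psi A z) * w z + - 1 * ?q z) (\<lambda>_. 0)"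
    by (rule has_weak_dbar_AE_0)
  then obtain h0 where h0: "h0 holomorphic_on unit_disk"
    "AE z in lebesgue. z \<in> unit_disk \<longrightarrow> exp (- psi A z) * w z + - 1 * ?q z = h0 z"
    by (rule weyl_lemma_dbar)
  \<comment> \<open>Integration in \<open>cnj z\<close> raises every exponent by one, so
    \<open>h j\<close> returns at index \<open>j + 1\<close>, divided by \<open>j + 1\<close>; the
    holomorphic function from Weyl's lemma fills index \<open>0\<close>.\<close>
  define H where "H = (\<lambda>k z. if k = 0 then h0 z else h (k - 1) z / of_nat k)"
  have "H k holomorphic_on unit_disk" if "k < Suc n" for k
  proof (cases k)
    case 0
    then show ?thesis using h0(1) by (simp add: H_def)
  next
    case (Suc j)
    then show ?thesis using that h(1)[of j] by (auto simp: H_def simp del: of_nat_Suc intro!: holomorphic_intros)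
  qed
  moreover have "AE z in lebesgue. z \<in> unit_disk \<longrightarrow> w z = exp (psi A z) * (\<Sum>k<Suc n. cnj z ^ k * H k z)"
    using h0(2)
  proof eventually_elim
    case (elim z)
    show ?case
    proof
      assume "z \<in> unit_disk"
      then have e: "exp (- psi A z) * w z = h0 z + ?q z" using elim by (simp add: algebra_simps)
      have "w z = exp (psi A z) * (exp (- psi A z) * w z)"
        by (simp add: mult.assoc[symmetric] exp_add[symmetric])
      also have "h0 z + ?q z = (\<Sum>k<Suc n. cnj z ^ k * H k z)"
        unfolding sum.lessThan_Suc_shift by (simp add: H_def del: of_nat_Suc power_Suc)
      then have "exp (- psi A z) * w z = (\<Sum>k<Suc n. cnj z ^ k * H k z)" using e by simp
      finally show "w z = exp (psi A z) * (\<Sum>k<Suc n. cnj z ^ k * H k z)" .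
    qed
  qed
  ultimately show ?case by blast
qed

theorem theorem3p3:
  fixes n :: nat and q :: real and A w :: "complex \<Rightarrow> complex"
  assumes "n > 0"
    and "q > 2"
    and "A \<in> sobolev (n - 1) q unit_disk"
    and "is_solution unit_disk n A w"
  shows "\<exists>h :: nat \<Rightarrow> complex \<Rightarrow> complex.
    (\<forall>k\<in>{0..n - 1}. h k holomorphic_on unit_disk) \<and>
    (AE z in lebesgue_on unit_disk.
       w z = exp (psi A z) * (\<Sum>k = 0..n - 1. cnj z ^ k * h k z))"
proof -
  have "A \<in> Lspace q unit_disk" using assms(3) by (simp add: sobolev_def)
  moreover have "unit_disk \<in> sets lebesgue" by simp
  ultimately obtain M where M: "cauchy_bounded (\<lambda>z. indicator unit_disk z *\<^sub>R A z) M"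
    using cauchy_bounded_Lspace[OF assms(2) _ _ bounded_ball] by blast
  \<comment> \<open>Positivity of \<open>n\<close> matters: for \<open>n = 0\<close> the truncated
    \<open>n - 1\<close> would leave the index \<open>0\<close>.\<close>
  have I: "{0..n - 1} = {..<n}" using assms(1) by auto
  obtain h :: "nat \<Rightarrow> complex \<Rightarrow> complex" where h: "\<forall>k<n. h k holomorphic_on unit_disk"
    "AE z in lebesgue. z \<in> unit_disk \<longrightarrow> w z = exp (psi A z) * (\<Sum>k<n. cnj z ^ k * h k z)"
    using iterated_dbar_minus_solution[OF M assms(4)[unfolded is_solution_def]] by blast
  show ?thesis
    unfolding I using h by (intro exI[of _ h]) (simp add: AE_restrict_space_iff)
qed

end
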